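(* Let $W_n=\frac1{\sqrt n}X_n+A_n$, where $A_n$ is a real symmetric $n\times n$ matrix with eigenvalues $\theta,0,\dots,0$ and $v_1^{(n)}$ is a unit eigenvector of $A_n$ for $\theta$, as described in the context. Then, in probability, the spectral measure $\mu_{(W_n,v_1^{(n)})}$ converges weakly as $n\to\infty$ towards the probability measure $$\mu_{sc,\theta}(dx)=\frac{\sqrt{4-x^2}}{2\pi(\theta^2+1-\theta x)}\mathbf 1_{|x|\le2}\,dx+\mathbf 1_{|\theta|>1}\left(1-\frac1{\theta^2}\right)\delta_{\theta+\frac1\theta}(dx).$$
   Context: For each $n\ge1$, $X_n$ is an $n\times n$ real symmetric random matrix whose entries $X^{(n)}_{ij}$, $1\le i\le j\le n$, are i.i.d. copies of a fixed real random variable $X$ (whose law does not depend on $n$) with $\mathbf E[X]=0$, $\mathbf E[X^2]=1$ and finite moments of all orders. $A_n$ is deterministic (or random and independent of $X_n$), real symmetric, with eigenvalues $\gamma_1^{(n)}=\theta$ and $\gamma_2^{(n)}=\dots=\gamma_n^{(n)}=0$, $\theta\in\mathbf R$ fixed, i.e. $A_n=\theta\,v_1^{(n)}(v_1^{(n)})^T$ with $v_1^{(n)}$ a unit vector (independent of $X_n$). Let $\lambda_1^{(n)}\ge\dots\ge\lambda_n^{(n)}$ be the eigenvalues of $W_n$ and $\phi_1^{(n)},\dots,\phi_n^{(n)}$ an associated orthonormal basis of eigenvectors. The spectral measure in the direction of the spike is $\mu_{(W_n,v_1^{(n)})}=\sum_{i=1}^n|\langle\phi_i^{(n)},v_1^{(n)}\rangle|^2\delta_{\lambda_i^{(n)}}$.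 Weak convergence in probability of random probability measures $\mu_n$ to a deterministic $\mu$ means $\int f\,d\mu_n\to\int f\,d\mu$ in probability for every bounded continuous $f$. A term multiplied by a vanishing indicator is read as $0$. *)

theory Defs
  imports "HOL-Probability.Probability" "Jordan_Normal_Form.Char_Poly"
begin

(* HOL-Analysis and Jordan_Normal_Form overload the same infix symbols for vector entries and
   scalar products, so the constants vec_index and scalar_prod are written out below. *)

definition borel_vec :: "nat \<Rightarrow> real Matrix.vec measure" where
  "borel_vec n =
     vimage_algebra (carrier_vec n) (\<lambda>x. \<lambda>i\<in>{..<n}. vec_index x i) (Pi\<^sub>M {..<n} (\<lambda>_. borel))"

definition borel_mat :: "nat \<Rightarrow> real Matrix.mat measure" where
  "borel_mat n =
     vimage_algebra (carrier_mat n n) (\<lambda>A. \<lambda>ij\<in>{..<n} \<times> {..<n}. index_mat A ij)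
       (Pi\<^sub>M ({..<n} \<times> {..<n}) (\<lambda>_. borel))"

(* The library's indep_var, which requires both variables to have the same type, without that
   restriction; see prob_space.indep_var_eq. *)
definition indep_rv ::
    "'a measure \<Rightarrow> 'b measure \<Rightarrow> ('a \<Rightarrow> 'b) \<Rightarrow> 'c measure \<Rightarrow> ('a \<Rightarrow> 'c) \<Rightarrow> bool" where
  "indep_rv M S Y T Z \<longleftrightarrow>
     Y \<in> measurable M S \<and> Z \<in> measurable M T \<and>
     prob_space.indep_set M {Y -` B \<inter> space M | B. B \<in> sets S} {Z -` B \<inter> space M | B. B \<in> sets T}"

(* Indices run over 0, ..., n - 1. As n orthonormal vectors in dimension n form a basis, ls lists
   the eigenvalues with multiplicity. *)
definition ordered_eigenbasis ::
    "nat \<Rightarrow> real Matrix.mat \<Rightarrow> (nat \<Rightarrow> real) \<Rightarrow> (nat \<Rightarrow> real Matrix.vec) \<Rightarrow> bool" where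
  "ordered_eigenbasis n W ls fs \<longleftrightarrow>
     (\<forall>i<n. \<forall>j<n. i \<le> j \<longrightarrow> ls j \<le> ls i) \<and>
     (\<forall>i<n. fs i \<in> carrier_vec n \<and> eigenvector W (fs i) (ls i)) \<and>
     (\<forall>i<n. \<forall>j<n. scalar_prod (fs i) (fs j) = (if i = j then 1 else 0))"

(* The push-forward under ls of the measure on the indices that gives i the mass <fs i, v>^2,
   i.e. the sum of the point masses <fs i, v>^2 at ls i. *)
definition spectral_measure ::
    "nat \<Rightarrow> (nat \<Rightarrow> real) \<Rightarrow> (nat \<Rightarrow> real Matrix.vec) \<Rightarrow> real Matrix.vec \<Rightarrow> real measure" where
  "spectral_measure n ls fs v =
     distr (point_measure {..<n} (\<lambda>i. ennreal ((scalar_prod (fs i) v)\<^sup>2))) borel ls"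

lemma emeasure_spectral_measure:
  assumes "B \<in> sets borel"
  shows "emeasure (spectral_measure n ls fs v) B =
    (\<Sum>i<n. ennreal ((scalar_prod (fs i) v)\<^sup>2) * emeasure (return borel (ls i)) B)"
proof -
  have "emeasure (spectral_measure n ls fs v) B =
      (\<Sum>i\<in>ls -` B \<inter> {..<n}. ennreal ((scalar_prod (fs i) v)\<^sup>2))"
    unfolding spectral_measure_def using assms
    by (subst emeasure_distr)
       (auto simp: measurable_def sets_point_measure space_point_measure emeasure_point_measure_finite)
  also have "\<dots> = (\<Sum>i<n. ennreal ((scalar_prod (fs i) v)\<^sup>2) * indicator B (ls i))"
    by (rule sum.mono_neutral_cong_left) (auto simp: indicator_def)
  finally show ?thesis using assms by simp
qed

definition mu_sc :: "real \<Rightarrow> real measure" where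
  "mu_sc \<theta> = measure_of UNIV (sets borel) (\<lambda>B.
     (\<integral>\<^sup>+x. ennreal (sqrt (4 - x\<^sup>2) / (2 * pi * (\<theta>\<^sup>2 + 1 - \<theta> * x)) * indicator {x. \<bar>x\<bar> \<le> 2} x)
        * indicator B x \<partial>lborel)
     + (if \<bar>\<theta>\<bar> > 1 then ennreal (1 - 1 / \<theta>\<^sup>2) * emeasure (return borel (\<theta> + 1 / \<theta>)) B else 0))"

lemma emeasure_mu_sc:
  assumes "B \<in> sets borel"
  shows "emeasure (mu_sc \<theta>) B =
    (\<integral>\<^sup>+x. ennreal (sqrt (4 - x\<^sup>2) / (2 * pi * (\<theta>\<^sup>2 + 1 - \<theta> * x)) * indicator {x. \<bar>x\<bar> \<le> 2} x)
        * indicator B x \<partial>lborel)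
     + (if \<bar>\<theta>\<bar> > 1 then ennreal (1 - 1 / \<theta>\<^sup>2) * emeasure (return borel (\<theta> + 1 / \<theta>)) B else 0)"
proof -
  let ?g = "\<lambda>x. ennreal (sqrt (4 - x\<^sup>2) / (2 * pi * (\<theta>\<^sup>2 + 1 - \<theta> * x)) * indicator {x. \<bar>x\<bar> \<le> 2} x)"
  let ?w = "if \<bar>\<theta>\<bar> > 1 then ennreal (1 - 1 / \<theta>\<^sup>2) else 0"
  let ?r = "return borel (\<theta> + 1 / \<theta>)"
  let ?\<mu> = "\<lambda>B. (\<integral>\<^sup>+x. ?g x * indicator B x \<partial>lborel)
     + (if \<bar>\<theta>\<bar> > 1 then ennreal (1 - 1 / \<theta>\<^sup>2) * emeasure ?r B else 0)"
  have g: "?g \<in> borel_measurable lborel" by measurable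
  have eq: "?\<mu> B = emeasure (density lborel ?g) B + ?w * emeasure ?r B" if "B \<in> sets borel" for B
    using that g by (simp add: emeasure_density del: emeasure_return)
  have "countably_additive (sets borel) ?\<mu>"
  proof (rule countably_additiveI)
    fix A :: "nat \<Rightarrow> real set"
    assume A: "range A \<subseteq> sets borel" "disjoint_family A" "\<Union> (range A) \<in> sets borel"
    have 1: "?\<mu> (A i) = emeasure (density lborel ?g) (A i) + ?w * emeasure ?r (A i)" for i
      using A by (intro eq) auto
    have "(\<Sum>i. emeasure (density lborel ?g) (A i)) = emeasure (density lborel ?g) (\<Union> (range A))"
      using A by (intro suminf_emeasure) auto
    moreover have "(\<Sum>i. emeasure ?r (A i)) = emeasure ?r (\<Union> (range A))"
      using A by (intro suminf_emeasure) auto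
    ultimately have "(\<Sum>i. emeasure (density lborel ?g) (A i) + ?w * emeasure ?r (A i)) =
        emeasure (density lborel ?g) (\<Union> (range A)) + ?w * emeasure ?r (\<Union> (range A))"
      by (subst suminf_add[symmetric]) (simp_all del: emeasure_return)
    then show "(\<Sum>i. ?\<mu> (A i)) = ?\<mu> (\<Union> (range A))"
      unfolding 1 eq[OF A(3)] .
  qed
  moreover have "positive (sets borel) ?\<mu>" by (simp add: positive_def)
  ultimately show ?thesis
    unfolding mu_sc_def using assms sets.sigma_algebra_axioms[of "borel :: real measure"]
    by (intro emeasure_measure_of_sigma) auto
qed

(* Each Y n may live on its own probability space M n. Measurability is required because measure
   is 0 on non-measurable sets. Random variables are indexed by n \<ge> 1. *)
definition tendsto_in_prob ::
    "(nat \<Rightarrow> 'a measure) \<Rightarrow> (nat \<Rightarrow> 'a \<Rightarrow> real) \<Rightarrow> real \<Rightarrow> bool" where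
  "tendsto_in_prob M Y c \<longleftrightarrow>
     (\<forall>n\<ge>1. Y n \<in> borel_measurable (M n)) \<and>
     (\<forall>\<epsilon>>0. (\<lambda>n. measure (M n) {\<omega> \<in> space (M n). \<bar>Y n \<omega> - c\<bar> > \<epsilon>}) \<longlonglongrightarrow> 0)"

definition weak_conv_in_prob ::
    "(nat \<Rightarrow> 'a measure) \<Rightarrow> (nat \<Rightarrow> 'a \<Rightarrow> real measure) \<Rightarrow> real measure \<Rightarrow> bool" where
  "weak_conv_in_prob M \<mu> \<nu> \<longleftrightarrow>
     (\<forall>f :: real \<Rightarrow> real. continuous_on UNIV f \<longrightarrow> bounded (range f) \<longrightarrow>
        tendsto_in_prob M (\<lambda>n \<omega>. \<integral>x. f x \<partial>\<mu> n \<omega>) (\<integral>x. f x \<partial>\<nu>))"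

end

(* Let H = X_n / sqrt n with resolvent G(z) = (H - z)^-1, and put q = <v, G v>, m = tr G / n. Expanding
   G in a single matrix entry (a second-order cumulant expansion with exact remainder) gives
   E[(1 + z q + m q) Y] = O(n^(-1/2)) for every bounded statistic Y that depends weakly on each entry;
   the Ward identity makes the error summable, uniformly in the unit vector v. With Y the conjugate of
   m - s and then of q - s, where s^2 + z s + 1 = 0 and Im s > 0, this yields m -> s and q -> s in L^2.
   Since A_n = theta v v^T, the Stieltjes transform of the spectral measure of W_n at v is
   q / (1 + theta q), which tends to s / (1 + theta s), the Stieltjes transform of the limit law.
   Finally, continuous functions of compact support are uniform limits of combinations of Cauchy
   kernels Im (1 / (x - z)), and no mass escapes because the limit law is a probability measure of
   compact support. *)

theory Submission
  imports Defs "Jordan_Normal_Form.Schur_Decomposition"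
begin

section \<open>Resolvents of real symmetric matrices\<close>

text \<open>A crude count fails: third-order errors of size n^(-3/2) at each of the n^2 entries,
  weighted by |v_i|, add up to order 1 for a delocalised v. The errors therefore keep coordinates of
  G v as factors, and Cauchy-Schwarz against the v_i then gains n^(-1/2) for every unit vector v.
  Uniformity in v is used twice: averaging over the coordinate vectors turns the equation for q into
  one for m, and a random v independent of X_n can be frozen by Fubini. The expansion sets an entry
  to 0 instead of differentiating: the resolvent identity is exact, and the zeroed matrix is
  independent of the entry. Testing against the conjugate of the error itself produces squared
  moduli, and stability comes from signs of imaginary parts at every Im z > 0, so that neither
  concentration inequalities nor a large Im z enter. Eigenvalues and eigenvectors carry no
  measurability assumption; integrals against the spectral measure are shown measurable as functions
  of q, or as limits of such functions.\<close>

definition shifted_mat :: "nat \<Rightarrow> complex \<Rightarrow> (nat \<Rightarrow> nat \<Rightarrow> real) \<Rightarrow> complex Matrix.mat" where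
  "shifted_mat n z h = Matrix.mat n n (\<lambda>(i, j). of_real (h i j) - (if i = j then z else 0))"

text \<open>Written with the adjugate, so that the entries are visibly measurable in the entries of h. The
  value is junk (division by 0) unless z lies off the spectrum of h.\<close>
definition resolvent :: "nat \<Rightarrow> complex \<Rightarrow> (nat \<Rightarrow> nat \<Rightarrow> real) \<Rightarrow> nat \<Rightarrow> nat \<Rightarrow> complex" where
  "resolvent n z h i j =
     index_mat (adj_mat (shifted_mat n z h)) (i, j) / Determinant.det (shifted_mat n z h)"

definition sym_on :: "nat \<Rightarrow> (nat \<Rightarrow> nat \<Rightarrow> real) \<Rightarrow> bool" where
  "sym_on n h \<longleftrightarrow> (\<forall>i<n. \<forall>j<n. h i j = h j i)"

definition res_vec ::
    "nat \<Rightarrow> complex \<Rightarrow> (nat \<Rightarrow> nat \<Rightarrow> real) \<Rightarrow> (nat \<Rightarrow> real) \<Rightarrow> nat \<Rightarrow> complex" where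
  "res_vec n z h v i = (\<Sum>j<n. resolvent n z h i j * of_real (v j))"

definition res_quad ::
    "nat \<Rightarrow> complex \<Rightarrow> (nat \<Rightarrow> nat \<Rightarrow> real) \<Rightarrow> (nat \<Rightarrow> real) \<Rightarrow> complex" where
  "res_quad n z h v = (\<Sum>i<n. of_real (v i) * res_vec n z h v i)"

definition res_trace :: "nat \<Rightarrow> complex \<Rightarrow> (nat \<Rightarrow> nat \<Rightarrow> real) \<Rightarrow> complex" where
  "res_trace n z h = (\<Sum>i<n. resolvent n z h i i) / of_nat n"

lemma shifted_mat_carrier [simp]: "shifted_mat n z h \<in> carrier_mat n n"
  by (simp add: shifted_mat_def)

lemma shifted_mat_entry:
  "i < n \<Longrightarrow> j < n \<Longrightarrow>
    index_mat (shifted_mat n z h) (i, j) = of_real (h i j) - (if i = j then z else 0)"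
  by (simp add: shifted_mat_def)

lemma Im_zero_if_cnj_eq: "cnj x = x \<Longrightarrow> Im x = 0"
  by (simp add: complex_eq_iff)

lemma real_quadratic_form:
  fixes w :: "nat \<Rightarrow> complex"
  assumes "sym_on n h"
  shows "Im (\<Sum>i<n. cnj (w i) * (\<Sum>j<n. of_real (h i j) * w j)) = 0"
proof -
  let ?S = "\<Sum>i<n. \<Sum>j<n. cnj (w i) * (of_real (h i j) * w j)"
  have "cnj ?S = (\<Sum>i<n. \<Sum>j<n. w i * (of_real (h i j) * cnj (w j)))"
    by simp
  also have "\<dots> = (\<Sum>j<n. \<Sum>i<n. w i * (of_real (h i j) * cnj (w j)))"
    by (rule sum.swap)
  also have "\<dots> = ?S"
    using assms by (intro sum.cong refl) (auto simp: sym_on_def)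
  finally have "Im ?S = 0"
    using Im_zero_if_cnj_eq by blast
  then show ?thesis by (simp only: sum_distrib_left)
qed

text \<open>If w solves (h - z) w = b, pairing with the conjugate of w makes the term in h real, so
  only Im z times the squared norm survives. Taking b = 0 gives invertibility, b = v the Ward
  identity.\<close>

lemma ward_aux:
  fixes w b :: "nat \<Rightarrow> complex"
  assumes "sym_on n h" and "\<And>i. i < n \<Longrightarrow> (\<Sum>j<n. of_real (h i j) * w j) = z * w i + b i"
  shows "Im (\<Sum>i<n. cnj (w i) * b i) = - Im z * (\<Sum>i<n. (cmod (w i))\<^sup>2)"
proof -
  have "0 = Im (\<Sum>i<n. cnj (w i) * (z * w i + b i))"
    using real_quadratic_form[OF assms(1), of w] assms(2) by simp
  also have "(\<Sum>i<n. cnj (w i) * (z * w i + b i))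
      = z * of_real (\<Sum>i<n. (cmod (w i))\<^sup>2) + (\<Sum>i<n. cnj (w i) * b i)"
  proof -
    have "cnj (w i) * (z * w i + b i) = z * of_real ((cmod (w i))\<^sup>2) + cnj (w i) * b i" for i
      unfolding complex_norm_square by (simp add: algebra_simps)
    then show ?thesis by (simp add: sum.distrib sum_distrib_left)
  qed
  finally show ?thesis by simp
qed

text \<open>A kernel vector would solve the equation of \<open>ward_aux\<close> with b = 0 and so
  have norm 0. Hence the quotient defining \<open>resolvent\<close> is genuine in the upper
  half-plane.\<close>

lemma det_shifted_mat_nonzero:
  assumes "sym_on n h" and "Im z > 0"
  shows "Determinant.det (shifted_mat n z h) \<noteq> 0"
proof
  assume "Determinant.det (shifted_mat n z h) = 0"
  then obtain x where x: "x \<in> carrier_vec n" "x \<noteq> 0\<^sub>v n"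
      "shifted_mat n z h *\<^sub>v x = 0\<^sub>v n"
    using det_0_iff_vec_prod_zero[OF shifted_mat_carrier[of n z h]] by blast
  define w where "w = (\<lambda>i. vec_index x i)"
  have "(\<Sum>j<n. of_real (h i j) * w j) = z * w i + 0" if "i < n" for i
  proof -
    have "0 = vec_index (shifted_mat n z h *\<^sub>v x) i" using x that by simp
    also have "\<dots> = (\<Sum>j<n. (of_real (h i j) - (if i = j then z else 0)) * w j)"
      using x(1) that
      by (auto simp: shifted_mat_def scalar_prod_def w_def atLeast0LessThan intro!: sum.cong)
    also have "\<dots> = (\<Sum>j<n. of_real (h i j) * w j) - (\<Sum>j<n. if i = j then z * w j else 0)"
      by (subst sum_subtractf[symmetric]) (auto intro!: sum.cong simp: algebra_simps)
    finally show ?thesis using that by simp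
  qed
  from ward_aux[OF assms(1) this] have "(\<Sum>i<n. (cmod (w i))\<^sup>2) = 0"
    using assms(2) by simp
  then have "\<forall>i<n. w i = 0" by (simp add: sum_nonneg_eq_0_iff)
  then have "x = 0\<^sub>v n" using x(1) by (intro eq_vecI) (auto simp: w_def)
  then show False using x by simp
qed

text \<open>Division of \<open>A * adj A = det A = adj A * A\<close> by the determinant. The forms h
  G = 1 + z G and G h = 1 + z G are the ones by which h is eliminated later.\<close>

lemma
  assumes "sym_on n h" and "Im z > 0" and "i < n" and "j < n"
  shows resolvent_right: "(\<Sum>k<n. of_real (h i k) * resolvent n z h k j)
      = z * resolvent n z h i j + (if i = j then 1 else 0)"
    and resolvent_left: "(\<Sum>k<n. resolvent n z h i k * of_real (h k j))
      = z * resolvent n z h i j + (if i = j then 1 else 0)"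
proof -
  let ?A = "shifted_mat n z h"
  let ?d = "Determinant.det ?A"
  have d: "?d \<noteq> 0" using det_shifted_mat_nonzero assms by blast
  note adj = adj_mat[OF shifted_mat_carrier[of n z h]]
  have adj': "dim_row (adj_mat ?A) = n" "dim_col (adj_mat ?A) = n" using adj(1) by auto
  have "index_mat (?A * adj_mat ?A) (i, j) / ?d = (if i = j then 1 else 0)"
    using assms d by (simp add: adj(2))
  moreover have "index_mat (?A * adj_mat ?A) (i, j) / ?d
      = (\<Sum>k<n. (of_real (h i k) - (if i = k then z else 0)) * resolvent n z h k j)"
    using assms(3,4) adj'
    by (simp add: scalar_prod_def resolvent_def sum_divide_distrib atLeast0LessThan
        shifted_mat_entry carrier_matD[OF shifted_mat_carrier])
  moreover have "\<dots> = (\<Sum>k<n. of_real (h i k) * resolvent n z h k j)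
      - (\<Sum>k<n. if i = k then z * resolvent n z h k j else 0)"
    by (subst sum_subtractf[symmetric]) (auto intro!: sum.cong simp: algebra_simps)
  ultimately show "(\<Sum>k<n. of_real (h i k) * resolvent n z h k j)
      = z * resolvent n z h i j + (if i = j then 1 else 0)"
    using assms(3) by (simp add: algebra_simps)
  have "index_mat (adj_mat ?A * ?A) (i, j) / ?d = (if i = j then 1 else 0)"
    using assms d by (simp add: adj(3))
  moreover have "index_mat (adj_mat ?A * ?A) (i, j) / ?d
      = (\<Sum>k<n. resolvent n z h i k * (of_real (h k j) - (if k = j then z else 0)))"
    using assms(3,4) adj'
    by (simp add: scalar_prod_def resolvent_def sum_divide_distrib atLeast0LessThan
        shifted_mat_entry carrier_matD[OF shifted_mat_carrier])
  moreover have "\<dots> = (\<Sum>k<n. resolvent n z h i k * of_real (h k j))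
      - (\<Sum>k<n. if k = j then z * resolvent n z h i k else 0)"
    by (subst sum_subtractf[symmetric]) (auto intro!: sum.cong simp: algebra_simps)
  ultimately show "(\<Sum>k<n. resolvent n z h i k * of_real (h k j))
      = z * resolvent n z h i j + (if i = j then 1 else 0)"
    using assms(4) by (simp add: algebra_simps)
qed

lemma sum_delta_mult:
  fixes f :: "nat \<Rightarrow> complex"
  assumes "j < n"
  shows "(\<Sum>k<n. f k * (if k = j then 1 else 0)) = f j"
    and "(\<Sum>k<n. (if k = j then 1 else 0) * f k) = f j"
    and "(\<Sum>k<n. (if j = k then 1 else 0) * f k) = f j"
    and "(\<Sum>k<n. f k * (if j = k then 1 else 0)) = f j"
  using assms by (simp_all add: if_distrib if_distribR cong: if_cong)

text \<open>In G' h G and G' h' G the products are evaluated by h G = 1 + z G and G' h' = 1 + z G';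
  the terms z G' G cancel in the difference.\<close>

lemma resolvent_diff:
  assumes "sym_on n h" "sym_on n h'" and "Im z > 0" and "i < n" and "j < n"
  shows "resolvent n z h' i j - resolvent n z h i j
    = (\<Sum>k<n. \<Sum>l<n. resolvent n z h' i k * of_real (h k l - h' k l) * resolvent n z h l j)"
proof -
  let ?G = "resolvent n z h" and ?G' = "resolvent n z h'"
  have "(\<Sum>k<n. \<Sum>l<n. ?G' i k * of_real (h k l) * ?G l j)
      = (\<Sum>k<n. ?G' i k * (z * ?G k j + (if k = j then 1 else 0)))"
    using assms by (simp flip: resolvent_right add: sum_distrib_left mult.assoc)
  also have "\<dots> = (\<Sum>k<n. ?G' i k * (z * ?G k j)) + ?G' i j"
    using assms(5) by (simp add: algebra_simps sum.distrib sum_delta_mult del: mult_if_delta)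
  finally have 1: "(\<Sum>k<n. \<Sum>l<n. ?G' i k * of_real (h k l) * ?G l j)
      = (\<Sum>k<n. ?G' i k * (z * ?G k j)) + ?G' i j" .
  have "(\<Sum>k<n. \<Sum>l<n. ?G' i k * of_real (h' k l) * ?G l j)
      = (\<Sum>l<n. (\<Sum>k<n. ?G' i k * of_real (h' k l)) * ?G l j)"
    by (subst sum.swap) (simp add: sum_distrib_right)
  also have "\<dots> = (\<Sum>l<n. (z * ?G' i l + (if i = l then 1 else 0)) * ?G l j)"
    using assms by (simp add: resolvent_left)
  also have "\<dots> = (\<Sum>k<n. ?G' i k * (z * ?G k j)) + ?G i j"
    using assms(4) by (simp add: algebra_simps sum.distrib sum_delta_mult del: mult_if_delta)
  finally show ?thesis using 1
    by (simp add: algebra_simps sum_subtractf)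
qed

text \<open>The left inverse equation evaluates G h G^T in two ways: as z G G^T + G when applied to
  the second factor, and as z G G^T + G^T when applied to the first.\<close>

lemma resolvent_sym:
  assumes "sym_on n h" and "Im z > 0" and "i < n" and "j < n"
  shows "resolvent n z h i j = resolvent n z h j i"
proof -
  let ?G = "resolvent n z h"
  have "(\<Sum>k<n. ?G i k * (\<Sum>l<n. ?G j l * of_real (h l k)))
      = (\<Sum>k<n. ?G i k * (\<Sum>l<n. of_real (h k l) * ?G j l))"
  proof (intro sum.cong[OF refl] arg_cong[of _ _ "(*) _"])
    fix k l assume "k \<in> {..<n}" "l \<in> {..<n}"
    then show "?G j l * of_real (h l k) = of_real (h k l) * ?G j l"
      using assms(1) by (simp add: sym_on_def)
  qed
  also have "\<dots> = (\<Sum>l<n. (\<Sum>k<n. ?G i k * of_real (h k l)) * ?G j l)"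
    by (simp add: sum_distrib_left sum_distrib_right mult.assoc) (rule sum.swap)
  finally have eq: "(\<Sum>k<n. ?G i k * (\<Sum>l<n. ?G j l * of_real (h l k)))
      = (\<Sum>l<n. (\<Sum>k<n. ?G i k * of_real (h k l)) * ?G j l)" .
  have "(\<Sum>k<n. ?G i k * (\<Sum>l<n. ?G j l * of_real (h l k)))
      = (\<Sum>k<n. ?G i k * (z * ?G j k + (if j = k then 1 else 0)))"
    by (intro sum.cong refl) (simp add: resolvent_left[OF assms(1,2,4)])
  moreover have "(\<Sum>l<n. (\<Sum>k<n. ?G i k * of_real (h k l)) * ?G j l)
      = (\<Sum>l<n. (z * ?G i l + (if i = l then 1 else 0)) * ?G j l)"
    by (intro sum.cong refl) (simp add: resolvent_left[OF assms(1,2,3)])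
  ultimately have "(\<Sum>k<n. ?G i k * (z * ?G j k + (if j = k then 1 else 0)))
      = (\<Sum>l<n. (z * ?G i l + (if i = l then 1 else 0)) * ?G j l)"
    using eq by simp
  then show ?thesis
    using assms(3,4) by (simp add: algebra_simps sum.distrib sum_delta_mult del: mult_if_delta)
qed

section \<open>The resolvent applied to a vector: Ward identity and uniform bounds\<close>

lemma res_vec_eq:
  assumes "sym_on n h" and "Im z > 0" and "i < n"
  shows "(\<Sum>j<n. of_real (h i j) * res_vec n z h v j) = z * res_vec n z h v i + of_real (v i)"
proof -
  have "(\<Sum>j<n. of_real (h i j) * res_vec n z h v j)
      = (\<Sum>k<n. (\<Sum>j<n. of_real (h i j) * resolvent n z h j k) * of_real (v k))"
    by (simp add: res_vec_def sum_distrib_left sum_distrib_right mult.assoc) (rule sum.swap)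
  also have "\<dots> = (\<Sum>k<n. (z * resolvent n z h i k + (if i = k then 1 else 0)) * of_real (v k))"
    using assms by (simp add: resolvent_right)
  also have "\<dots> = z * res_vec n z h v i + of_real (v i)"
    using assms(3)
    by (simp add: algebra_simps sum.distrib sum_delta_mult res_vec_def sum_distrib_left
        del: mult_if_delta)
  finally show ?thesis .
qed

text \<open>The Ward identity, from \<open>ward_aux\<close> with b = v real. The coordinates of G v
  are square-summable without any factor n, and the sign of Im q is fixed.\<close>

lemma Im_res_quad:
  assumes "sym_on n h" and "Im z > 0"
  shows "Im (res_quad n z h v) = Im z * (\<Sum>i<n. (cmod (res_vec n z h v i))\<^sup>2)"
proof -
  have "Im (\<Sum>i<n. cnj (res_vec n z h v i) * of_real (v i)) = - Im (res_quad n z h v)"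
    by (simp add: res_quad_def Im_sum sum_negf mult.commute)
  with ward_aux[OF assms(1) res_vec_eq[OF assms]] show ?thesis by simp
qed

lemma Cauchy_Schwarz_sum_complex:
  fixes w :: "nat \<Rightarrow> complex"
  shows "(cmod (\<Sum>i<n. of_real (v i) * w i))\<^sup>2 \<le> (\<Sum>i<n. (v i)\<^sup>2) * (\<Sum>i<n. (cmod (w i))\<^sup>2)"
proof -
  have "cmod (\<Sum>i<n. of_real (v i) * w i) \<le> (\<Sum>i<n. \<bar>v i\<bar> * cmod (w i))"
    by (rule order_trans[OF norm_sum]) (simp add: norm_mult)
  then have "(cmod (\<Sum>i<n. of_real (v i) * w i))\<^sup>2 \<le> (\<Sum>i<n. \<bar>v i\<bar> * cmod (w i))\<^sup>2"
    by (intro power_mono) auto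
  also have "\<dots> \<le> (\<Sum>i<n. \<bar>v i\<bar>\<^sup>2) * (\<Sum>i<n. (cmod (w i))\<^sup>2)"
    by (rule Cauchy_Schwarz_ineq_sum)
  finally show ?thesis by simp
qed

text \<open>For w = G v one has Im z |w|^2 = Im q <= |q| <= |v| |w|, after which |w| cancels. This
  is the operator norm bound for G, obtained without the spectral theorem.\<close>

lemma ward:
  assumes "sym_on n h" and "Im z > 0"
  shows "(\<Sum>i<n. (cmod (res_vec n z h v i))\<^sup>2) \<le> (\<Sum>i<n. (v i)\<^sup>2) / (Im z)\<^sup>2"
proof -
  let ?S = "\<Sum>i<n. (cmod (res_vec n z h v i))\<^sup>2" and ?V = "\<Sum>i<n. (v i)\<^sup>2"
  have S: "?S \<ge> 0" by (simp add: sum_nonneg)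
  have "Im z * ?S \<le> cmod (res_quad n z h v)"
    using Im_res_quad[OF assms, of v] abs_Im_le_cmod[of "res_quad n z h v"] by linarith
  then have "(Im z * ?S)\<^sup>2 \<le> (cmod (res_quad n z h v))\<^sup>2"
    using assms(2) S by (intro power_mono) auto
  also have "\<dots> \<le> ?V * ?S"
    unfolding res_quad_def by (rule Cauchy_Schwarz_sum_complex)
  finally have le: "(Im z)\<^sup>2 * ?S * ?S \<le> ?V * ?S" by (simp add: power2_eq_square algebra_simps)
  show ?thesis
  proof (cases "?S = 0")
    case True then show ?thesis by (simp only: True) (simp add: sum_nonneg)
  next
    case False
    then have "(Im z)\<^sup>2 * ?S \<le> ?V" using le S by (simp add: mult_le_cancel_right)
    then show ?thesis using assms(2) by (simp add: field_simps)
  qed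
qed

lemma res_vec_bound:
  assumes "sym_on n h" and "Im z > 0" and "(\<Sum>i<n. (v i)\<^sup>2) = 1" and "i < n"
  shows "cmod (res_vec n z h v i) \<le> 1 / Im z"
proof -
  have "(cmod (res_vec n z h v i))\<^sup>2 \<le> (\<Sum>i<n. (cmod (res_vec n z h v i))\<^sup>2)"
    using assms(4) by (intro member_le_sum) auto
  also have "\<dots> \<le> (1 / Im z)\<^sup>2" using ward[OF assms(1,2), of v] assms(3) by (simp add: power_divide)
  finally show ?thesis using assms(2) power2_le_imp_le by fastforce
qed

text \<open>Coordinate vectors turn the bounds for \<open>res_vec\<close> and
  \<open>res_quad\<close> into bounds for single entries; averaging over them later yields the
  equation for the trace.\<close>

lemma res_vec_unit:
  assumes "j < n"
  shows "res_vec n z h (\<lambda>k. if k = j then 1 else 0) i = resolvent n z h i j"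
    and "res_quad n z h (\<lambda>k. if k = j then 1 else 0) = resolvent n z h j j"
    and "(\<Sum>i<n. (if i = j then 1 else 0 :: real)\<^sup>2) = 1"
proof -
  show *: "res_vec n z h (\<lambda>k. if k = j then 1 else 0) i = resolvent n z h i j" for i
    using assms by (simp add: res_vec_def if_distrib cong: if_cong)
  show "res_quad n z h (\<lambda>k. if k = j then 1 else 0) = resolvent n z h j j"
    using assms by (simp add: res_quad_def * if_distrib if_distribR cong: if_cong)
  show "(\<Sum>i<n. (if i = j then 1 else 0 :: real)\<^sup>2) = 1"
    using assms by (simp add: if_distrib[of "\<lambda>x. x ^ _"] cong: if_cong)
qed

lemma resolvent_bound:
  assumes "sym_on n h" and "Im z > 0" and "i < n" and "j < n"
  shows "cmod (resolvent n z h i j) \<le> 1 / Im z"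
  using res_vec_bound[OF assms(1,2) res_vec_unit(3)[OF assms(4)] assms(3)] res_vec_unit(1)[OF assms(4)]
  by metis

lemma res_quad_bound:
  assumes "sym_on n h" and "Im z > 0" and "(\<Sum>i<n. (v i)\<^sup>2) = 1"
  shows "cmod (res_quad n z h v) \<le> 1 / Im z"
proof -
  have "(cmod (res_quad n z h v))\<^sup>2 \<le> (1 / Im z)\<^sup>2"
    using Cauchy_Schwarz_sum_complex[of v "res_vec n z h v" n] ward[OF assms(1,2), of v] assms(3)
    by (simp add: res_quad_def power_divide)
  then show ?thesis using assms(2) power2_le_imp_le by fastforce
qed

lemma res_trace_bound:
  assumes "sym_on n h" and "Im z > 0"
  shows "cmod (res_trace n z h) \<le> 1 / Im z"
proof (cases "n = 0")
  case False
  have "cmod (\<Sum>i<n. resolvent n z h i i) \<le> of_nat (card {..<n}) * (1 / Im z)"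
    by (rule sum_norm_bound) (use assms resolvent_bound in auto)
  then show ?thesis using False by (simp add: res_trace_def norm_divide field_simps)
qed (use assms in \<open>simp add: res_trace_def\<close>)

text \<open>Each diagonal entry is a quadratic form at a coordinate vector, whose imaginary part the
  Ward identity makes nonnegative. This sign later keeps the factor m + z + s away from 0.\<close>

lemma Im_res_trace_nonneg:
  assumes "sym_on n h" and "Im z > 0"
  shows "Im (res_trace n z h) \<ge> 0"
proof -
  have "Im (resolvent n z h i i) \<ge> 0" if "i < n" for i
    using Im_res_quad[OF assms, of "\<lambda>k. if k = i then 1 else 0"] res_vec_unit(2)[OF that] assms(2)
    by (simp add: sum_nonneg)
  then show ?thesis by (auto simp: res_trace_def Im_sum intro!: sum_nonneg divide_nonneg_nonneg)
qed

section \<open>Measurability of the resolvent in the matrix entries\<close>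

lemma measurable_det:
  assumes "\<And>i j. i < n \<Longrightarrow> j < n \<Longrightarrow> (\<lambda>\<omega>. index_mat (F \<omega>) (i, j)) \<in> borel_measurable M"
    and "\<And>\<omega>. F \<omega> \<in> carrier_mat n n"
  shows "(\<lambda>\<omega>. Determinant.det (F \<omega>) :: complex) \<in> borel_measurable M"
proof -
  have "(\<lambda>\<omega>. \<Sum>p | p permutes {0..<n}. signof p * (\<Prod>i = 0..<n. index_mat (F \<omega>) (i, p i)))
      \<in> borel_measurable M"
    using assms(1) permutes_in_image
    by (intro borel_measurable_sum borel_measurable_times borel_measurable_prod
        borel_measurable_const) force+
  then show ?thesis using det_def'[OF assms(2)] by (simp cong: measurable_cong)
qed

text \<open>An entry is a signed minor over a determinant, both polynomial in the entries of h;
  totality of division takes care of singular matrices.\<close>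

lemma measurable_resolvent:
  assumes h: "\<And>i j. i < n \<Longrightarrow> j < n \<Longrightarrow> (\<lambda>\<omega>. h \<omega> i j) \<in> borel_measurable M"
    and ij: "i < n" "j < n"
  shows "(\<lambda>\<omega>. resolvent n z (h \<omega>) i j) \<in> borel_measurable M"
proof -
  let ?A = "\<lambda>\<omega>. shifted_mat n z (h \<omega>)"
  have A: "(\<lambda>\<omega>. index_mat (?A \<omega>) (k, l)) \<in> borel_measurable M" if "k < n" "l < n" for k l
    using that h by (simp add: shifted_mat_def)
  have "(\<lambda>\<omega>. index_mat (mat_delete (?A \<omega>) j i) (k, l)) \<in> borel_measurable M"
    if kl: "k < n - 1" "l < n - 1" for k l
  proof -
    have "index_mat (mat_delete (?A \<omega>) j i) (k, l)
        = index_mat (?A \<omega>) (insert_index j k, insert_index i l)" for \<omega>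
      using mat_delete_index[of "?A \<omega>" "n - 1" j i k l] ij kl by simp
    moreover have "insert_index j k < n" "insert_index i l < n"
      using kl by (auto simp: insert_index_def)
    ultimately show ?thesis using A by simp
  qed
  then have 1: "(\<lambda>\<omega>. Determinant.det (mat_delete (?A \<omega>) j i)) \<in> borel_measurable M"
    using mat_delete_carrier[OF shifted_mat_carrier] by (rule measurable_det)
  have "(\<lambda>\<omega>. Determinant.det (?A \<omega>)) \<in> borel_measurable M"
    by (rule measurable_det[OF A]) auto
  moreover have "resolvent n z (h \<omega>) i j
      = (-1) ^ (j + i) * Determinant.det (mat_delete (?A \<omega>) j i) / Determinant.det (?A \<omega>)" for \<omega>
    using ij by (simp add: resolvent_def adj_mat_def cofactor_def shifted_mat_def)
  ultimately show ?thesis using 1 by simp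
qed

text \<open>With w = G v, testing the eigenvector equation against w gives (l_k - z) <f_k, w> = (1 +
  theta q) <f_k, v>, and completeness gives q as the sum of <f_k, v> <f_k, w>. The multiplied form
  avoids dividing by 1 + theta q, whose nonvanishing is derived from it afterwards.\<close>

lemma res_quad_rank_one:
  fixes h :: "nat \<Rightarrow> nat \<Rightarrow> real" and f :: "nat \<Rightarrow> nat \<Rightarrow> real"
  assumes h: "sym_on n h" and z: "Im z > 0" and v: "(\<Sum>i<n. (v i)\<^sup>2) = 1"
    and eig: "\<And>k i. k < n \<Longrightarrow> i < n \<Longrightarrow>
      (\<Sum>j<n. (h i j + \<theta> * v i * v j) * f k j) = l k * f k i"
    and complete: "\<And>i j. i < n \<Longrightarrow> j < n \<Longrightarrow> (\<Sum>k<n. f k i * f k j) = (if i = j then 1 else 0)"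
  defines "q \<equiv> res_quad n z h v"
    and "Q \<equiv> \<Sum>k<n. of_real ((\<Sum>i<n. f k i * v i)\<^sup>2) / (of_real (l k) - z)"
  shows "q = (1 + of_real \<theta> * q) * Q"
proof -
  define w where "w = res_vec n z h v"
  define c where "c k = complex_of_real (\<Sum>i<n. f k i * v i)" for k
  define d where "d k = (\<Sum>i<n. of_real (f k i) * w i)" for k
  have q: "q = (\<Sum>i<n. of_real (v i) * w i)" by (simp add: q_def res_quad_def w_def)
  have dk: "(of_real (l k) - z) * d k = (1 + of_real \<theta> * q) * c k" if k: "k < n" for k
  proof -
    have "of_real (l k) * d k
        = (\<Sum>i<n. of_real (\<Sum>j<n. (h i j + \<theta> * v i * v j) * f k j) * w i)"
      using eig[OF k] by (simp add: d_def sum_distrib_left mult.assoc)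
    also have "\<dots> = (\<Sum>i<n. \<Sum>j<n. of_real (h i j) * of_real (f k j) * w i)
        + (\<Sum>i<n. \<Sum>j<n. of_real (\<theta> * v i * v j) * of_real (f k j) * w i)"
      by (simp add: sum.distrib sum_distrib_right sum_distrib_left algebra_simps)
    \<comment> \<open>Symmetry moves h from f_k to w, where (h - z) w = v applies.\<close>
    also have "(\<Sum>i<n. \<Sum>j<n. of_real (h i j) * of_real (f k j) * w i)
        = (\<Sum>j<n. of_real (f k j) * (\<Sum>i<n. of_real (h j i) * w i))"
      using h by (subst sum.swap)
        (auto simp: sum_distrib_left sym_on_def algebra_simps intro!: sum.cong)
    also have "\<dots> = (\<Sum>j<n. of_real (f k j) * (z * w j + of_real (v j)))"
      unfolding w_def by (intro sum.cong refl) (simp add: res_vec_eq[OF h z])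
    also have "\<dots> = z * d k + c k"
      by (simp add: d_def c_def sum.distrib sum_distrib_left algebra_simps)
    also have "(\<Sum>i<n. \<Sum>j<n. of_real (\<theta> * v i * v j) * of_real (f k j) * w i)
        = of_real \<theta> * q * c k"
      unfolding q c_def by (simp add: sum_product sum_distrib_left algebra_simps)
    finally show ?thesis by (simp add: algebra_simps)
  qed
  have lz: "of_real (l k) - z \<noteq> 0" for k
    using z by (auto simp: complex_eq_iff)
  have "(\<Sum>k<n. c k * d k)
      = (\<Sum>k<n. \<Sum>i<n. \<Sum>j<n. of_real (f k i * f k j) * (of_real (v i) * w j))"
    unfolding c_def d_def of_real_sum sum_product by (intro sum.cong refl) simp
  also have "\<dots> = (\<Sum>i<n. \<Sum>k<n. \<Sum>j<n. of_real (f k i * f k j) * (of_real (v i) * w j))"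
    by (rule sum.swap)
  also have "\<dots> = (\<Sum>i<n. \<Sum>j<n. \<Sum>k<n. of_real (f k i * f k j) * (of_real (v i) * w j))"
    by (rule sum.cong[OF refl], rule sum.swap)
  also have "\<dots> = (\<Sum>i<n. \<Sum>j<n. of_real (\<Sum>k<n. f k i * f k j) * (of_real (v i) * w j))"
    by (simp add: sum_distrib_right)
  also have "\<dots> = (\<Sum>i<n. \<Sum>j<n. (if i = j then 1 else 0) * (of_real (v i) * w j))"
    using complete by (intro sum.cong refl) auto
  also have "\<dots> = q"
    unfolding q by (intro sum.cong refl) (simp add: if_distrib if_distribR cong: if_cong)
  finally have "q = (\<Sum>k<n. c k * d k)" ..
  also have "\<dots> = (\<Sum>k<n. c k * ((1 + of_real \<theta> * q) * c k / (of_real (l k) - z)))"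
    using dk lz by (intro sum.cong refl) (simp add: field_simps)
  also have "\<dots> = (1 + of_real \<theta> * q) * Q"
  proof -
    have "Q = (\<Sum>k<n. (c k)\<^sup>2 / (of_real (l k) - z))" by (simp add: Q_def c_def)
    then show ?thesis by (simp add: sum_distrib_left power2_eq_square mult_ac)
  qed
  finally show ?thesis .
qed

lemma cauchy_transform_bound:
  assumes "Im z > 0" shows "cmod (1 / (of_real x - z)) \<le> 1 / Im z"
proof -
  have "Im z \<le> cmod (of_real x - z)" using abs_Im_le_cmod[of "of_real x - z"] by simp
  then show ?thesis using assms by (simp add: norm_divide frac_le)
qed

section \<open>Removing one entry\<close>

text \<open>A Wigner matrix is coded by the family of its entries on and above the diagonal; the
  normalisation by the square root of n is included.\<close>
definition sym_of :: "nat \<Rightarrow> (nat \<times> nat \<Rightarrow> real) \<Rightarrow> nat \<Rightarrow> nat \<Rightarrow> real" where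
  "sym_of n x i j = x (min i j, max i j) / sqrt (real n)"

lemma sym_on_sym_of [simp]: "sym_on n (sym_of n x)"
  by (simp add: sym_on_def sym_of_def min.commute max.commute)

text \<open>Key of the one stored coordinate from which both mirror entries (i, j) and (j, i) are
  read, so that changing it keeps the matrix symmetric.\<close>

definition edge :: "nat \<Rightarrow> nat \<Rightarrow> nat \<times> nat" where
  "edge i j = (min i j, max i j)"

text \<open>If the entry h of a symmetric matrix at (i, j) and (j, i) is set to 0, its resolvent G becomes
  G' = G + h G' E G with E the matrix unit (i = j) or the sum of two matrix units; pert G' u i j p is
  the p-th coordinate of G' E u.\<close>
definition pert :: "(nat \<Rightarrow> nat \<Rightarrow> complex) \<Rightarrow> (nat \<Rightarrow> complex) \<Rightarrow> nat \<Rightarrow> nat \<Rightarrow> nat \<Rightarrow> complex" where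
  "pert G u i j p = (if i = j then G p i * u i else G p i * u j + G p j * u i)"

lemma pert_diff:
  "pert G u i j p - pert G u' i j p = pert G (\<lambda>k. u k - u' k) i j p"
  "pert G u i j p - pert G' u i j p = pert (\<lambda>k l. G k l - G' k l) u i j p"
  by (simp_all add: pert_def algebra_simps)

lemma pert_bound:
  assumes "cmod (G p i) \<le> B" "cmod (G p j) \<le> B"
  shows "cmod (pert G u i j p) \<le> B * (cmod (u i) + cmod (u j))"
proof -
  have B: "B \<ge> 0" using assms(1) norm_ge_zero order_trans by blast
  have "cmod (G p i) * cmod (u j) + cmod (G p j) * cmod (u i) \<le> B * cmod (u j) + B * cmod (u i)"
    using assms by (intro add_mono mult_right_mono) auto
  moreover have "cmod (G p i * u j + G p j * u i)
      \<le> cmod (G p i) * cmod (u j) + cmod (G p j) * cmod (u i)"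
    by (metis norm_mult norm_triangle_ineq)
  moreover have "cmod (G p i) * cmod (u i) \<le> B * cmod (u i)"
    using assms by (intro mult_right_mono) auto
  moreover have "0 \<le> B * cmod (u j)" using B by simp
  ultimately show ?thesis
    by (auto simp: pert_def norm_mult algebra_simps)
qed

lemma double_sum_single:
  fixes F :: "nat \<Rightarrow> nat \<Rightarrow> complex"
  assumes "i < n" "j < n"
  shows "(\<Sum>k<n. \<Sum>l<n. if k = i \<and> l = j then F k l else 0) = F i j"
proof -
  have "(\<Sum>k<n. \<Sum>l<n. if k = i \<and> l = j then F k l else 0)
      = (\<Sum>k<n. if k = i then (\<Sum>l<n. if l = j then F k l else 0) else 0)"
    by (intro sum.cong) auto
  then show ?thesis using assms by simp
qed

text \<open>The matrices differ at (i, j) and (j, i) only, so the double sum of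
  \<open>resolvent_diff\<close> collapses to one term on the diagonal and to two off it.\<close>

lemma resolvent_zeroed:
  fixes x :: "nat \<times> nat \<Rightarrow> real"
  assumes "Im z > 0" and "i < n" "j < n" "p < n" "q < n"
  defines "G \<equiv> resolvent n z (sym_of n x)" and "G0 \<equiv> resolvent n z (sym_of n (x(edge i j := 0)))"
  shows "G0 p q = G p q + of_real (sym_of n x i j) * pert G0 (\<lambda>k. G k q) i j p"
proof -
  let ?h = "sym_of n x" and ?hz = "sym_of n (x(edge i j := 0))"
  have d: "?h k l - ?hz k l = (if (k = i \<and> l = j) \<or> (k = j \<and> l = i) then ?h i j else 0)" for k l
  proof (cases "edge k l = edge i j")
    case True
    then have "(k = i \<and> l = j) \<or> (k = j \<and> l = i)"
      by (auto simp: edge_def min_def max_def split: if_splits)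
    then show ?thesis by (auto simp: sym_of_def edge_def min.commute max.commute)
  next
    case False
    then have "\<not> ((k = i \<and> l = j) \<or> (k = j \<and> l = i))"
      by (auto simp: edge_def min.commute max.commute)
    then show ?thesis using False by (auto simp: sym_of_def edge_def)
  qed
  have "G0 p q - G p q = (\<Sum>k<n. \<Sum>l<n. G0 p k * of_real (?h k l - ?hz k l) * G l q)"
    unfolding G_def G0_def by (rule resolvent_diff) (use assms in auto)
  also have "\<dots> = of_real (?h i j) * pert G0 (\<lambda>k. G k q) i j p"
  proof (cases "i = j")
    case True
    have "(\<Sum>k<n. \<Sum>l<n. G0 p k * of_real (?h k l - ?hz k l) * G l q)
        = (\<Sum>k<n. \<Sum>l<n. if k = i \<and> l = j then of_real (?h i j) * (G0 p k * G l q) else 0)"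
      unfolding d using True by (intro sum.cong) auto
    then show ?thesis using True double_sum_single[OF assms(2,3)] by (simp add: pert_def)
  next
    case False
    have "(\<Sum>k<n. \<Sum>l<n. G0 p k * of_real (?h k l - ?hz k l) * G l q)
        = (\<Sum>k<n. \<Sum>l<n. (if k = i \<and> l = j then of_real (?h i j) * (G0 p k * G l q) else 0)
           + (if k = j \<and> l = i then of_real (?h i j) * (G0 p k * G l q) else 0))"
      unfolding d using False by (intro sum.cong) auto
    then show ?thesis
      using False double_sum_single[OF assms(2,3)] double_sum_single[OF assms(3,2)]
      by (simp add: pert_def sum.distrib ring_distribs)
  qed
  finally show ?thesis by (simp add: algebra_simps)
qed

lemma res_vec_zeroed:
  fixes x :: "nat \<times> nat \<Rightarrow> real" and v :: "nat \<Rightarrow> real"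
  assumes "Im z > 0" and "i < n" "j < n" "p < n"
  defines "x0 \<equiv> x(edge i j := 0)"
  shows "res_vec n z (sym_of n x0) v p = res_vec n z (sym_of n x) v p
    + of_real (sym_of n x i j) * pert (resolvent n z (sym_of n x0)) (res_vec n z (sym_of n x) v) i j p"
proof -
  let ?G = "resolvent n z (sym_of n x)" and ?Gz = "resolvent n z (sym_of n x0)"
  have "res_vec n z (sym_of n x0) v p
      = (\<Sum>q<n. (?G p q + of_real (sym_of n x i j) * pert ?Gz (\<lambda>k. ?G k q) i j p) * of_real (v q))"
    unfolding res_vec_def x0_def using assms by (intro sum.cong refl) (simp add: resolvent_zeroed)
  also have "\<dots> = res_vec n z (sym_of n x) v p
      + of_real (sym_of n x i j) * (\<Sum>q<n. pert ?Gz (\<lambda>k. ?G k q) i j p * of_real (v q))"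
    by (simp add: res_vec_def ring_distribs sum.distrib sum_distrib_left mult.assoc)
  also have "(\<Sum>q<n. pert ?Gz (\<lambda>k. ?G k q) i j p * of_real (v q))
      = pert ?Gz (res_vec n z (sym_of n x) v) i j p"
    by (auto simp: pert_def res_vec_def ring_distribs sum.distrib sum_distrib_left mult.assoc)
  finally show ?thesis .
qed

lemma res_vec_left:
  assumes "sym_on n h" "Im z > 0" "i < n"
  shows "(\<Sum>p<n. of_real (v p) * resolvent n z h p i) = res_vec n z h v i"
  unfolding res_vec_def using assms by (intro sum.cong refl) (simp add: resolvent_sym[of n h z i])

text \<open>Symmetry of the zeroed resolvent turns v^T G0 into \<open>w0\<close>. The change of q is
  thus h times products of coordinates of \<open>w0\<close> and \<open>w\<close>, which are small on
  average by the Ward identity.\<close>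

lemma res_quad_zeroed:
  fixes x :: "nat \<times> nat \<Rightarrow> real" and v :: "nat \<Rightarrow> real"
  assumes "Im z > 0" and "i < n" "j < n"
  defines "x0 \<equiv> x(edge i j := 0)"
  defines "w \<equiv> res_vec n z (sym_of n x) v" and "w0 \<equiv> res_vec n z (sym_of n x0) v"
  shows "res_quad n z (sym_of n x0) v = res_quad n z (sym_of n x) v
    + of_real (sym_of n x i j) * (if i = j then w0 i * w i else w0 i * w j + w0 j * w i)"
proof -
  let ?Gz = "resolvent n z (sym_of n x0)"
  have "res_quad n z (sym_of n x0) v
      = (\<Sum>p<n. of_real (v p) * (w p + of_real (sym_of n x i j) * pert ?Gz w i j p))"
    unfolding res_quad_def x0_def w_def using assms
    by (intro sum.cong refl) (simp add: res_vec_zeroed)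
  also have "\<dots> = res_quad n z (sym_of n x) v
      + of_real (sym_of n x i j) * (\<Sum>p<n. of_real (v p) * pert ?Gz w i j p)"
    by (simp add: res_quad_def w_def ring_distribs sum.distrib sum_distrib_left mult_ac)
  also have "(\<Sum>p<n. of_real (v p) * pert ?Gz w i j p)
      = (if i = j then (\<Sum>p<n. of_real (v p) * ?Gz p i) * w i
         else (\<Sum>p<n. of_real (v p) * ?Gz p i) * w j + (\<Sum>p<n. of_real (v p) * ?Gz p j) * w i)"
    by (auto simp: pert_def ring_distribs sum.distrib sum_distrib_left sum_distrib_right mult_ac)
  also have "\<dots> = (if i = j then w0 i * w i else w0 i * w j + w0 j * w i)"
    using assms by (simp add: res_vec_left)
  finally show ?thesis .
qed

text \<open>The pairing is bilinear, without conjugates, and both vectors share one bound, so |a b|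
  <= (|a|^2 + |b|^2) / 2 applied termwise is enough.\<close>

lemma Cauchy_Schwarz_sum_cmod:
  fixes a b :: "nat \<Rightarrow> complex"
  assumes "(\<Sum>i<n. (cmod (a i))\<^sup>2) \<le> B\<^sup>2" "(\<Sum>i<n. (cmod (b i))\<^sup>2) \<le> B\<^sup>2"
  shows "cmod (\<Sum>i<n. a i * b i) \<le> B\<^sup>2"
proof -
  have "cmod (\<Sum>i<n. a i * b i) \<le> (\<Sum>i<n. cmod (a i) * cmod (b i))"
    by (rule order_trans[OF norm_sum]) (simp add: norm_mult)
  also have "\<dots> \<le> (\<Sum>i<n. ((cmod (a i))\<^sup>2 + (cmod (b i))\<^sup>2) / 2)"
  proof (rule sum_mono)
    fix i show "cmod (a i) * cmod (b i) \<le> ((cmod (a i))\<^sup>2 + (cmod (b i))\<^sup>2) / 2"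
      using sum_squares_bound[of "cmod (a i)" "cmod (b i)"] by (simp add: field_simps)
  qed
  also have "\<dots> \<le> B\<^sup>2"
    using assms by (simp add: sum.distrib flip: sum_divide_distrib)
  finally show ?thesis .
qed

lemma resolvent_column_bound:
  assumes "sym_on n h" "Im z > 0" "i < n"
  shows "(\<Sum>p<n. (cmod (resolvent n z h p i))\<^sup>2) \<le> (1 / Im z)\<^sup>2"
  using ward[OF assms(1,2), of "\<lambda>k. if k = i then 1 else 0"] assms(3)
  by (simp only: res_vec_unit power_divide) simp

text \<open>Summed over p, the diagonal of G0 E G becomes one or two pairings of resolvent columns,
  each at most (1 / Im z)^2. Bounding the n diagonal terms separately would lose the factor 1 /
  n.\<close>

lemma res_trace_zeroed:
  fixes x :: "nat \<times> nat \<Rightarrow> real"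
  assumes "Im z > 0" and "i < n" "j < n"
  defines "x0 \<equiv> x(edge i j := 0)"
  shows "cmod (res_trace n z (sym_of n x) - res_trace n z (sym_of n x0))
    \<le> 2 * (1 / Im z)\<^sup>2 * \<bar>sym_of n x i j\<bar> / n"
proof -
  let ?G = "resolvent n z (sym_of n x)" and ?Gz = "resolvent n z (sym_of n x0)"
  let ?B = "1 / Im z" and ?h = "sym_of n x i j"
  have n: "n > 0" using assms(2) by simp
  have b: "cmod (\<Sum>p<n. ?Gz p k * ?G l p) \<le> ?B\<^sup>2" if "k < n" "l < n" for k l
  proof -
    have "(\<Sum>p<n. ?Gz p k * ?G l p) = (\<Sum>p<n. ?Gz p k * ?G p l)"
      using assms(1) that by (intro sum.cong refl) (simp add: resolvent_sym[of n _ z l])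
    then show ?thesis
      using Cauchy_Schwarz_sum_cmod[OF resolvent_column_bound resolvent_column_bound] assms(1) that
      by simp
  qed
  have "of_nat n * (res_trace n z (sym_of n x0) - res_trace n z (sym_of n x)) = (\<Sum>p<n. ?Gz p p - ?G p p)"
    using n by (simp add: res_trace_def sum_subtractf field_simps)
  also have "\<dots> = (\<Sum>p<n. of_real ?h * pert ?Gz (\<lambda>k. ?G k p) i j p)"
    unfolding x0_def using assms by (intro sum.cong refl) (simp add: resolvent_zeroed)
  also have "\<dots> = of_real ?h * (if i = j then \<Sum>p<n. ?Gz p i * ?G i p
      else (\<Sum>p<n. ?Gz p i * ?G j p) + (\<Sum>p<n. ?Gz p j * ?G i p))"
    by (auto simp: pert_def sum_distrib_left sum.distrib ring_distribs)
  finally have "of_nat n * (res_trace n z (sym_of n x0) - res_trace n z (sym_of n x)) = \<dots>" .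
  then have "real n * cmod (res_trace n z (sym_of n x0) - res_trace n z (sym_of n x))
      = \<bar>?h\<bar> * cmod (if i = j then \<Sum>p<n. ?Gz p i * ?G i p
      else (\<Sum>p<n. ?Gz p i * ?G j p) + (\<Sum>p<n. ?Gz p j * ?G i p))"
    by (drule_tac arg_cong[of _ _ cmod]) (simp only: norm_mult norm_of_nat norm_of_real)
  also have "\<dots> \<le> \<bar>?h\<bar> * (2 * ?B\<^sup>2)"
  proof (rule mult_left_mono)
    have "cmod ((\<Sum>p<n. ?Gz p i * ?G j p) + (\<Sum>p<n. ?Gz p j * ?G i p)) \<le> ?B\<^sup>2 + ?B\<^sup>2"
      using assms by (intro norm_triangle_mono b) auto
    moreover have "cmod (\<Sum>p<n. ?Gz p i * ?G i p) \<le> ?B\<^sup>2 + ?B\<^sup>2"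
      using b[of i i] assms(2) by (rule_tac order_trans[of _ "?B\<^sup>2"]) auto
    ultimately show "cmod (if i = j then \<Sum>p<n. ?Gz p i * ?G i p
      else (\<Sum>p<n. ?Gz p i * ?G j p) + (\<Sum>p<n. ?Gz p j * ?G i p)) \<le> 2 * ?B\<^sup>2"
      unfolding mult_2 by (cases "i = j") (simp_all only: if_True if_False simp_thms)
  qed simp
  finally have "cmod (res_trace n z (sym_of n x) - res_trace n z (sym_of n x0)) * n
      \<le> 2 * ?B\<^sup>2 * \<bar>?h\<bar>"
    by (simp only: norm_minus_commute mult_ac)
  then show ?thesis using n by (subst pos_le_divide_eq) auto
qed

text \<open>The size of the error made at the pair (i, j) below. What matters is that the squares sum up to
  O(1 / n^2) because the coordinates of the resolvent vector are square-summable (Ward identity).\<close>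
definition fluct :: "nat \<Rightarrow> complex \<Rightarrow> (nat \<Rightarrow> real) \<Rightarrow> (nat \<times> nat \<Rightarrow> real) \<Rightarrow> nat \<Rightarrow> nat \<Rightarrow> real" where
  "fluct n z v x i j = (let a = (\<lambda>k. cmod (res_vec n z (sym_of n x) v k)); r = sqrt (real n) in
     a i * a j / r^2 + (a i + a j) / r^3 + 1 / r^4)"

text \<open>With A the sum of the squares of the a_i, the three terms contribute A^2 / n^2, 4 A n /
  n^3 and n^2 / n^4, all of order n^(-2) since A <= (1 / Im z)^2. The leading 3 comes from (a + b +
  c)^2 <= 3 (a^2 + b^2 + c^2).\<close>

lemma sum_fluct_sq:
  assumes "Im z > 0" and v: "(\<Sum>i<n. (v i)\<^sup>2) = 1" and n: "n \<ge> 1"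
  shows "(\<Sum>i<n. \<Sum>j<n. (fluct n z v x i j)\<^sup>2) \<le> 3 * ((1 / Im z)^4 + 4 * (1 / Im z)^2 + 1) / (real n)^2"
proof -
  let ?a = "\<lambda>k. cmod (res_vec n z (sym_of n x) v k)"
  let ?A = "\<Sum>i<n. (?a i)\<^sup>2"
  define r where "r = sqrt (real n)"
  have r: "r > 0" "r^2 = n" using n by (auto simp: r_def)
  have A: "?A \<le> (1 / Im z)^2"
    using ward[OF sym_on_sym_of[of n x] assms(1), of v] v by (simp add: power_divide)
  have A0: "?A \<ge> 0" by (simp add: sum_nonneg)
  have "(fluct n z v x i j)\<^sup>2
      \<le> 3 * ((?a i)\<^sup>2 * (?a j)\<^sup>2 / r^4 + 2 * ((?a i)\<^sup>2 + (?a j)\<^sup>2) / r^6 + 1 / r^8)" for i j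
  proof -
    have 3: "(a + b + c)\<^sup>2 \<le> 3 * (a\<^sup>2 + b\<^sup>2 + c\<^sup>2)" for a b c :: real
      using sum_squares_bound[of a b] sum_squares_bound[of a c] sum_squares_bound[of b c]
      by (simp add: power2_eq_square algebra_simps)
    have "(?a i + ?a j)\<^sup>2 \<le> 2 * ((?a i)\<^sup>2 + (?a j)\<^sup>2)"
      using sum_squares_bound[of "?a i" "?a j"] by (simp add: power2_eq_square algebra_simps)
    then have "((?a i + ?a j) / r^3)\<^sup>2 \<le> 2 * ((?a i)\<^sup>2 + (?a j)\<^sup>2) / r^6"
      by (simp add: power_divide divide_right_mono flip: power_mult)
    moreover have "(?a i * ?a j / r^2)\<^sup>2 = (?a i)\<^sup>2 * (?a j)\<^sup>2 / r^4" "(1 / r^4)\<^sup>2 = 1 / r^8"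
      by (simp_all add: power_divide power_mult_distrib flip: power_mult)
    moreover have "(fluct n z v x i j)\<^sup>2
        \<le> 3 * ((?a i * ?a j / r^2)\<^sup>2 + ((?a i + ?a j) / r^3)\<^sup>2 + (1 / r^4)\<^sup>2)"
      unfolding fluct_def Let_def r_def[symmetric] by (rule 3)
    moreover have "X \<le> 3 * (P' + Q' + R')"
      if "Q \<le> Q'" "P = P'" "R = R'" "X \<le> 3 * (P + Q + R)" for X P Q R P' Q' R' :: real
      using that by simp
    ultimately show ?thesis by blast
  qed
  then have "(\<Sum>i<n. \<Sum>j<n. (fluct n z v x i j)\<^sup>2)
      \<le> (\<Sum>i<n. \<Sum>j<n. 3 * ((?a i)\<^sup>2 * (?a j)\<^sup>2 / r^4 + 2 * ((?a i)\<^sup>2 + (?a j)\<^sup>2) / r^6 + 1 / r^8))"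
    by (intro sum_mono)
  also have "\<dots> = 3 * ((\<Sum>i<n. \<Sum>j<n. (?a i)\<^sup>2 * (?a j)\<^sup>2) / r^4
      + 2 * (\<Sum>i<n. \<Sum>j<n. (?a i)\<^sup>2 + (?a j)\<^sup>2) / r^6 + (\<Sum>i<n. \<Sum>j<n. 1) / r^8)"
    unfolding sum_distrib_left sum_divide_distrib sum.distrib[symmetric] ..
  also have "(\<Sum>i<n. \<Sum>j<n. (?a i)\<^sup>2 * (?a j)\<^sup>2) = ?A * ?A"
    by (rule sum_product[symmetric])
  also have "(\<Sum>i<n. \<Sum>j<n. (?a i)\<^sup>2 + (?a j)\<^sup>2) = 2 * n * ?A"
    by (simp add: sum.distrib flip: sum_distrib_left)
  also have "(\<Sum>i<n. \<Sum>j<n. 1) = real n * n" by simp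
  also have "3 * (?A * ?A / r^4 + 2 * (real (2 * n) * ?A) / r^6 + real n * real n / r^8)
      = 3 * (?A * ?A + 4 * ?A + 1) / (real n)^2"
  proof -
    have "r^4 = (real n)^2" "r^6 = (real n)^3" "r^8 = (real n)^4"
      using power_mult[of r 2 2] power_mult[of r 2 3] power_mult[of r 2 4] r(2) by simp_all
    then show ?thesis
      using n by (simp add: field_simps power2_eq_square power3_eq_cube power4_eq_xxxx)
  qed
  also have "\<dots> \<le> 3 * ((1 / Im z)^2 * (1 / Im z)^2 + 4 * (1 / Im z)^2 + 1) / (real n)^2"
    using A A0 by (intro divide_right_mono mult_left_mono add_mono mult_mono) auto
  finally show ?thesis by (simp flip: power_add)
qed

text \<open>Real arithmetic for \<open>loc_err_bound\<close>. Among the products with \<delta>, the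
  critical one is |h| \<delta>, which spends the whole factor r allowed in the hypothesis on
  \<delta>. The fourth power of \<rho> comes from h^2 \<delta>, and 10 = 2 + 2 + 4 + 2 collects the
  terms with B^2.\<close>

lemma local_error_arith:
  fixes h B K S T \<rho> r \<delta> N :: real
  assumes pos: "B \<ge> 0" "K \<ge> 0" "S \<ge> 0" "\<rho> \<ge> 1" "r \<ge> 1" "\<delta> \<ge> 0" and N: "N = r\<^sup>2"
    and h: "\<bar>h\<bar> \<le> \<rho> / r" and \<delta>: "\<delta> \<le> K * \<rho>\<^sup>2 * r * T" and S: "S / r^3 \<le> T"
  shows "\<bar>h\<bar> * B * \<delta> + h\<^sup>2 * (2 * B\<^sup>2 * \<bar>h\<bar> * S * K + 2 * B\<^sup>2 * \<delta>)
      + 1 / N * (4 * B\<^sup>2 * \<bar>h\<bar> * S * K + 2 * B\<^sup>2 * \<delta>) \<le> (B + 10 * B\<^sup>2) * K * \<rho>^4 * T"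
proof -
  have T: "T \<ge> 0" using S pos by (meson divide_nonneg_nonneg order_trans zero_le_power zero_le_one)
  have KT: "K * T \<ge> 0" using pos T by simp
  have rho: "\<rho>^3 \<le> \<rho>^4" "\<rho>^2 \<le> \<rho>^4" "\<rho> \<le> \<rho>^4"
    using pos power_increasing[of _ 4 \<rho>] power_increasing[of 1 4 \<rho>] by auto
  have r: "r > 0" using pos by simp
  have nn: "0 \<le> \<rho>^4 * (K * T)" "0 \<le> \<rho>\<^sup>2 * (K * T)"
    by (rule mult_nonneg_nonneg[OF _ KT], simp)+
  have a: "\<bar>h\<bar> * \<delta> \<le> K * \<rho>^4 * T"
  proof -
    have "\<bar>h\<bar> * \<delta> \<le> \<rho> / r * (K * \<rho>\<^sup>2 * r * T)"
      using h \<delta> pos by (intro mult_mono) auto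
    also have "\<dots> = \<rho>^3 * (K * T)" using r by (simp add: field_simps power2_eq_square power3_eq_cube)
    also have "\<dots> \<le> \<rho>^4 * (K * T)" using rho KT by (intro mult_right_mono) auto
    finally show ?thesis by (simp add: mult_ac)
  qed
  have b: "\<bar>h\<bar>^3 * S \<le> \<rho>^4 * T"
  proof -
    have "\<bar>h\<bar>^3 * S \<le> (\<rho> / r)^3 * S"
      using h pos by (intro mult_right_mono power_mono) auto
    also have "\<dots> = \<rho>^3 * (S / r^3)" by (simp add: power_divide)
    also have "\<dots> \<le> \<rho>^4 * T" using rho S pos T by (intro mult_mono) auto
    finally show ?thesis .
  qed
  have c: "h\<^sup>2 * \<delta> \<le> K * \<rho>^4 * T"
  proof -
    have "h\<^sup>2 * \<delta> \<le> (\<rho> / r)\<^sup>2 * (K * \<rho>\<^sup>2 * r * T)"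
      using h \<delta> pos power_mono[OF h, of 2] by (intro mult_mono) auto
    also have "\<dots> = \<rho>^4 * (K * T) / r"
      using r by (simp add: field_simps power2_eq_square power4_eq_xxxx)
    also have "\<dots> \<le> \<rho>^4 * (K * T)"
      using pos divide_left_mono[of 1 r] nn by fastforce
    finally show ?thesis by (simp add: mult_ac)
  qed
  have d: "1 / N * (\<bar>h\<bar> * S) \<le> \<rho>^4 * T"
  proof -
    have "\<bar>h\<bar> * S \<le> \<rho> / r * S" using h pos by (intro mult_right_mono) auto
    then have "1 / N * (\<bar>h\<bar> * S) \<le> 1 / N * (\<rho> / r * S)"
      using N r by (intro mult_left_mono) auto
    also have "\<dots> = \<rho> * (S / r^3)" by (simp add: N power2_eq_square power3_eq_cube)
    also have "\<dots> \<le> \<rho>^4 * T" using rho S pos T by (intro mult_mono) auto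
    finally show ?thesis .
  qed
  have e: "1 / N * \<delta> \<le> K * \<rho>^4 * T"
  proof -
    have "1 / N * \<delta> \<le> 1 / N * (K * \<rho>\<^sup>2 * r * T)"
      using \<delta> N r by (intro mult_left_mono) auto
    also have "\<dots> = \<rho>\<^sup>2 * (K * T) / r"
      using r by (simp add: N field_simps power2_eq_square)
    also have "\<dots> \<le> \<rho>\<^sup>2 * (K * T)"
      using pos divide_left_mono[of 1 r] nn by fastforce
    also have "\<dots> \<le> \<rho>^4 * (K * T)" using rho KT by (intro mult_right_mono) auto
    finally show ?thesis by (simp add: mult_ac)
  qed
  have "\<bar>h\<bar> * B * \<delta> + h\<^sup>2 * (2 * B\<^sup>2 * \<bar>h\<bar> * S * K + 2 * B\<^sup>2 * \<delta>)
      + 1 / N * (4 * B\<^sup>2 * \<bar>h\<bar> * S * K + 2 * B\<^sup>2 * \<delta>)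
      = B * (\<bar>h\<bar> * \<delta>) + 2 * B\<^sup>2 * K * (\<bar>h\<bar>^3 * S) + 2 * B\<^sup>2 * (h\<^sup>2 * \<delta>)
        + 4 * B\<^sup>2 * K * (1 / N * (\<bar>h\<bar> * S)) + 2 * B\<^sup>2 * (1 / N * \<delta>)"
    by (simp add: algebra_simps power2_eq_square power3_eq_cube abs_mult_self_eq)
  also have "\<dots> \<le> B * (K * \<rho>^4 * T) + 2 * B\<^sup>2 * K * (\<rho>^4 * T) + 2 * B\<^sup>2 * (K * \<rho>^4 * T)
      + 4 * B\<^sup>2 * K * (\<rho>^4 * T) + 2 * B\<^sup>2 * (K * \<rho>^4 * T)"
    using pos by (intro add_mono mult_left_mono a b c d e) auto
  also have "\<dots> = (B + 10 * B\<^sup>2) * K * \<rho>^4 * T" by (simp add: algebra_simps)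
  finally show ?thesis .
qed

text \<open>The term in brackets has mean zero: x0 does not involve the entry x (edge i j), whose first two
  moments are 0 and 1.\<close>
definition loc_err :: "nat \<Rightarrow> complex \<Rightarrow> (nat \<Rightarrow> real) \<Rightarrow> ((nat \<times> nat \<Rightarrow> real) \<Rightarrow> complex) \<Rightarrow>
    (nat \<times> nat \<Rightarrow> real) \<Rightarrow> nat \<Rightarrow> nat \<Rightarrow> complex" where
  "loc_err n z v Y x i j = (let x0 = x(edge i j := 0); h = of_real (sym_of n x i j);
       G = resolvent n z (sym_of n x); w = res_vec n z (sym_of n x) v;
       G0 = resolvent n z (sym_of n x0); w0 = res_vec n z (sym_of n x0) v in
     h * w j * Y x + pert G w i j j * Y x / of_nat n
     - (h * w0 j * Y x0 + (1 / of_nat n - h\<^sup>2) * pert G0 w0 i j j * Y x0))"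

text \<open>The expansion in a single entry. The first-order change of w_j is -h times
  \<open>pert\<close>, and the resulting h^2 term is matched against the h^2 inside the bracket of
  \<open>loc_err\<close>. The change of Y is not expanded but counted as an error.\<close>

lemma loc_err_bound:
  fixes x :: "nat \<times> nat \<Rightarrow> real"
  assumes z: "Im z > 0" and ij: "i < n" "j < n" and v: "(\<Sum>i<n. (v i)\<^sup>2) = 1"
    and Y: "cmod (Y x) \<le> K"
    and dY: "cmod (Y x - Y (x(edge i j := 0)))
      \<le> K * (1 + \<bar>x (edge i j)\<bar>)\<^sup>2 * sqrt (real n) * fluct n z v x i j"
  shows "cmod (loc_err n z v Y x i j)
    \<le> (1 / Im z + 10 * (1 / Im z)\<^sup>2) * K * (1 + \<bar>x (edge i j)\<bar>)^4 * fluct n z v x i j"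
proof -
  define x0 where "x0 = x(edge i j := 0)"
  define h where "h = sym_of n x i j"
  define G where "G = resolvent n z (sym_of n x)"
  define w where "w = res_vec n z (sym_of n x) v"
  define Gz where "Gz = resolvent n z (sym_of n x0)"
  define wz where "wz = res_vec n z (sym_of n x0) v"
  define B where "B = 1 / Im z"
  define \<rho> where "\<rho> = 1 + \<bar>x (edge i j)\<bar>"
  define r where "r = sqrt (real n)"
  define T where "T = fluct n z v x i j"
  define S where "S = cmod (w i) + cmod (w j)"
  define \<delta> where "\<delta> = cmod (Y x - Y x0)"
  define \<alpha> where "\<alpha> = pert G w i j j"
  define \<alpha>z where "\<alpha>z = pert Gz wz i j j"
  \<comment> \<open>Intermediate between \<alpha> and \<alpha>z, with the zeroed resolvent and the
    original vector, so that only one argument changes at a time.\<close>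
  define \<beta> where "\<beta> = pert Gz w i j j"
  have n: "n \<ge> 1" using ij by simp
  have B: "B \<ge> 0" using z by (simp add: B_def)
  have K: "K \<ge> 0" using Y norm_ge_zero order_trans by blast
  have Gb: "cmod (G p q) \<le> B" "cmod (Gz p q) \<le> B" if "p < n" "q < n" for p q
    using that z by (simp_all add: G_def Gz_def B_def resolvent_bound del: of_real_divide)
  have wb: "cmod (w p) \<le> B" "cmod (wz p) \<le> B" if "p < n" for p
    using res_vec_bound[OF sym_on_sym_of z v that] by (simp_all add: w_def wz_def B_def)
  have wd: "w p - wz p = - of_real h * pert Gz w i j p" if "p < n" for p
    using res_vec_zeroed[OF z ij that, of x v] by (simp add: w_def wz_def Gz_def x0_def h_def)
  have wdb: "cmod (w p - wz p) \<le> \<bar>h\<bar> * (B * S)" if "p < n" for p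
    using pert_bound[of Gz p i B j w] Gb that ij
    by (simp add: wd norm_mult S_def mult_left_mono)
  have Gd: "cmod (G p q - Gz p q) \<le> \<bar>h\<bar> * (B * (2 * B))" if "p < n" "q < n" for p q
  proof -
    have "cmod (pert Gz (\<lambda>k. G k q) i j p) \<le> B * (cmod (G i q) + cmod (G j q))"
      using Gb that ij by (intro pert_bound) auto
    also have "\<dots> \<le> B * (2 * B)"
      using Gb(1)[OF ij(1) that(2)] Gb(1)[OF ij(2) that(2)] B by (intro mult_left_mono) auto
    finally have "cmod (pert Gz (\<lambda>k. G k q) i j p) \<le> B * (2 * B)" .
    moreover have "G p q - Gz p q = - of_real h * pert Gz (\<lambda>k. G k q) i j p"
      using resolvent_zeroed[OF z ij that, of x] by (simp add: G_def Gz_def x0_def h_def)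
    ultimately show ?thesis by (simp add: norm_mult mult_left_mono)
  qed
  have \<beta>\<alpha>z: "cmod (\<beta> - \<alpha>z) \<le> 2 * B\<^sup>2 * \<bar>h\<bar> * S"
  proof -
    have "cmod (\<beta> - \<alpha>z) \<le> B * (cmod (w i - wz i) + cmod (w j - wz j))"
      unfolding \<beta>_def \<alpha>z_def pert_diff(1) using Gb ij by (intro pert_bound) auto
    also have "\<dots> \<le> B * (\<bar>h\<bar> * (B * S) + \<bar>h\<bar> * (B * S))"
      using wdb ij B by (intro mult_left_mono add_mono) auto
    finally show ?thesis by (simp add: power2_eq_square algebra_simps)
  qed
  have \<alpha>\<beta>: "cmod (\<alpha> - \<beta>) \<le> 2 * B\<^sup>2 * \<bar>h\<bar> * S"
  proof -
    have "cmod (\<alpha> - \<beta>) \<le> \<bar>h\<bar> * (B * (2 * B)) * S"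
      unfolding \<alpha>_def \<beta>_def pert_diff(2) S_def using Gd ij by (intro pert_bound) auto
    then show ?thesis by (simp add: power2_eq_square algebra_simps)
  qed
  have \<alpha>zb: "cmod \<alpha>z \<le> 2 * B\<^sup>2"
  proof -
    have "cmod \<alpha>z \<le> B * (cmod (wz i) + cmod (wz j))"
      unfolding \<alpha>z_def using Gb ij by (intro pert_bound) auto
    also have "\<dots> \<le> B * (B + B)" using wb ij B by (intro mult_left_mono add_mono) auto
    finally show ?thesis by (simp add: power2_eq_square algebra_simps)
  qed
  have t1: "cmod (of_real h * wz j * (Y x - Y x0)) \<le> \<bar>h\<bar> * B * \<delta>"
    using wb ij B by (auto simp: norm_mult \<delta>_def intro!: mult_mono)
  have bY: "cmod (\<beta> * Y x - \<alpha>z * Y x0) \<le> 2 * B\<^sup>2 * \<bar>h\<bar> * S * K + 2 * B\<^sup>2 * \<delta>"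
  proof -
    have "\<beta> * Y x - \<alpha>z * Y x0 = (\<beta> - \<alpha>z) * Y x + \<alpha>z * (Y x - Y x0)"
      by (simp add: algebra_simps)
    also have "cmod \<dots> \<le> cmod (\<beta> - \<alpha>z) * cmod (Y x) + cmod \<alpha>z * \<delta>"
      unfolding \<delta>_def norm_mult[symmetric] by (rule norm_triangle_ineq)
    also have "\<dots> \<le> 2 * B\<^sup>2 * \<bar>h\<bar> * S * K + 2 * B\<^sup>2 * \<delta>"
      using \<beta>\<alpha>z \<alpha>zb Y B K by (intro add_mono mult_mono) (auto simp: \<delta>_def S_def)
    finally show ?thesis .
  qed
  have aY: "cmod (\<alpha> * Y x - \<alpha>z * Y x0) \<le> 4 * B\<^sup>2 * \<bar>h\<bar> * S * K + 2 * B\<^sup>2 * \<delta>"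
  proof -
    have "\<alpha> * Y x - \<alpha>z * Y x0 = (\<alpha> - \<beta>) * Y x + (\<beta> * Y x - \<alpha>z * Y x0)"
      by (simp add: algebra_simps)
    also have "cmod \<dots> \<le> cmod (\<alpha> - \<beta>) * cmod (Y x) + cmod (\<beta> * Y x - \<alpha>z * Y x0)"
      unfolding norm_mult[symmetric] by (rule norm_triangle_ineq)
    also have "\<dots> \<le> 2 * B\<^sup>2 * \<bar>h\<bar> * S * K + (2 * B\<^sup>2 * \<bar>h\<bar> * S * K + 2 * B\<^sup>2 * \<delta>)"
      using \<alpha>\<beta> bY Y B K by (intro add_mono mult_mono) (auto simp: S_def)
    finally show ?thesis by (simp add: algebra_simps)
  qed
  have "loc_err n z v Y x i j = of_real h * w j * Y x + \<alpha> * Y x / of_nat n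
     - (of_real h * wz j * Y x0 + (1 / of_nat n - (of_real h)\<^sup>2) * \<alpha>z * Y x0)"
    by (simp add: loc_err_def Let_def h_def w_def wz_def \<alpha>_def \<alpha>z_def G_def Gz_def x0_def)
  also have "\<dots> = of_real h * wz j * (Y x - Y x0) + of_real h * (w j - wz j) * Y x
      + (of_real h)\<^sup>2 * \<alpha>z * Y x0 + (1 / of_nat n) * (\<alpha> * Y x - \<alpha>z * Y x0)"
    by (simp add: algebra_simps)
  \<comment> \<open>\<open>wd\<close> inserts w_j - wz_j = -h \<beta> exactly; only differences
    between quantities at x and at x0 remain.\<close>
  also have "\<dots> = of_real h * wz j * (Y x - Y x0) - (of_real h)\<^sup>2 * (\<beta> * Y x - \<alpha>z * Y x0)
      + (1 / of_nat n) * (\<alpha> * Y x - \<alpha>z * Y x0)"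
    unfolding wd[OF ij(2)] \<beta>_def by (simp add: algebra_simps power2_eq_square)
  finally have eq: "loc_err n z v Y x i j
      = of_real h * wz j * (Y x - Y x0) - (of_real h)\<^sup>2 * (\<beta> * Y x - \<alpha>z * Y x0)
      + (1 / of_nat n) * (\<alpha> * Y x - \<alpha>z * Y x0)" .
  have "cmod (a - b + c) \<le> cmod a + cmod b + cmod c" for a b c
    using norm_triangle_ineq[of "a - b" c] norm_triangle_ineq4[of a b] by linarith
  then have "cmod (loc_err n z v Y x i j)
      \<le> cmod (of_real h * wz j * (Y x - Y x0)) + cmod ((of_real h)\<^sup>2 * (\<beta> * Y x - \<alpha>z * Y x0))
        + cmod ((1 / of_nat n) * (\<alpha> * Y x - \<alpha>z * Y x0))"
    unfolding eq .
  also have "cmod ((of_real h)\<^sup>2 * (\<beta> * Y x - \<alpha>z * Y x0))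
      = h\<^sup>2 * cmod (\<beta> * Y x - \<alpha>z * Y x0)" by (simp add: norm_mult norm_power)
  also have "cmod ((1 / of_nat n) * (\<alpha> * Y x - \<alpha>z * Y x0))
      = 1 / real n * cmod (\<alpha> * Y x - \<alpha>z * Y x0)" by (simp add: norm_mult norm_divide)
  also have "cmod (of_real h * wz j * (Y x - Y x0)) + h\<^sup>2 * cmod (\<beta> * Y x - \<alpha>z * Y x0)
        + 1 / real n * cmod (\<alpha> * Y x - \<alpha>z * Y x0)
      \<le> \<bar>h\<bar> * B * \<delta> + h\<^sup>2 * (2 * B\<^sup>2 * \<bar>h\<bar> * S * K + 2 * B\<^sup>2 * \<delta>)
      + 1 / real n * (4 * B\<^sup>2 * \<bar>h\<bar> * S * K + 2 * B\<^sup>2 * \<delta>)"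
    by (intro add_mono mult_left_mono t1 bY aY) auto
  also have "\<dots> \<le> (B + 10 * B\<^sup>2) * K * \<rho>^4 * T"
  proof (rule local_error_arith)
    show "\<bar>h\<bar> \<le> \<rho> / r"
      using n by (simp add: h_def sym_of_def \<rho>_def r_def edge_def divide_right_mono)
    show "\<delta> \<le> K * \<rho>\<^sup>2 * r * T"
      using dY by (simp add: \<delta>_def x0_def \<rho>_def r_def T_def)
    show "S / r^3 \<le> T"
      by (simp add: T_def fluct_def Let_def r_def S_def w_def)
  qed (use B K n in \<open>auto simp: S_def \<rho>_def r_def \<delta>_def\<close>)
  finally show ?thesis by (simp add: B_def \<rho>_def T_def)
qed

text \<open>\<open>pert G w i j j\<close> is minus the derivative of w_j in the entry (i, j).
  Summing h w_j against v gives 1 + z q because (h - z) w = v. Summing \<open>pert\<close> gives n m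
  q, plus the sum of the w_j^2, minus a diagonal correction; the last two are at most (1 / Im z)^2
  each and are divided by n.\<close>

lemma self_consistent_decomp:
  fixes x :: "nat \<times> nat \<Rightarrow> real"
  assumes z: "Im z > 0" and n: "n \<ge> 1" and v: "(\<Sum>i<n. (v i)\<^sup>2) = 1"
  defines "q \<equiv> res_quad n z (sym_of n x) v" and "m \<equiv> res_trace n z (sym_of n x)"
    and "G \<equiv> resolvent n z (sym_of n x)" and "w \<equiv> res_vec n z (sym_of n x) v"
  shows "cmod ((1 + z * q + m * q) - (\<Sum>i<n. \<Sum>j<n. of_real (v i) *
      (of_real (sym_of n x i j) * w j + pert G w i j j / of_nat n))) \<le> 2 * (1 / Im z)\<^sup>2 / n"
proof -
  let ?h = "sym_of n x" and ?B = "1 / Im z"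
  have s: "sym_on n ?h" by simp
  have w2: "(\<Sum>i<n. (cmod (w i))\<^sup>2) \<le> ?B\<^sup>2"
    using ward[OF s z, of v] v by (simp add: w_def power_divide)
  have "(\<Sum>i<n. \<Sum>j<n. of_real (v i) * (of_real (?h i j) * w j))
      = (\<Sum>i<n. of_real (v i) * (z * w i + of_real (v i)))"
    unfolding w_def by (intro sum.cong refl) (simp add: res_vec_eq[OF s z] flip: sum_distrib_left)
  also have "\<dots> = z * q + of_real (\<Sum>i<n. (v i)\<^sup>2)"
    by (simp add: q_def res_quad_def w_def sum.distrib sum_distrib_left power2_eq_square algebra_simps)
  finally have 1: "(\<Sum>i<n. \<Sum>j<n. of_real (v i) * (of_real (?h i j) * w j)) = 1 + z * q"
    using v by simp
  \<comment> \<open>At i = j the off-diagonal formula counts G_ii w_i twice, so it is subtracted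
    once.\<close>
  have p: "pert G w i j j = (G j j * w i + G j i * w j) - (if j = i then G i i * w i else 0)" for i j
    by (simp add: pert_def)
  have "(\<Sum>i<n. \<Sum>j<n. of_real (v i) * pert G w i j j)
      = (\<Sum>i<n. \<Sum>j<n. of_real (v i) * w i * G j j) + (\<Sum>i<n. \<Sum>j<n. of_real (v i) * G j i * w j)
        - (\<Sum>i<n. \<Sum>j<n. if j = i then of_real (v i) * (G i i * w i) else 0)"
    unfolding p by (simp add: sum.distrib sum_subtractf ring_distribs if_distrib[of "(*) _"] mult_ac
        cong: if_cong)
  also have "(\<Sum>i<n. \<Sum>j<n. of_real (v i) * w i * G j j) = of_nat n * m * q"
  proof -
    have "(\<Sum>i<n. \<Sum>j<n. of_real (v i) * w i * G j j) = q * (\<Sum>j<n. G j j)"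
      unfolding q_def res_quad_def w_def by (rule sum_product[symmetric])
    then show ?thesis using n by (simp add: m_def res_trace_def G_def)
  qed
  also have "(\<Sum>i<n. \<Sum>j<n. of_real (v i) * G j i * w j) = (\<Sum>j<n. w j * w j)"
  proof -
    have "(\<Sum>i<n. \<Sum>j<n. of_real (v i) * G j i * w j) = (\<Sum>j<n. (\<Sum>i<n. G j i * of_real (v i)) * w j)"
      by (subst sum.swap) (simp add: sum_distrib_left sum_distrib_right mult_ac)
    then show ?thesis by (simp add: w_def res_vec_def G_def)
  qed
  finally have 2: "(\<Sum>i<n. \<Sum>j<n. of_real (v i) * pert G w i j j)
      = of_nat n * m * q + (\<Sum>j<n. w j * w j) - (\<Sum>i<n. of_real (v i) * (G i i * w i))"
    by simp
  have b1: "cmod (\<Sum>j<n. w j * w j) \<le> ?B\<^sup>2"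
    by (rule Cauchy_Schwarz_sum_cmod[OF w2 w2])
  have b2: "cmod (\<Sum>i<n. of_real (v i) * (G i i * w i)) \<le> ?B\<^sup>2"
  proof -
    have "(cmod (\<Sum>i<n. of_real (v i) * (G i i * w i)))\<^sup>2 \<le> 1 * (\<Sum>i<n. (cmod (G i i * w i))\<^sup>2)"
      using Cauchy_Schwarz_sum_complex[of v "\<lambda>i. G i i * w i" n] v by simp
    also have "\<dots> \<le> 1 * (\<Sum>i<n. ?B\<^sup>2 * (cmod (w i))\<^sup>2)"
      using resolvent_bound[OF s z] z
      by (auto simp: norm_mult power_mult_distrib G_def simp del: power_divide
          intro!: sum_mono mult_right_mono power_mono)
    also have "\<dots> \<le> ?B\<^sup>2 * ?B\<^sup>2"
      unfolding mult_1 sum_distrib_left[symmetric] by (rule mult_left_mono[OF w2]) simp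
    finally have "(cmod (\<Sum>i<n. of_real (v i) * (G i i * w i)))\<^sup>2 \<le> (?B\<^sup>2)\<^sup>2"
      by (simp only: power2_eq_square)
    then show ?thesis by (rule power2_le_imp_le) simp
  qed
  have "(\<Sum>i<n. \<Sum>j<n. of_real (v i) * (of_real (?h i j) * w j + pert G w i j j / of_nat n))
      = (1 + z * q) + (\<Sum>i<n. \<Sum>j<n. of_real (v i) * pert G w i j j) / of_nat n"
    unfolding 1[symmetric] by (simp add: ring_distribs sum.distrib sum_divide_distrib)
  also have "\<dots> = (1 + z * q + m * q)
      + ((\<Sum>j<n. w j * w j) - (\<Sum>i<n. of_real (v i) * (G i i * w i))) / of_nat n"
    unfolding 2 using n by (simp add: field_simps)
  finally have "(1 + z * q + m * q) - (\<Sum>i<n. \<Sum>j<n. of_real (v i) *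
      (of_real (?h i j) * w j + pert G w i j j / of_nat n))
      = ((\<Sum>i<n. of_real (v i) * (G i i * w i)) - (\<Sum>j<n. w j * w j)) / of_nat n"
    using n by (simp add: field_simps)
  moreover have "cmod ((\<Sum>i<n. of_real (v i) * (G i i * w i)) - (\<Sum>j<n. w j * w j)) \<le> ?B\<^sup>2 + ?B\<^sup>2"
    by (rule order_trans[OF norm_triangle_ineq4 add_mono[OF b2 b1]])
  ultimately show ?thesis
    using n by (simp only: norm_divide norm_of_nat mult_2) (intro divide_right_mono; simp)
qed

section \<open>The self-consistent equation\<close>

lemma borel_measurable_cnj [measurable (raw)]:
  "f \<in> borel_measurable M \<Longrightarrow> (\<lambda>x. cnj (f x)) \<in> borel_measurable M"
  by (rule measurable_compose[of f M borel cnj])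
     (auto intro!: borel_measurable_continuous_onI continuous_intros)

lemma norm_integral_le:
  fixes f :: "'a \<Rightarrow> complex"
  assumes "integrable M f" "integrable M g" "\<And>x. x \<in> space M \<Longrightarrow> cmod (f x) \<le> g x"
  shows "cmod (\<integral>x. f x \<partial>M) \<le> (\<integral>x. g x \<partial>M)"
  using integral_norm_bound[of M f] integral_mono[OF integrable_norm[OF assms(1)] assms(2,3)]
  by (rule order_trans)

text \<open>Expectations are computed on the product of copies of the law D, indexed by the upper
  triangle; the noise matrices of the theorem enter later through their joint law alone.\<close>

locale entry_law = prob_space D for D :: "real measure" +
  assumes sets_D [measurable_cong]: "sets D = sets borel"
    and moments: "\<And>k::nat. integrable D (\<lambda>y. y ^ k)"
    and mean_zero: "(\<integral>y. y \<partial>D) = 0"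
    and second_moment: "(\<integral>y. y\<^sup>2 \<partial>D) = 1"
begin

section \<open>Integration over independent entries\<close>

definition upper_idx :: "nat \<Rightarrow> (nat \<times> nat) set" where
  "upper_idx n = {(i, j). i \<le> j \<and> j < n}"

definition entry_space :: "nat \<Rightarrow> (nat \<times> nat \<Rightarrow> real) measure" where
  "entry_space n = PiM (upper_idx n) (\<lambda>_. D)"

lemma finite_upper_idx [simp]: "finite (upper_idx n)"
  by (rule finite_subset[of _ "{..<n} \<times> {..<n}"]) (auto simp: upper_idx_def)

lemma edge_in_upper_idx: "i < n \<Longrightarrow> j < n \<Longrightarrow> edge i j \<in> upper_idx n"
  by (auto simp: edge_def upper_idx_def)

lemma space_D: "space D = UNIV"
  using sets_eq_imp_space_eq[OF sets_D] by simp

lemma prob_space_entry_space: "prob_space (entry_space n)"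
  unfolding entry_space_def by (intro prob_space_PiM) (rule prob_space_axioms)

lemma measurable_entry:
  assumes "e \<in> upper_idx n" shows "(\<lambda>x. x e) \<in> borel_measurable (entry_space n)"
proof -
  have "(\<lambda>x. x e) \<in> measurable (entry_space n) D"
    unfolding entry_space_def using assms by (rule measurable_component_singleton)
  then show ?thesis by (simp cong: measurable_cong_sets add: sets_D)
qed

lemma measurable_sym_of:
  "i < n \<Longrightarrow> j < n \<Longrightarrow> (\<lambda>x. sym_of n x i j) \<in> borel_measurable (entry_space n)"
  using measurable_entry[OF edge_in_upper_idx[of i n j]] by (simp add: sym_of_def edge_def)

lemma measurable_entry_space_resolvent:
  "i < n \<Longrightarrow> j < n \<Longrightarrow> (\<lambda>x. resolvent n z (sym_of n x) i j) \<in> borel_measurable (entry_space n)"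
  by (rule measurable_resolvent) (rule measurable_sym_of)

lemma measurable_entry_space_res_vec:
  "i < n \<Longrightarrow> (\<lambda>x. res_vec n z (sym_of n x) v i) \<in> borel_measurable (entry_space n)"
  unfolding res_vec_def
  by (intro borel_measurable_sum borel_measurable_times borel_measurable_const
      measurable_entry_space_resolvent) auto

lemma measurable_entry_space_res_quad: "(\<lambda>x. res_quad n z (sym_of n x) v) \<in> borel_measurable (entry_space n)"
  unfolding res_quad_def
  by (intro borel_measurable_sum borel_measurable_times borel_measurable_const
      measurable_entry_space_res_vec) auto

lemma measurable_entry_space_res_trace: "(\<lambda>x. res_trace n z (sym_of n x)) \<in> borel_measurable (entry_space n)"
  unfolding res_trace_def
  by (intro borel_measurable_sum borel_measurable_divide borel_measurable_const
      measurable_entry_space_resolvent) auto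

lemma measurable_entry_space_pert:
  "i < n \<Longrightarrow> j < n \<Longrightarrow> (\<lambda>x. pert (resolvent n z (sym_of n x)) (res_vec n z (sym_of n x) v) i j j)
    \<in> borel_measurable (entry_space n)"
  unfolding pert_def
  by (cases "i = j") (auto intro!: borel_measurable_times borel_measurable_add
      measurable_entry_space_resolvent measurable_entry_space_res_vec)

text \<open>D is a measure on the whole line, so 0 is an admissible coordinate value even if the law
  gives no mass near it.\<close>

lemma measurable_zeroed:
  assumes "e \<in> upper_idx n" shows "(\<lambda>x. x(e := 0)) \<in> measurable (entry_space n) (entry_space n)"
  unfolding entry_space_def
proof (rule measurable_PiM_single')
  fix k assume "k \<in> upper_idx n"
  then show "(\<lambda>x. (x(e := 0)) k) \<in> measurable (PiM (upper_idx n) (\<lambda>_. D)) D"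
    by (cases "k = e") (auto intro: measurable_component_singleton simp: space_D)
next
  show "(\<lambda>x. x(e := 0)) \<in> space (PiM (upper_idx n) (\<lambda>_. D)) \<rightarrow> (\<Pi>\<^sub>E k\<in>upper_idx n. space D)"
    using assms by (auto simp: space_PiM space_D PiE_iff extensional_def)
qed

lemma
  fixes g :: "real \<Rightarrow> real"
  assumes "e \<in> upper_idx n" and g: "integrable D g"
  shows integrable_entry: "integrable (entry_space n) (\<lambda>x. g (x e))"
    and integral_entry: "(\<integral>x. g (x e) \<partial>entry_space n) = (\<integral>y. g y \<partial>D)"
proof -
  have d: "distr (entry_space n) D (\<lambda>x. x e) = D"
    unfolding entry_space_def using distr_PiM_component[of "upper_idx n" "\<lambda>_. D" e] assms prob_space_axioms by simp
  have m: "(\<lambda>x. x e) \<in> measurable (entry_space n) D"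
    unfolding entry_space_def using assms by (intro measurable_component_singleton)
  show "integrable (entry_space n) (\<lambda>x. g (x e))"
    using integrable_distr[OF m, of g] g d by simp
  show "(\<integral>x. g (x e) \<partial>entry_space n) = (\<integral>y. g y \<partial>D)"
    using integral_distr[OF m, of g] g d by simp
qed

text \<open>F at the zeroed point does not see the coordinate e. By Fubini that coordinate can be
  integrated first, which leaves the integral of g as a factor.\<close>

lemma expectation_zeroed:
  fixes g :: "real \<Rightarrow> real" and F :: "(nat \<times> nat \<Rightarrow> real) \<Rightarrow> complex"
  assumes e: "e \<in> upper_idx n" and g: "integrable D g" and F: "F \<in> borel_measurable (entry_space n)"
    and K: "\<And>x. x \<in> space (entry_space n) \<Longrightarrow> cmod (F x) \<le> K" and zero: "(\<integral>y. g y \<partial>D) = 0"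
  shows "integrable (entry_space n) (\<lambda>x. of_real (g (x e)) * F (x(e := 0)))"
    and "(\<integral>x. of_real (g (x e)) * F (x(e := 0)) \<partial>entry_space n) = 0"
proof -
  let ?f = "\<lambda>x. of_real (g (x e)) * F (x(e := 0))"
  have m: "(\<lambda>x. F (x(e := 0))) \<in> borel_measurable (entry_space n)"
    by (rule measurable_compose[OF measurable_zeroed[OF e] F])
  have gm: "(\<lambda>x. g (x e)) \<in> borel_measurable (entry_space n)"
    using integrable_entry[OF e g] by auto
  have K0: "K \<ge> 0"
    using K prob_space.not_empty[OF prob_space_entry_space[of n]] norm_ge_zero order_trans by blast
  show int: "integrable (entry_space n) ?f"
  proof (rule Bochner_Integration.integrable_bound)
    show "integrable (entry_space n) (\<lambda>x. K * g (x e))" using integrable_entry[OF e g] by simp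
    show "?f \<in> borel_measurable (entry_space n)" using m gm by measurable
    have "cmod (?f x) \<le> norm (K * g (x e))" if "x \<in> space (entry_space n)" for x
      using K[OF measurable_space[OF measurable_zeroed[OF e] that]] K0
      by (simp add: norm_mult abs_mult mult.commute[of "\<bar>g (x e)\<bar>"] mult_right_mono)
    then show "AE x in entry_space n. cmod (?f x) \<le> norm (K * g (x e))" by simp
  qed
  interpret P: product_sigma_finite "\<lambda>_::nat \<times> nat. D"
    by (rule product_sigma_finite.intro) (rule sigma_finite_measure_axioms)
  have ins: "insert e (upper_idx n - {e}) = upper_idx n" using e by auto
  have "(\<integral>x. ?f x \<partial>entry_space n)
      = (\<integral>x. (\<integral>y. ?f (x(e := y)) \<partial>D) \<partial>PiM (upper_idx n - {e}) (\<lambda>_. D))"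
    using P.product_integral_insert[of "upper_idx n - {e}" e ?f] int
    unfolding ins entry_space_def by simp
  also have "\<dots> = 0"
    using g zero by simp
  finally show "(\<integral>x. ?f x \<partial>entry_space n) = 0" .
qed

text \<open>The exponent is 8 because \<open>loc_err_bound\<close> carries the fourth power of 1 +
  |x|, which gets squared when it is separated from \<open>fluct\<close>.\<close>

definition moment8 :: real where "moment8 = (\<integral>y. (1 + \<bar>y\<bar>) ^ 8 \<partial>D)"

lemma integrable_moment8: "integrable D (\<lambda>y. (1 + \<bar>y\<bar>) ^ 8)"
proof (rule Bochner_Integration.integrable_bound)
  \<comment> \<open>256 = 2^8: the base 1 + |y| is at most 2 or at most 2 |y|, according to whether
    |y| <= 1.\<close>
  show "integrable D (\<lambda>y. 256 * (1 + y ^ 8))" using moments by simp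
  show "(\<lambda>y. (1 + \<bar>y\<bar>) ^ 8) \<in> borel_measurable D" by measurable
  have "(1 + \<bar>y\<bar>) ^ 8 \<le> 256 * (1 + y ^ 8)" for y :: real
  proof (cases "\<bar>y\<bar> \<le> 1")
    case True
    then have "(1 + \<bar>y\<bar>) ^ 8 \<le> 2 ^ 8" by (intro power_mono) auto
    also have "(2::real) ^ 8 \<le> 256 * (1 + y ^ 8)"
      using mult_left_mono[of 1 "1 + y ^ 8" "256::real"] by simp
    finally show ?thesis .
  next
    case False
    then have "(1 + \<bar>y\<bar>) ^ 8 \<le> (2 * \<bar>y\<bar>) ^ 8" by (intro power_mono) auto
    then show ?thesis by (simp add: power_mult_distrib power_even_abs)
  qed
  then show "AE y in D. norm ((1 + \<bar>y\<bar>) ^ 8) \<le> norm (256 * (1 + y ^ 8))"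
    by (intro AE_I2) (metis abs_ge_self abs_ge_zero abs_of_nonneg add_nonneg_nonneg order_trans
        real_norm_def zero_le_one zero_le_power)
qed

text \<open>Test functions against which the self-consistent equation holds up to O(K / sqrt n).\<close>
definition admissible :: "nat \<Rightarrow> complex \<Rightarrow> (nat \<Rightarrow> real) \<Rightarrow> real \<Rightarrow>
    ((nat \<times> nat \<Rightarrow> real) \<Rightarrow> complex) \<Rightarrow> bool" where
  "admissible n z v K Y \<longleftrightarrow> Y \<in> borel_measurable (entry_space n) \<and> (\<forall>x\<in>space (entry_space n). cmod (Y x) \<le> K) \<and>
     (\<forall>x\<in>space (entry_space n). \<forall>i<n. \<forall>j<n. cmod (Y x - Y (x(edge i j := 0)))
        \<le> K * (1 + \<bar>x (edge i j)\<bar>)\<^sup>2 * sqrt (real n) * fluct n z v x i j)"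

text \<open>The first factor comes from \<open>loc_err_bound\<close>; the half sum pairs the eighth
  moment with the constant of \<open>sum_fluct_sq\<close>; the last summand comes from
  \<open>self_consistent_decomp\<close>.\<close>

definition est_const :: "complex \<Rightarrow> real" where
  "est_const z = (1 / Im z + 10 * (1 / Im z)\<^sup>2) *
     ((moment8 + 3 * ((1 / Im z)^4 + 4 * (1 / Im z)^2 + 1)) / 2) + 2 * (1 / Im z)\<^sup>2"

text \<open>Subtracting the mean-zero parts \<open>Z\<close> leaves the local errors. Their sum
  against v is split by 2 a b <= a^2 / c + c b^2 with c = n^(3/2), which balances n / n^(3/2) from
  the moments against n^(3/2) / n^2 from \<open>sum_fluct_sq\<close>.\<close>

lemma self_consistent:
  assumes z: "Im z > 0" and n: "n \<ge> 1" and v: "(\<Sum>i<n. (v i)\<^sup>2) = 1"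
    and Y: "admissible n z v K Y"
  shows "cmod (\<integral>x. (1 + z * res_quad n z (sym_of n x) v
      + res_trace n z (sym_of n x) * res_quad n z (sym_of n x) v) * Y x \<partial>entry_space n)
    \<le> est_const z * K / sqrt n"
proof -
  interpret O: prob_space "entry_space n" by (rule prob_space_entry_space)
  define B where "B = 1 / Im z"
  define C where "C = 3 * (B^4 + 4 * B^2 + 1)"
  define A where "A = (B + 10 * B\<^sup>2) * K"
  define r where "r = sqrt (real n)"
  define F where "F x = (1 + z * res_quad n z (sym_of n x) v
      + res_trace n z (sym_of n x) * res_quad n z (sym_of n x) v)" for x
  define Z where "Z i j x = of_real (sym_of n x i j)
      * (res_vec n z (sym_of n (x(edge i j := 0))) v j * Y (x(edge i j := 0)))
      + (1 / of_nat n - (of_real (sym_of n x i j))\<^sup>2)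
      * (pert (resolvent n z (sym_of n (x(edge i j := 0))))
          (res_vec n z (sym_of n (x(edge i j := 0))) v) i j j * Y (x(edge i j := 0)))" for i j x
  have Ym: "Y \<in> borel_measurable (entry_space n)" and Yb: "\<And>x. x \<in> space (entry_space n) \<Longrightarrow> cmod (Y x) \<le> K"
    using Y by (auto simp: admissible_def)
  have K: "K \<ge> 0" using Yb O.not_empty norm_ge_zero order_trans by blast
  have B: "B > 0" using z by (simp add: B_def)
  have r: "r \<ge> 1" "r\<^sup>2 = n" "r > 0" using n by (auto simp: r_def)
  have Zint: "integrable (entry_space n) (Z i j)" "(\<integral>x. Z i j x \<partial>entry_space n) = 0" if ij: "i < n" "j < n" for i j
  proof -
    let ?e = "edge i j"
    let ?w = "\<lambda>x. res_vec n z (sym_of n x) v"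
    let ?p = "\<lambda>x. pert (resolvent n z (sym_of n x)) (?w x) i j j"
    have e: "?e \<in> upper_idx n" using ij by (rule edge_in_upper_idx)
    have i1: "integrable D (\<lambda>y. y / r)" and i2: "integrable D (\<lambda>y. 1 / n - y\<^sup>2 / n)"
      using moments[of 1] moments[of 2] by auto
    \<comment> \<open>The normalisation of the first two moments enters here. Diagonal entries have
      the same law, so the pair i = j needs no special treatment.\<close>
    have m1: "(\<integral>y. y / r \<partial>D) = 0" using mean_zero by simp
    have m2: "(\<integral>y. 1 / n - y\<^sup>2 / n \<partial>D) = 0"
      using moments[of 2] second_moment by (simp add: prob_space)
    have b1: "cmod (?w x j * Y x) \<le> B * K" if "x \<in> space (entry_space n)" for x
      unfolding norm_mult B_def using res_vec_bound[OF sym_on_sym_of z v ij(2)] Yb[OF that] z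
      by (intro mult_mono) auto
    have b2: "cmod (?p x * Y x) \<le> B * (B + B) * K" if "x \<in> space (entry_space n)" for x
    proof -
      have "cmod (?p x) \<le> B * (cmod (?w x i) + cmod (?w x j))"
        unfolding B_def using resolvent_bound[OF sym_on_sym_of z] ij by (intro pert_bound) auto
      also have "\<dots> \<le> B * (B + B)"
        unfolding B_def using res_vec_bound[OF sym_on_sym_of z v] ij z
        by (intro mult_left_mono add_mono) auto
      finally show ?thesis unfolding norm_mult using Yb[OF that] B by (intro mult_mono) auto
    qed
    note Z1 = expectation_zeroed[OF e i1 _ b1 m1] and Z2 = expectation_zeroed[OF e i2 _ b2 m2]
    have q1: "(\<lambda>x. ?w x j * Y x) \<in> borel_measurable (entry_space n)"
      using measurable_entry_space_res_vec[OF ij(2)] Ym by (rule borel_measurable_times)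
    have q2: "(\<lambda>x. ?p x * Y x) \<in> borel_measurable (entry_space n)"
      using measurable_entry_space_pert[OF ij] Ym by (rule borel_measurable_times)
    have eq: "Z i j x = of_real (x ?e / r) * (?w (x(?e := 0)) j * Y (x(?e := 0)))
        + of_real (1 / n - (x ?e)\<^sup>2 / n) * (?p (x(?e := 0)) * Y (x(?e := 0)))" for x
      using r(2) by (simp add: Z_def sym_of_def r_def edge_def power_divide flip: of_real_power)
    show "integrable (entry_space n) (Z i j)" "(\<integral>x. Z i j x \<partial>entry_space n) = 0"
      unfolding eq[abs_def] using Z1[OF q1] Z2[OF q2] by simp_all
  qed
  define ZZ where "ZZ x = (\<Sum>i<n. \<Sum>j<n. of_real (v i) * Z i j x)" for x
  have ZZ: "integrable (entry_space n) ZZ"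
    unfolding ZZ_def[abs_def] using Zint(1)
    by (intro Bochner_Integration.integrable_sum integrable_mult_right) auto
  have ZZ0: "(\<integral>x. ZZ x \<partial>entry_space n) = 0"
  proof -
    have i: "integrable (entry_space n) (\<lambda>x. of_real (v i) * Z i j x)" if "i < n" "j < n" for i j
      using Zint(1)[OF that] by simp
    have "(\<integral>x. ZZ x \<partial>entry_space n) = (\<Sum>i<n. \<integral>x. (\<Sum>j<n. of_real (v i) * Z i j x) \<partial>entry_space n)"
      unfolding ZZ_def
      by (intro Bochner_Integration.integral_sum Bochner_Integration.integrable_sum i) auto
    also have "\<dots> = (\<Sum>i<n. \<Sum>j<n. \<integral>x. of_real (v i) * Z i j x \<partial>entry_space n)"
      by (intro sum.cong refl Bochner_Integration.integral_sum i) auto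
    finally show ?thesis using Zint(2) by simp
  qed
  \<comment> \<open>An integrable majorant in which only the moment sum is still random:
    \<open>sum_fluct_sq\<close> has replaced the sum of the squared \<open>fluct\<close> by a
    constant.\<close>
  define g where "g x = 2 * B\<^sup>2 / n * K + A * (1 / (2 * r^3) *
      (\<Sum>i<n. \<Sum>j<n. (v i)\<^sup>2 * (1 + \<bar>x (edge i j)\<bar>)^8) + r^3 / 2 * (C / (real n)\<^sup>2))" for x
  have Fb: "cmod (F x * Y x - ZZ x) \<le> g x" if x: "x \<in> space (entry_space n)" for x
  proof -
    let ?L = "\<lambda>i j. loc_err n z v Y x i j"
    let ?w = "res_vec n z (sym_of n x) v" and ?G = "resolvent n z (sym_of n x)"
    let ?S = "\<Sum>i<n. \<Sum>j<n. of_real (v i) * (of_real (sym_of n x i j) * ?w j + pert ?G ?w i j j / of_nat n)"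
    have LZ: "(of_real (sym_of n x i j) * ?w j + pert ?G ?w i j j / of_nat n) * Y x
        = ?L i j + Z i j x" for i j
      by (simp add: loc_err_def Z_def Let_def algebra_simps)
    have "?S * Y x = (\<Sum>i<n. \<Sum>j<n. of_real (v i) *
        ((of_real (sym_of n x i j) * ?w j + pert ?G ?w i j j / of_nat n) * Y x))"
      by (simp only: sum_distrib_right mult.assoc)
    also have "\<dots> = (\<Sum>i<n. \<Sum>j<n. of_real (v i) * ?L i j) + ZZ x"
      by (simp only: LZ distrib_left sum.distrib ZZ_def)
    finally have "?S * Y x = (\<Sum>i<n. \<Sum>j<n. of_real (v i) * ?L i j) + ZZ x" .
    then have split: "F x * Y x - ZZ x = (F x - ?S) * Y x + (\<Sum>i<n. \<Sum>j<n. of_real (v i) * ?L i j)"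
      by (simp only: left_diff_distrib) simp
    have decomp: "cmod (F x - ?S) \<le> 2 * B\<^sup>2 / n"
      unfolding F_def B_def by (rule self_consistent_decomp[OF z n v])
    have "cmod ((F x - ?S) * Y x) \<le> 2 * B\<^sup>2 / n * K"
      unfolding norm_mult using decomp Yb[OF x] by (rule mult_mono) auto
    moreover have "cmod (\<Sum>i<n. \<Sum>j<n. of_real (v i) * ?L i j)
        \<le> (\<Sum>i<n. \<Sum>j<n. \<bar>v i\<bar> * cmod (?L i j))"
      by (intro order_trans[OF norm_sum] sum_mono) (simp add: norm_mult)
    moreover have "(\<Sum>i<n. \<Sum>j<n. \<bar>v i\<bar> * cmod (?L i j))
        \<le> (\<Sum>i<n. \<Sum>j<n. A * (1 / (2 * r^3) * ((v i)\<^sup>2 * (1 + \<bar>x (edge i j)\<bar>)^8)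
            + r^3 / 2 * (fluct n z v x i j)\<^sup>2))"
    proof (intro sum_mono)
      fix i j assume "i \<in> {..<n}" "j \<in> {..<n}"
      then have ij: "i < n" "j < n" by auto
      let ?\<rho> = "1 + \<bar>x (edge i j)\<bar>" and ?T = "fluct n z v x i j"
      have "cmod (?L i j) \<le> A * ?\<rho>^4 * ?T"
        unfolding A_def B_def using Y x ij Yb[OF x]
        by (intro loc_err_bound[OF z ij v]) (auto simp: admissible_def)
      then have "\<bar>v i\<bar> * cmod (?L i j) \<le> \<bar>v i\<bar> * (A * ?\<rho>^4 * ?T)"
        by (rule mult_left_mono) simp
      also have "\<dots> = A * ((\<bar>v i\<bar> * ?\<rho>^4) * ?T)" by simp
      also have "\<dots> \<le> A * (1 / (2 * r^3) * ((v i)\<^sup>2 * ?\<rho>^8) + r^3 / 2 * ?T\<^sup>2)"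
      proof (rule mult_left_mono)
        have "a * b \<le> 1 / (2 * c) * a\<^sup>2 + c / 2 * b\<^sup>2" if "c > 0" for a b c :: real
        proof -
          have "2 * c * (a * b) \<le> a\<^sup>2 + (c * b)\<^sup>2"
            using sum_squares_bound[of a "c * b"] by (simp add: mult_ac)
          then show ?thesis using that by (simp add: field_simps power2_eq_square)
        qed
        from this[of "r^3" "\<bar>v i\<bar> * ?\<rho>^4" ?T]
        show "\<bar>v i\<bar> * ?\<rho>^4 * ?T \<le> 1 / (2 * r^3) * ((v i)\<^sup>2 * ?\<rho>^8) + r^3 / 2 * ?T\<^sup>2"
          using r by (simp add: power_mult_distrib flip: power_mult)
        show "A \<ge> 0" using B K by (simp add: A_def)
      qed
      finally show "\<bar>v i\<bar> * cmod (?L i j)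
          \<le> A * (1 / (2 * r^3) * ((v i)\<^sup>2 * ?\<rho>^8) + r^3 / 2 * ?T\<^sup>2)" .
    qed
    moreover have "(\<Sum>i<n. \<Sum>j<n. A * (1 / (2 * r^3) * ((v i)\<^sup>2 * (1 + \<bar>x (edge i j)\<bar>)^8)
            + r^3 / 2 * (fluct n z v x i j)\<^sup>2))
        = A * (1 / (2 * r^3) * (\<Sum>i<n. \<Sum>j<n. (v i)\<^sup>2 * (1 + \<bar>x (edge i j)\<bar>)^8)
        + r^3 / 2 * (\<Sum>i<n. \<Sum>j<n. (fluct n z v x i j)\<^sup>2))"
      by (simp only: sum.distrib sum_distrib_left distrib_left)
    moreover have "A * (1 / (2 * r^3) * (\<Sum>i<n. \<Sum>j<n. (v i)\<^sup>2 * (1 + \<bar>x (edge i j)\<bar>)^8)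
        + r^3 / 2 * (\<Sum>i<n. \<Sum>j<n. (fluct n z v x i j)\<^sup>2)) \<le> A * (1 / (2 * r^3) * (\<Sum>i<n. \<Sum>j<n. (v i)\<^sup>2 * (1 + \<bar>x (edge i j)\<bar>)^8)
        + r^3 / 2 * (C / (real n)\<^sup>2))"
      using sum_fluct_sq[OF z v n, of x] r B K
      by (intro mult_left_mono add_mono) (auto simp: A_def C_def B_def)
    moreover have "cmod (p + q) \<le> a + c" if "cmod p \<le> a" "cmod q \<le> b" "b \<le> d" "d = e" "e \<le> c"
      for p q :: complex and a b c d e
      using norm_triangle_mono[OF that(1), of q c] that(2-) by simp
    ultimately show ?thesis unfolding split g_def by blast
  qed
  define SS where "SS x = (\<Sum>i<n. \<Sum>j<n. (v i)\<^sup>2 * (1 + \<bar>x (edge i j)\<bar>)^8)" for x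
  have i8: "integrable (entry_space n) (\<lambda>x. (v i)\<^sup>2 * (1 + \<bar>x (edge i j)\<bar>)^8)" if "i < n" "j < n" for i j
    using integrable_entry[OF edge_in_upper_idx[OF that] integrable_moment8] by simp
  have SSint: "integrable (entry_space n) SS"
    unfolding SS_def[abs_def] by (intro Bochner_Integration.integrable_sum i8) auto
  have "(\<integral>x. SS x \<partial>entry_space n)
      = (\<Sum>i<n. \<integral>x. (\<Sum>j<n. (v i)\<^sup>2 * (1 + \<bar>x (edge i j)\<bar>)^8) \<partial>entry_space n)"
    unfolding SS_def
    by (intro Bochner_Integration.integral_sum Bochner_Integration.integrable_sum i8) auto
  also have "\<dots> = (\<Sum>i<n. \<Sum>j<n. \<integral>x. (v i)\<^sup>2 * (1 + \<bar>x (edge i j)\<bar>)^8 \<partial>entry_space n)"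
    by (intro sum.cong refl Bochner_Integration.integral_sum i8) auto
  finally have SS: "(\<integral>x. SS x \<partial>entry_space n) = (\<Sum>i<n. \<Sum>j<n. (v i)\<^sup>2 * moment8)"
    by (simp add: integral_entry[OF edge_in_upper_idx integrable_moment8] moment8_def)
  have gint: "integrable (entry_space n) g"
    unfolding g_def[abs_def] SS_def[symmetric] using SSint by simp
  have "(\<integral>x. g x \<partial>entry_space n) = 2 * B\<^sup>2 / n * K + A * (1 / (2 * r^3) *
      (\<Sum>i<n. \<Sum>j<n. (v i)\<^sup>2 * moment8) + r^3 / 2 * (C / (real n)\<^sup>2))"
    unfolding g_def SS_def[symmetric] SS[symmetric] using SSint by (simp add: O.prob_space)
  also have "(\<Sum>i<n. \<Sum>j<n. (v i)\<^sup>2 * moment8) = n * moment8"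
    using v by (simp flip: sum_distrib_left sum_distrib_right)
  also have "2 * B\<^sup>2 / n * K + A * (1 / (2 * r^3) * (n * moment8) + r^3 / 2 * (C / (real n)\<^sup>2))
      = 2 * B\<^sup>2 / n * K + A * ((moment8 + C) / 2) / r"
    unfolding r(2)[symmetric] using r(3) by (simp add: field_simps power2_eq_square power3_eq_cube)
  \<comment> \<open>The remainder of order 1 / n is relaxed to 1 / sqrt n, so that one rate covers
    both terms.\<close>
  also have "\<dots> \<le> 2 * B\<^sup>2 / r * K + A * ((moment8 + C) / 2) / r"
  proof -
    have "r \<le> n" unfolding r(2)[symmetric] using r(1) by (simp add: power2_eq_square)
    then show ?thesis using K r n by (intro add_right_mono mult_right_mono divide_left_mono) auto
  qed
  also have "\<dots> = est_const z * K / r"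
    by (simp add: est_const_def A_def C_def B_def algebra_simps add_divide_distrib)
  finally have g: "(\<integral>x. g x \<partial>entry_space n) \<le> est_const z * K / r" .
  have FYm: "(\<lambda>x. F x * Y x) \<in> borel_measurable (entry_space n)"
    unfolding F_def using Ym measurable_entry_space_res_quad measurable_entry_space_res_trace by measurable
  have int: "integrable (entry_space n) (\<lambda>x. F x * Y x - ZZ x)"
    using FYm ZZ by (intro Bochner_Integration.integrable_bound[OF gint] AE_I2
        borel_measurable_diff) (auto intro: order_trans[OF Fb])
  have "(\<integral>x. F x * Y x \<partial>entry_space n) = (\<integral>x. (F x * Y x - ZZ x) + ZZ x \<partial>entry_space n)" by simp
  also have "\<dots> = (\<integral>x. F x * Y x - ZZ x \<partial>entry_space n)"
    using Bochner_Integration.integral_add[OF int ZZ] ZZ0 by simp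
  finally have "cmod (\<integral>x. F x * Y x \<partial>entry_space n) \<le> (\<integral>x. g x \<partial>entry_space n)"
    using norm_integral_le[OF int gint Fb] by simp
  with g show ?thesis by (simp add: F_def r_def)
qed

section \<open>Convergence in L^2 of the trace and of the quadratic form\<close>

lemma L2_integrable:
  assumes "f \<in> borel_measurable (entry_space n)" "\<And>x. cmod (f x) \<le> K"
  shows "integrable (entry_space n) f" "integrable (entry_space n) (\<lambda>x. (cmod (f x))\<^sup>2)"
proof -
  interpret O: prob_space "entry_space n" by (rule prob_space_entry_space)
  show "integrable (entry_space n) f"
    using assms by (intro O.integrable_const_bound[where B = K]) auto
  have "(cmod (f x))\<^sup>2 \<le> K\<^sup>2" for x using assms(2) by (intro power_mono) auto
  then show "integrable (entry_space n) (\<lambda>x. (cmod (f x))\<^sup>2)"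
    using assms(1) by (intro O.integrable_const_bound[where B = "K\<^sup>2"]) auto
qed

text \<open>One entry moves the trace by O(|h| / n), that is r times 1 / r^4 up to the factor 1 +
  |x|, so the last term of \<open>fluct\<close> alone suffices.\<close>

lemma admissible_trace:
  assumes z: "Im z > 0" and v: "(\<Sum>i<n. (v i)\<^sup>2) = 1"
  shows "admissible n z v (1 / Im z + cmod s + 2 * (1 / Im z)\<^sup>2)
    (\<lambda>x. cnj (res_trace n z (sym_of n x) - s))"
  unfolding admissible_def
proof (intro conjI ballI allI impI)
  let ?m = "\<lambda>x. res_trace n z (sym_of n x)" and ?B = "1 / Im z"
  show "(\<lambda>x. cnj (?m x - s)) \<in> borel_measurable (entry_space n)"
    using measurable_entry_space_res_trace by measurable
  fix x assume x: "x \<in> space (entry_space n)"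
  have "cmod (?m x - s) \<le> ?B + cmod s"
    using res_trace_bound[OF sym_on_sym_of z, of n x] norm_triangle_ineq4[of "?m x" s] by linarith
  moreover have "0 \<le> 2 * ?B\<^sup>2" by simp
  ultimately show "cmod (cnj (?m x - s)) \<le> ?B + cmod s + 2 * ?B\<^sup>2"
    unfolding complex_mod_cnj by linarith
  fix i j assume ij: "i < n" "j < n"
  define r where "r = sqrt (real n)"
  define \<rho> where "\<rho> = 1 + \<bar>x (edge i j)\<bar>"
  have r: "r \<ge> 1" "r\<^sup>2 = n" "r > 0" using ij by (auto simp: r_def)
  have "cmod (?m x - ?m (x(edge i j := 0))) \<le> 2 * ?B\<^sup>2 * \<bar>sym_of n x i j\<bar> / n"
    by (rule res_trace_zeroed[OF z ij])
  also have "\<dots> \<le> 2 * ?B\<^sup>2 * (\<rho> / r) / n"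
    by (intro divide_right_mono mult_left_mono)
       (auto simp: sym_of_def \<rho>_def r_def edge_def divide_right_mono)
  also have "\<dots> = 2 * ?B\<^sup>2 * \<rho> * (r * (1 / r^4))"
    unfolding r(2)[symmetric] using r by (simp add: field_simps power2_eq_square power4_eq_xxxx)
  also have "\<dots> \<le> (?B + cmod s + 2 * ?B\<^sup>2) * \<rho>\<^sup>2 * (r * fluct n z v x i j)"
  proof (intro mult_mono)
    show "\<rho> \<le> \<rho>\<^sup>2" by (rule self_le_power) (auto simp: \<rho>_def)
    show "1 / r ^ 4 \<le> fluct n z v x i j" by (simp add: fluct_def Let_def r_def)
  qed (use z r in \<open>auto simp: \<rho>_def\<close>)
  finally show "cmod (cnj (?m x - s) - cnj (?m (x(edge i j := 0)) - s))
      \<le> (?B + cmod s + 2 * ?B\<^sup>2) * (1 + \<bar>x (edge i j)\<bar>)\<^sup>2 * sqrt (real n) * fluct n z v x i j"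
    by (simp add: \<rho>_def r_def mult.assoc flip: complex_cnj_diff)
qed

text \<open>By \<open>res_quad_zeroed\<close> the change of q is h times products of coordinates of
  \<open>w0\<close> and \<open>w\<close>. Replacing \<open>w0\<close> by \<open>w\<close> costs a
  second factor h, which is why \<open>admissible\<close> allows the square of 1 + |x|. Main part
  and correction match the first two terms of \<open>fluct\<close>; the summands 2 and 2 (1 / Im
  z)^2 of the constant cover their coefficients.\<close>

lemma admissible_quad:
  assumes z: "Im z > 0" and v: "(\<Sum>i<n. (v i)\<^sup>2) = 1"
  shows "admissible n z v (1 / Im z + cmod s + 2 + 2 * (1 / Im z)\<^sup>2)
    (\<lambda>x. cnj (res_quad n z (sym_of n x) v - s))"
  unfolding admissible_def
proof (intro conjI ballI allI impI)
  let ?q = "\<lambda>x. res_quad n z (sym_of n x) v"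
  define B where "B = 1 / Im z"
  define K where "K = B + cmod s + 2 + 2 * B\<^sup>2"
  show "(\<lambda>x. cnj (?q x - s)) \<in> borel_measurable (entry_space n)"
    using measurable_entry_space_res_quad by measurable
  fix x assume x: "x \<in> space (entry_space n)"
  have "cmod (?q x - s) \<le> 1 / Im z + cmod s"
    using res_quad_bound[OF sym_on_sym_of z v, of x] norm_triangle_ineq4[of "?q x" s] by linarith
  moreover have "0 \<le> 2 + 2 * (1 / Im z)\<^sup>2" by (simp add: add_nonneg_nonneg)
  ultimately show "cmod (cnj (?q x - s)) \<le> 1 / Im z + cmod s + 2 + 2 * (1 / Im z)\<^sup>2"
    unfolding complex_mod_cnj by linarith
  fix i j assume ij: "i < n" "j < n"
  define x0 where "x0 = x(edge i j := 0)"
  define h where "h = sym_of n x i j"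
  define w where "w = res_vec n z (sym_of n x) v"
  define wz where "wz = res_vec n z (sym_of n x0) v"
  define r where "r = sqrt (real n)"
  define \<rho> where "\<rho> = 1 + \<bar>x (edge i j)\<bar>"
  define a where "a k = cmod (w k)" for k
  define S where "S = a i + a j"
  have B: "B \<ge> 0" using z by (simp add: B_def)
  have K: "K \<ge> 2 + 2 * B\<^sup>2" using B by (simp add: K_def)
  have K0: "K \<ge> 0" using B by (simp add: K_def add_nonneg_nonneg)
  have r: "r \<ge> 1" "r\<^sup>2 = n" "r > 0" using ij by (auto simp: r_def)
  have a: "0 \<le> a k" for k by (simp add: a_def)
  have ab: "a k \<le> B" if "k < n" for k
    using res_vec_bound[OF sym_on_sym_of z v that] by (simp add: a_def w_def B_def)
  have wzb: "cmod (wz p) \<le> a p + \<bar>h\<bar> * (B * S)" if p: "p < n" for p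
  proof -
    have "cmod (pert (resolvent n z (sym_of n x0)) w i j p) \<le> B * S"
      unfolding S_def a_def B_def using resolvent_bound[OF sym_on_sym_of z] ij p
      by (intro pert_bound) auto
    moreover have "wz p = w p + of_real h * pert (resolvent n z (sym_of n x0)) w i j p"
      using res_vec_zeroed[OF z ij p, of x v] by (simp add: w_def wz_def x0_def h_def)
    moreover have "cmod (w p + of_real h * pert (resolvent n z (sym_of n x0)) w i j p)
        \<le> a p + \<bar>h\<bar> * cmod (pert (resolvent n z (sym_of n x0)) w i j p)"
      by (rule order_trans[OF norm_triangle_ineq]) (simp add: a_def norm_mult)
    ultimately show ?thesis by (smt (verit) abs_ge_zero mult_left_mono)
  qed
  have hr: "\<bar>h\<bar> \<le> \<rho> / r"
    by (simp add: h_def sym_of_def \<rho>_def r_def edge_def divide_right_mono)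
  have "cmod (if i = j then wz i * w i else wz i * w j + wz j * w i)
      \<le> cmod (wz i) * a j + cmod (wz j) * a i"
    using norm_triangle_ineq[of "wz i * w j" "wz j * w i"] by (simp add: norm_mult a_def)
  also have "\<dots> \<le> (a i + \<bar>h\<bar> * (B * S)) * a j + (a j + \<bar>h\<bar> * (B * S)) * a i"
    using wzb ij a by (intro add_mono mult_right_mono) auto
  also have "\<dots> = 2 * (a i * a j) + \<bar>h\<bar> * (B * S * S)"
    by (simp add: S_def algebra_simps)
  \<comment> \<open>\<open>fluct\<close> contains S only linearly, so one of the two factors S is
    traded for 2 B.\<close>
  also have "\<dots> \<le> 2 * (a i * a j) + \<bar>h\<bar> * (B * S * (2 * B))"
    using ab[OF ij(1)] ab[OF ij(2)] a B by (intro add_left_mono mult_left_mono) (auto simp: S_def)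
  finally have "\<bar>h\<bar> * cmod (if i = j then wz i * w i else wz i * w j + wz j * w i)
      \<le> \<bar>h\<bar> * (2 * (a i * a j) + \<bar>h\<bar> * (B * S * (2 * B)))"
    by (rule mult_left_mono) simp
  also have "\<bar>h\<bar> * cmod (if i = j then wz i * w i else wz i * w j + wz j * w i) = cmod (?q x - ?q x0)"
    using res_quad_zeroed[OF z ij, of x v]
    by (simp add: w_def wz_def x0_def h_def norm_mult)
  also have "\<bar>h\<bar> * (2 * (a i * a j) + \<bar>h\<bar> * (B * S * (2 * B)))
      \<le> (\<rho> / r) * (2 * (a i * a j) + (\<rho> / r) * (B * S * (2 * B)))"
    using hr a B by (intro mult_mono add_left_mono mult_right_mono) (auto simp: S_def)
  also have "\<dots> = 2 * \<rho> * (r * (a i * a j / r^2)) + 2 * B\<^sup>2 * \<rho>\<^sup>2 * (r * (S / r^3))"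
    using r(3) by (simp add: field_simps power2_eq_square power3_eq_cube)
  also have "\<dots> \<le> K * \<rho>\<^sup>2 * (r * (a i * a j / r^2)) + K * \<rho>\<^sup>2 * (r * (S / r^3))"
  proof (intro add_mono mult_right_mono mult_mono)
    show "\<rho> \<le> \<rho>\<^sup>2" by (rule self_le_power) (auto simp: \<rho>_def)
    show "2 \<le> K" "2 * B\<^sup>2 \<le> K" using K zero_le_power2[of B] by linarith+
  qed (use a B r K0 in \<open>auto simp: \<rho>_def S_def\<close>)
  also have "\<dots> \<le> K * \<rho>\<^sup>2 * (r * fluct n z v x i j)"
  proof -
    have "a i * a j / r^2 + S / r^3 \<le> fluct n z v x i j"
      by (simp add: fluct_def Let_def r_def S_def a_def w_def)
    then have "K * \<rho>\<^sup>2 * (r * (a i * a j / r^2 + S / r^3)) \<le> K * \<rho>\<^sup>2 * (r * fluct n z v x i j)"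
      using r K0 by (intro mult_left_mono) auto
    then show ?thesis by (simp only: distrib_left)
  qed
  finally show "cmod (cnj (?q x - s) - cnj (?q (x(edge i j := 0)) - s))
      \<le> (1 / Im z + cmod s + 2 + 2 * (1 / Im z)\<^sup>2) * (1 + \<bar>x (edge i j)\<bar>)\<^sup>2 * sqrt (real n)
        * fluct n z v x i j"
    by (simp add: \<rho>_def r_def mult.assoc x0_def K_def B_def flip: complex_cnj_diff)
qed

text \<open>The polynomial 1 + z m + m^2 factors as (m - s) (m + z + s), and the second factor has imaginary part at least
  Im z.\<close>
lemma trace_L2:
  assumes z: "Im z > 0" and n: "n \<ge> 1" and s: "s\<^sup>2 + z * s + 1 = 0" "Im s > 0"
  shows "Im z * (\<integral>x. (cmod (res_trace n z (sym_of n x) - s))\<^sup>2 \<partial>entry_space n)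
    \<le> est_const z * (1 / Im z + cmod s + 2 * (1 / Im z)\<^sup>2) / sqrt n"
proof -
  interpret O: prob_space "entry_space n" by (rule prob_space_entry_space)
  let ?m = "\<lambda>x. res_trace n z (sym_of n x)"
  define K where "K = 1 / Im z + cmod s + 2 * (1 / Im z)\<^sup>2"
  define e :: "nat \<Rightarrow> nat \<Rightarrow> real" where "e k = (\<lambda>l. if l = k then 1 else 0)" for k
  let ?q = "\<lambda>k x. res_quad n z (sym_of n x) (e k)"
  let ?Y = "\<lambda>x. cnj (?m x - s)"
  have e: "(\<Sum>i<n. (e k i)\<^sup>2) = 1" if "k < n" for k
    using res_vec_unit(3)[OF that] by (simp add: e_def)
  have mb: "cmod (?m x) \<le> 1 / Im z" for x by (rule res_trace_bound[OF sym_on_sym_of z])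
  have msb: "cmod (?m x - s) \<le> 1 / Im z + cmod s" for x
    using mb[of x] norm_triangle_ineq4[of "?m x" s] by linarith
  note L2 = L2_integrable[OF borel_measurable_diff[OF measurable_entry_space_res_trace borel_measurable_const] msb]
  have int: "integrable (entry_space n) (\<lambda>x. (1 + z * ?q k x + ?m x * ?q k x) * ?Y x)" if k: "k < n" for k
  proof (rule L2_integrable(1))
    show "(\<lambda>x. (1 + z * ?q k x + ?m x * ?q k x) * ?Y x) \<in> borel_measurable (entry_space n)"
      using measurable_entry_space_res_trace measurable_entry_space_res_quad by measurable
    have qb: "cmod (?q k x) \<le> 1 / Im z" for x
      by (rule res_quad_bound[OF sym_on_sym_of z e[OF k]])
    show "cmod ((1 + z * ?q k x + ?m x * ?q k x) * ?Y x)
        \<le> (1 + cmod z * (1 / Im z) + 1 / Im z * (1 / Im z)) * (1 / Im z + cmod s)" for x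
    proof -
      have "cmod (z * ?q k x) \<le> cmod z * (1 / Im z)"
        unfolding norm_mult by (intro mult_left_mono qb) simp
      moreover have "cmod (?m x * ?q k x) \<le> 1 / Im z * (1 / Im z)"
        unfolding norm_mult using z by (intro mult_mono qb mb) auto
      ultimately have "cmod (1 + z * ?q k x + ?m x * ?q k x)
          \<le> 1 + cmod z * (1 / Im z) + 1 / Im z * (1 / Im z)"
        by (intro norm_triangle_mono) auto
      then show ?thesis unfolding norm_mult[of "1 + _ + _"] complex_mod_cnj using z
        by (intro mult_mono msb) (auto intro!: add_nonneg_nonneg)
    qed
  qed
  \<comment> \<open>Averaging over the coordinate vectors replaces q_k by m in the linear factor:
    the trace equation is the mean of n instances of \<open>self_consistent\<close> with one common
    test function.\<close>
  have eq: "(1 + z * ?m x + ?m x * ?m x) * ?Y x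
      = (\<Sum>k<n. (1 + z * ?q k x + ?m x * ?q k x) * ?Y x) / of_nat n" for x
  proof -
    have "(\<Sum>k<n. ?q k x) = of_nat n * ?m x"
      using n by (simp add: e_def res_vec_unit(2) res_trace_def)
    then have "(\<Sum>k<n. 1 + z * ?q k x + ?m x * ?q k x) = of_nat n * (1 + z * ?m x + ?m x * ?m x)"
      by (simp add: sum.distrib algebra_simps flip: sum_distrib_left)
    then show ?thesis using n by (simp flip: sum_distrib_right)
  qed
  have "Im z * (\<integral>x. (cmod (?m x - s))\<^sup>2 \<partial>entry_space n) = (\<integral>x. Im z * (cmod (?m x - s))\<^sup>2 \<partial>entry_space n)"
    by simp
  also have "\<dots> \<le> (\<integral>x. Im ((1 + z * ?m x + ?m x * ?m x) * ?Y x) \<partial>entry_space n)"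
  proof (rule integral_mono)
    show "integrable (entry_space n) (\<lambda>x. Im z * (cmod (?m x - s))\<^sup>2)" using L2(2) by simp
    show "integrable (entry_space n) (\<lambda>x. Im ((1 + z * ?m x + ?m x * ?m x) * ?Y x))"
      unfolding eq using int by (intro integrable_Im integrable_divide_zero
        Bochner_Integration.integrable_sum) auto
    fix x
    have "1 + z * ?m x + ?m x * ?m x = (?m x + z + s) * (?m x - s)"
      using s(1) by (simp add: algebra_simps power2_eq_square)
    then have "(1 + z * ?m x + ?m x * ?m x) * ?Y x = (?m x + z + s) * of_real ((cmod (?m x - s))\<^sup>2)"
      by (simp only: mult.assoc complex_norm_square)
    moreover have "Im z \<le> Im (?m x + z + s)"
      using Im_res_trace_nonneg[OF sym_on_sym_of z, of n x] s(2) by simp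
    ultimately show "Im z * (cmod (?m x - s))\<^sup>2 \<le> Im ((1 + z * ?m x + ?m x * ?m x) * ?Y x)"
      by (simp add: mult_right_mono)
  qed
  also have "\<dots> = Im (\<integral>x. (1 + z * ?m x + ?m x * ?m x) * ?Y x \<partial>entry_space n)"
    unfolding eq using int by (intro integral_Im integrable_divide_zero
        Bochner_Integration.integrable_sum) auto
  also have "\<dots> \<le> cmod (\<integral>x. (1 + z * ?m x + ?m x * ?m x) * ?Y x \<partial>entry_space n)"
    by (rule order_trans[OF abs_ge_self abs_Im_le_cmod])
  also have "(\<integral>x. (1 + z * ?m x + ?m x * ?m x) * ?Y x \<partial>entry_space n)
      = (\<Sum>k<n. (\<integral>x. (1 + z * ?q k x + ?m x * ?q k x) * ?Y x \<partial>entry_space n)) / of_nat n"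
    unfolding eq using int by (simp add: Bochner_Integration.integral_sum)
  also have "cmod \<dots> \<le> (of_nat (card {..<n}) * (est_const z * K / sqrt n)) / n"
    unfolding norm_divide norm_of_nat
  proof (intro divide_right_mono sum_norm_bound)
    fix k assume "k \<in> {..<n}"
    then have k: "k < n" by simp
    show "cmod (\<integral>x. (1 + z * ?q k x + ?m x * ?q k x) * ?Y x \<partial>entry_space n) \<le> est_const z * K / sqrt n"
      unfolding K_def by (intro self_consistent z n e k admissible_trace)
  qed simp
  also have "\<dots> = est_const z * K / sqrt n" using n by simp
  finally show ?thesis by (simp add: K_def)
qed

text \<open>With m already close to s the equation is linear in q: 1 + z q + m q = (z + s) (q - s) -
  (s - m) q, and |z + s| >= Im z. The last term is split so that half of Im z times the error of q
  is absorbed on the left, while the rest is controlled by \<open>trace_L2\<close>. The constant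
  depends neither on n nor on v.\<close>

lemma quad_L2:
  assumes z: "Im z > 0" and s: "s\<^sup>2 + z * s + 1 = 0" "Im s > 0"
  shows "\<exists>C. \<forall>n v. n \<ge> 1 \<longrightarrow> (\<Sum>i<n. (v i)\<^sup>2) = 1 \<longrightarrow>
    (\<integral>x. (cmod (res_quad n z (sym_of n x) v - s))\<^sup>2 \<partial>entry_space n) \<le> C / sqrt n"
proof -
  define B where "B = 1 / Im z"
  define C1 where "C1 = est_const z * (B + cmod s + 2 * B\<^sup>2)"
  define C2 where "C2 = est_const z * (B + cmod s + 2 + 2 * B\<^sup>2)"
  have main: "(\<integral>x. (cmod (res_quad n z (sym_of n x) v - s))\<^sup>2 \<partial>entry_space n)
      \<le> 2 * B * (C2 + B\<^sup>2 * B * B / 2 * C1) / sqrt n"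
    if n: "n \<ge> 1" and v: "(\<Sum>i<n. (v i)\<^sup>2) = 1" for n :: nat and v
  proof -
    interpret O: prob_space "entry_space n" by (rule prob_space_entry_space)
    let ?m = "\<lambda>x. res_trace n z (sym_of n x)" and ?q = "\<lambda>x. res_quad n z (sym_of n x) v"
    let ?Y = "\<lambda>x. cnj (?q x - s)"
    define E where "E = (\<integral>x. (cmod (?q x - s))\<^sup>2 \<partial>entry_space n)"
    define M where "M = (\<integral>x. (cmod (?m x - s))\<^sup>2 \<partial>entry_space n)"
    have mb: "cmod (?m x) \<le> B" for x unfolding B_def by (rule res_trace_bound[OF sym_on_sym_of z])
    have qb: "cmod (?q x) \<le> B" for x unfolding B_def by (rule res_quad_bound[OF sym_on_sym_of z v])
    have msb: "cmod (?m x - s) \<le> B + cmod s" for x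
      using mb[of x] norm_triangle_ineq4[of "?m x" s] by linarith
    have qsb: "cmod (?q x - s) \<le> B + cmod s" for x
      using qb[of x] norm_triangle_ineq4[of "?q x" s] by linarith
    have B: "B > 0" "Im z * B = 1" using z by (auto simp: B_def)
    note Lm = L2_integrable[OF borel_measurable_diff[OF measurable_entry_space_res_trace borel_measurable_const] msb]
    note Lq = L2_integrable[OF borel_measurable_diff[OF measurable_entry_space_res_quad borel_measurable_const] qsb]
    have M: "Im z * M \<le> C1 / sqrt n"
      using trace_L2[OF z n s] by (simp add: M_def C1_def B_def)
    have i2: "integrable (entry_space n) (\<lambda>x. (s - ?m x) * ?q x * ?Y x)"
    proof (rule L2_integrable(1))
      show "(\<lambda>x. (s - ?m x) * ?q x * ?Y x) \<in> borel_measurable (entry_space n)"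
        using measurable_entry_space_res_trace measurable_entry_space_res_quad by measurable
      show "cmod ((s - ?m x) * ?q x * ?Y x) \<le> (B + cmod s) * B * (B + cmod s)" for x
        unfolding norm_mult complex_mod_cnj norm_minus_commute[of s] using qb msb qsb B(1)
        by (intro mult_mono) auto
    qed
    have eq: "(1 + z * ?q x + ?m x * ?q x) * ?Y x
        = (z + s) * of_real ((cmod (?q x - s))\<^sup>2) - (s - ?m x) * ?q x * ?Y x" for x
    proof -
      have "1 + z * ?q x + ?m x * ?q x = (z + s) * (?q x - s) - (s - ?m x) * ?q x"
        using s(1) by (simp add: algebra_simps power2_eq_square)
      then show ?thesis by (simp only: left_diff_distrib complex_norm_square mult.assoc)
    qed
    have i1: "integrable (entry_space n) (\<lambda>x. (z + s) * of_real ((cmod (?q x - s))\<^sup>2))"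
      using Lq(2) by (intro integrable_mult_right) (rule integrable_of_real)
    have "(\<integral>x. (1 + z * ?q x + ?m x * ?q x) * ?Y x \<partial>entry_space n)
        = (z + s) * of_real E - (\<integral>x. (s - ?m x) * ?q x * ?Y x \<partial>entry_space n)"
      unfolding eq E_def by (subst Bochner_Integration.integral_diff[OF i1 i2])
        (simp only: integral_mult_right_zero integral_complex_of_real)
    then have "(z + s) * of_real E = (\<integral>x. (1 + z * ?q x + ?m x * ?q x) * ?Y x \<partial>entry_space n)
        + (\<integral>x. (s - ?m x) * ?q x * ?Y x \<partial>entry_space n)" by simp
    then have a: "cmod (z + s) * E \<le> cmod (\<integral>x. (1 + z * ?q x + ?m x * ?q x) * ?Y x \<partial>entry_space n)
        + cmod (\<integral>x. (s - ?m x) * ?q x * ?Y x \<partial>entry_space n)"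
    proof -
      assume eq: "(z + s) * of_real E = (\<integral>x. (1 + z * ?q x + ?m x * ?q x) * ?Y x \<partial>entry_space n)
        + (\<integral>x. (s - ?m x) * ?q x * ?Y x \<partial>entry_space n)"
      have "cmod (z + s) * E \<le> cmod (z + s) * \<bar>E\<bar>" by (intro mult_left_mono) auto
      also have "\<dots> = cmod ((z + s) * of_real E)" by (simp only: norm_mult norm_of_real)
      finally show ?thesis unfolding eq by (rule order_trans[OF _ norm_triangle_ineq])
    qed
    have b: "cmod (\<integral>x. (1 + z * ?q x + ?m x * ?q x) * ?Y x \<partial>entry_space n) \<le> C2 / sqrt n"
      unfolding C2_def B_def by (intro self_consistent z n v admissible_quad)
    have c: "cmod (\<integral>x. (s - ?m x) * ?q x * ?Y x \<partial>entry_space n)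
        \<le> (\<integral>x. Im z / 2 * (cmod (?q x - s))\<^sup>2 + B\<^sup>2 * B / 2 * (cmod (?m x - s))\<^sup>2 \<partial>entry_space n)"
    proof (rule norm_integral_le[OF i2])
      show "integrable (entry_space n) (\<lambda>x. Im z / 2 * (cmod (?q x - s))\<^sup>2 + B\<^sup>2 * B / 2 * (cmod (?m x - s))\<^sup>2)"
        using Lq(2) Lm(2) by simp
      fix x
      have "cmod ((s - ?m x) * ?q x * ?Y x) \<le> cmod (?m x - s) * B * cmod (?q x - s)"
        unfolding norm_mult complex_mod_cnj norm_minus_commute[of s] using qb[of x] B(1)
        by (intro mult_mono) auto
      also have "\<dots> \<le> Im z / 2 * (cmod (?q x - s))\<^sup>2 + B\<^sup>2 * B / 2 * (cmod (?m x - s))\<^sup>2"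
      proof -
        \<comment> \<open>The weights leave Im z / 2 on the unknown error of q, at the price of (1 /
          Im z)^3 / 2 on that of m.\<close>
        have "a * B * b \<le> Im z / 2 * b\<^sup>2 + B\<^sup>2 * B / 2 * a\<^sup>2" for a b
        proof -
          have "2 * (B * B * a) * b \<le> (B * B * a)\<^sup>2 + b\<^sup>2" by (rule sum_squares_bound)
          then have "Im z * (2 * (B * B * a) * b) \<le> Im z * ((B * B * a)\<^sup>2 + b\<^sup>2)"
            using z by (intro mult_left_mono) auto
          moreover have "Im z * (2 * (B * B * a) * b) = 2 * (a * B * b)"
            using B(2) by (metis (no_types, opaque_lifting) mult.assoc mult.commute mult.right_neutral)
          moreover have "Im z * (B * B * a)\<^sup>2 = B\<^sup>2 * B * a\<^sup>2"
            using B(2) by (simp add: power2_eq_square mult_ac)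
          ultimately show ?thesis by (simp add: distrib_left)
        qed
        then show ?thesis .
      qed
      finally show "cmod ((s - ?m x) * ?q x * ?Y x)
          \<le> Im z / 2 * (cmod (?q x - s))\<^sup>2 + B\<^sup>2 * B / 2 * (cmod (?m x - s))\<^sup>2" .
    qed
    have d: "(\<integral>x. Im z / 2 * (cmod (?q x - s))\<^sup>2 + B\<^sup>2 * B / 2 * (cmod (?m x - s))\<^sup>2 \<partial>entry_space n)
        = Im z / 2 * E + B\<^sup>2 * B / 2 * M"
      unfolding E_def M_def using Lq(2) Lm(2) by simp
    have 1: "cmod (z + s) * E \<le> C2 / sqrt n + (Im z / 2 * E + B\<^sup>2 * B / 2 * M)"
      using order_trans[OF a add_mono[OF b c]] unfolding d .
    have "Im z \<le> cmod (z + s)" using s(2) abs_Im_le_cmod[of "z + s"] by simp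
    moreover have "E \<ge> 0" unfolding E_def by simp
    ultimately have le: "Im z * E \<le> C2 / sqrt n + (Im z / 2 * E + B\<^sup>2 * B / 2 * M)"
      using 1 mult_right_mono[of "Im z" "cmod (z + s)" E] by linarith
    have "y \<le> p + w" if "x \<le> p + (y + w)" "x = y + y" for x y p w :: real
      using that by simp
    from this[OF le] have "Im z / 2 * E \<le> C2 / sqrt n + B\<^sup>2 * B / 2 * M" by simp
    then have "2 * B * (Im z / 2 * E) \<le> 2 * B * (C2 / sqrt n + B\<^sup>2 * B / 2 * M)"
      using B(1) by (intro mult_left_mono) auto
    moreover have "2 * B * (Im z / 2 * E) = E" using B(2) by (simp add: mult_ac)
    moreover have "M \<le> B * (C1 / sqrt n)"
    proof -
      have "B * (Im z * M) \<le> B * (C1 / sqrt n)" using M B(1) by (intro mult_left_mono) auto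
      moreover have "B * (Im z * M) = (Im z * B) * M" by simp
      ultimately show ?thesis by (simp only: B(2) mult_1)
    qed
    then have "2 * B * (C2 / sqrt n + B\<^sup>2 * B / 2 * M)
        \<le> 2 * B * (C2 / sqrt n + B\<^sup>2 * B / 2 * (B * (C1 / sqrt n)))"
      using B(1) by (intro mult_left_mono add_left_mono) auto
    ultimately have "E \<le> 2 * B * (C2 / sqrt n + B\<^sup>2 * B / 2 * (B * (C1 / sqrt n)))" by linarith
    also have "\<dots> = 2 * B * (C2 + B\<^sup>2 * B * B / 2 * C1) / sqrt n"
      by (simp add: distrib_left add_divide_distrib mult_ac)
    finally show ?thesis unfolding E_def .
  qed
  then show ?thesis by blast
qed

end

section \<open>The Stieltjes transform of the limit law\<close>

text \<open>In the coordinate x = - 2 cos t both the density of the limit law and the Cauchy kernel at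
  z = - (s + 1 / s) are built from generating functions of sin ((k + 1) t), so orthogonality of the
  sines evaluates the Stieltjes transform.\<close>
definition arc :: "real measure" where
  "arc = restrict_space lborel {0..pi}"

lemma finite_measure_arc: "finite_measure arc"
  by (rule finite_measureI) (simp add: arc_def emeasure_restrict_space space_restrict_space)

lemma space_arc [simp]: "space arc = {0..pi}"
  by (simp add: arc_def space_restrict_space)

lemma measurable_arc [measurable (raw)]: "f \<in> borel_measurable borel \<Longrightarrow> f \<in> borel_measurable arc"
  unfolding arc_def by (intro measurable_restrict_space1) simp

section \<open>Orthogonality of the sines and their generating function\<close>

lemma integral_arc_FTC:
  fixes f F :: "real \<Rightarrow> real"
  assumes "\<And>t. (F has_real_derivative f t) (at t)" "continuous_on UNIV f"
  shows "(\<integral>t. f t \<partial>arc) = F pi - F 0"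
proof -
  have "(\<integral>t. indicator {0..pi} t *\<^sub>R f t \<partial>lborel) = F pi - F 0"
    using assms by (intro integral_FTC_Icc)
      (auto intro: has_field_derivative_at_within continuous_on_subset
        simp flip: has_real_derivative_iff_has_vector_derivative)
  then show ?thesis
    unfolding arc_def by (subst integral_restrict_space) auto
qed

lemma integral_arc_cos:
  "(\<integral>t. cos (real m * t) \<partial>arc) = (if m = 0 then pi else 0)"
proof (cases "m = 0")
  case True
  then show ?thesis
    using integral_arc_FTC[of "\<lambda>t. t" "\<lambda>_. 1"] by simp
next
  case False
  have "(\<integral>t. cos (real m * t) \<partial>arc) = sin (real m * pi) / m - sin (real m * 0) / m"
    using False by (intro integral_arc_FTC)
      (auto intro!: derivative_eq_intros continuous_intros)
  then show ?thesis using False by simp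
qed

lemma integrable_arc_bounded:
  fixes f :: "real \<Rightarrow> 'b :: {banach, second_countable_topology}"
  assumes "f \<in> borel_measurable borel" "\<And>t. norm (f t) \<le> K"
  shows "integrable arc f"
  using assms by (intro finite_measure.integrable_const_bound[OF finite_measure_arc, of f K])
    (auto intro: measurable_arc)

lemma integral_arc_sin_sin:
  "(\<integral>t. sin (real (Suc k) * t) * sin (real (Suc l) * t) \<partial>arc) = (if k = l then pi / 2 else 0)"
proof -
  \<comment> \<open>The absolute difference as a natural number; it is 0 exactly for k = l, whereas
    k + l + 2 never is.\<close>
  define d where "d = (if k \<le> l then l - k else k - l)"
  have eq: "sin (real (Suc k) * t) * sin (real (Suc l) * t)
      = (cos (real d * t) - cos (real (k + l + 2) * t)) / 2" for t
  proof -
    have "cos (real d * t) = cos (real (Suc k) * t - real (Suc l) * t)"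
    proof (cases "k \<le> l")
      case True
      then have "real d * t = - (real (Suc k) * t - real (Suc l) * t)"
        by (simp add: d_def of_nat_diff algebra_simps)
      then show ?thesis by (metis cos_minus)
    next
      case False
      then have "real d * t = real (Suc k) * t - real (Suc l) * t"
        by (simp add: d_def of_nat_diff algebra_simps)
      then show ?thesis by simp
    qed
    moreover have "real (k + l + 2) * t = real (Suc k) * t + real (Suc l) * t"
      by (simp add: algebra_simps)
    ultimately show ?thesis by (simp only: sin_times_sin)
  qed
  have int: "integrable arc (\<lambda>t. cos (real m * t))" for m
    by (rule integrable_arc_bounded[of _ 1]) auto
  define e where "e = k + l + 2"
  have "(\<integral>t. (cos (real d * t) - cos (real e * t)) / 2 \<partial>arc)
      = ((\<integral>t. cos (real d * t) \<partial>arc) - (\<integral>t. cos (real e * t) \<partial>arc)) / 2"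
    using int[of d] int[of e] by simp
  then show ?thesis
    unfolding eq e_def[symmetric] integral_arc_cos by (simp add: d_def e_def)
qed

text \<open>Closed form of the sum of a^k sin ((k + 1) t): \<open>sin t\<close> times the generating
  function of the Chebyshev polynomials of the second kind at \<open>cos t\<close>.\<close>

definition sine_series :: "complex \<Rightarrow> real \<Rightarrow> complex" where
  "sine_series a t = of_real (sin t) / (1 + a\<^sup>2 - 2 * a * of_real (cos t))"

lemma poisson_factor:
  "1 + a\<^sup>2 - 2 * a * of_real (cos t) = (1 - a * cis t) * (1 - a * cis (- t))"
proof -
  have "cis t * cis (-t) = 1" by (simp add: cis_mult)
  moreover have "cis t + cis (-t) = 2 * of_real (cos t)" by (simp add: complex_eq_iff)
  ultimately show ?thesis
    by (simp add: algebra_simps power2_eq_square) (metis distrib_left mult.assoc mult.commute)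
qed

lemma poisson_factor_nonzero:
  assumes "cmod a < 1"
  shows "1 + a\<^sup>2 - 2 * a * of_real (cos t) \<noteq> 0"
    and "cmod (1 + a\<^sup>2 - 2 * a * of_real (cos t)) \<ge> (1 - cmod a)\<^sup>2"
proof -
  have *: "cmod (1 - a * cis s) \<ge> 1 - cmod a" for s
    using norm_triangle_ineq2[of 1 "a * cis s"] by (simp add: norm_mult)
  have "(1 - cmod a) * (1 - cmod a) \<le> cmod (1 - a * cis t) * cmod (1 - a * cis (-t))"
    using assms by (intro mult_mono *) auto
  then show le: "cmod (1 + a\<^sup>2 - 2 * a * of_real (cos t)) \<ge> (1 - cmod a)\<^sup>2"
    unfolding poisson_factor by (simp add: norm_mult power2_eq_square)
  have "(1 - cmod a)\<^sup>2 > 0" using assms by simp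
  then show "1 + a\<^sup>2 - 2 * a * of_real (cos t) \<noteq> 0"
    using le by (smt (verit) norm_zero)
qed

text \<open>Difference of two geometric series with ratios \<open>a * cis t\<close> and
  \<open>a * cis (- t)\<close>, divided by 2 i; \<open>poisson_factor\<close> supplies the common
  denominator.\<close>

lemma sine_series_sums:
  assumes "cmod a < 1"
  shows "(\<lambda>k. a ^ k * of_real (sin (real (Suc k) * t))) sums sine_series a t"
proof -
  have g: "(\<lambda>k. cis s * (a * cis s) ^ k) sums (cis s * (1 / (1 - a * cis s)))" for s
    using assms by (intro sums_mult geometric_sums) (simp add: norm_mult)
  have nz: "1 - a * cis s \<noteq> 0" for s
    using assms by (metis cmod_power2 eq_iff_diff_eq_0 less_irrefl mult.right_neutral norm_cis norm_mult norm_one)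
  have "(\<lambda>k. (cis t * (a * cis t) ^ k - cis (-t) * (a * cis (-t)) ^ k) / (2 * \<i>))
      sums ((cis t * (1 / (1 - a * cis t)) - cis (-t) * (1 / (1 - a * cis (-t)))) / (2 * \<i>))"
    by (intro sums_divide sums_diff g)
  also have "(\<lambda>k. (cis t * (a * cis t) ^ k - cis (-t) * (a * cis (-t)) ^ k) / (2 * \<i>))
      = (\<lambda>k. a ^ k * of_real (sin (real (Suc k) * t)))"
  proof
    fix k
    have c: "cis s * (a * cis s) ^ k = a ^ k * cis (real (Suc k) * s)" for s
    proof -
      have "cis s * (a * cis s) ^ k = a ^ k * cis s ^ Suc k" by (simp add: power_mult_distrib)
      then show ?thesis using Complex.DeMoivre[of s "Suc k"] by simp
    qed
    have "cis x - cis (- x) = 2 * \<i> * of_real (sin x)" for x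
      by (simp add: complex_eq_iff)
    from this[of "real (Suc k) * t"]
    have e: "a ^ k * cis (real (Suc k) * t) - a ^ k * cis (real (Suc k) * (-t))
        = a ^ k * (2 * \<i> * of_real (sin (real (Suc k) * t)))"
      by (simp only: right_diff_distrib[symmetric] mult_minus_right)
    show "(cis t * (a * cis t) ^ k - cis (-t) * (a * cis (-t)) ^ k) / (2 * \<i>)
        = a ^ k * of_real (sin (real (Suc k) * t))"
      unfolding c e by (subst mult.left_commute, rule nonzero_mult_div_cancel_left) simp
  qed
  also have "(cis t * (1 / (1 - a * cis t)) - cis (-t) * (1 / (1 - a * cis (-t)))) / (2 * \<i>)
      = sine_series a t"
  proof -
    have 1: "cis t * (1 / (1 - a * cis t)) - cis (-t) * (1 / (1 - a * cis (-t)))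
        = (cis t * (1 - a * cis (-t)) - cis (-t) * (1 - a * cis t)) / ((1 - a * cis t) * (1 - a * cis (-t)))"
      using nz[of t] nz[of "-t"] by (simp add: diff_frac_eq)
    have "cis t * (1 - a * cis (-t)) - cis (-t) * (1 - a * cis t) = 2 * \<i> * of_real (sin t)"
      by (simp add: complex_eq_iff algebra_simps)
    then show ?thesis unfolding 1 sine_series_def poisson_factor by simp
  qed
  finally show ?thesis .
qed

lemma measurable_sine_series [measurable]: "sine_series a \<in> borel_measurable borel"
  unfolding sine_series_def[abs_def] by measurable

lemma sine_series_bound:
  assumes "cmod a < 1"
  shows "cmod (sine_series a t) \<le> 1 / (1 - cmod a)\<^sup>2"
  unfolding sine_series_def norm_divide
  using poisson_factor_nonzero[OF assms, of t] assms
  by (intro frac_le) auto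

text \<open>A geometric majorant permits termwise integration. The second factor is general because
  the lemma is applied twice: to a single sine and then to another
  \<open>sine_series\<close>.\<close>

lemma integral_sine_series:
  fixes f :: "real \<Rightarrow> complex"
  assumes a: "cmod a < 1" and f: "f \<in> borel_measurable borel" "\<And>t. cmod (f t) \<le> K"
  shows "(\<lambda>k. a ^ k * (\<integral>t. of_real (sin (real (Suc k) * t)) * f t \<partial>arc))
    sums (\<integral>t. sine_series a t * f t \<partial>arc)"
proof -
  let ?g = "\<lambda>k t. a ^ k * of_real (sin (real (Suc k) * t)) * f t"
  have K: "K \<ge> 0" using f(2) norm_ge_zero order_trans by blast
  have b: "cmod (?g k t) \<le> cmod a ^ k * K" for k t
  proof -
    have "cmod (?g k t) = cmod a ^ k * \<bar>sin (real (Suc k) * t)\<bar> * cmod (f t)"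
      by (simp add: norm_mult norm_power)
    also have "\<dots> \<le> cmod a ^ k * 1 * K"
      using f(2) abs_sin_le_one by (intro mult_mono) auto
    finally show ?thesis by simp
  qed
  have m: "?g k \<in> borel_measurable borel" for k using f(1) by measurable
  have int: "integrable arc (?g k)" for k
    by (rule integrable_arc_bounded[OF m b])
  have geo: "summable (\<lambda>k. cmod a ^ k * K)" using a by (intro summable_mult2 summable_geometric) simp
  have "(\<lambda>k. \<integral>t. ?g k t \<partial>arc) sums (\<integral>t. (\<Sum>k. ?g k t) \<partial>arc)"
  proof (rule sums_integral)
    show "integrable arc (?g k)" for k by (rule int)
    show "AE t in arc. summable (\<lambda>k. cmod (?g k t))"
      using b by (intro AE_I2 summable_comparison_test'[OF geo, of 0]) auto
    show "summable (\<lambda>k. \<integral>t. cmod (?g k t) \<partial>arc)"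
    proof (rule summable_comparison_test'[of "\<lambda>k. (cmod a ^ k * K) * pi" 0])
      show "summable (\<lambda>k. (cmod a ^ k * K) * pi)" by (rule summable_mult2[OF geo])
      fix k
      have "(\<integral>t. cmod (?g k t) \<partial>arc) \<le> (\<integral>t. cmod a ^ k * K \<partial>arc)"
        using b by (intro integral_mono integrable_norm int
          finite_measure.integrable_const[OF finite_measure_arc])
      also have "\<dots> = (cmod a ^ k * K) * pi"
        using integral_arc_cos[of 0] by simp
      finally show "norm (\<integral>t. cmod (?g k t) \<partial>arc) \<le> (cmod a ^ k * K) * pi"
        by simp
    qed
  qed
  moreover have "(\<Sum>k. ?g k t) = sine_series a t * f t" for t
    using sums_mult2[OF sine_series_sums[OF a, of t], of "f t"] by (rule sums_unique[symmetric])
  ultimately show ?thesis by (simp add: mult.assoc)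
qed

text \<open>Orthogonality leaves only the diagonal terms, pi / 2 times the geometric series in a
  b.\<close>

lemma integral_sine_sine:
  assumes a: "cmod a < 1" and b: "cmod b < 1"
  shows "(\<integral>t. sine_series a t * sine_series b t \<partial>arc) = of_real (pi / 2) / (1 - a * b)"
proof -
  have inner: "(\<integral>t. of_real (sin (real (Suc k) * t)) * sine_series b t \<partial>arc) = of_real (pi / 2) * b ^ k" for k
  proof -
    let ?s = "\<lambda>t. complex_of_real (sin (real (Suc k) * t))"
    have m: "?s \<in> borel_measurable borel" by measurable
    have bd: "cmod (?s t) \<le> 1" for t using abs_sin_le_one by simp
    have v: "(\<integral>t. of_real (sin (real (Suc l) * t)) * ?s t \<partial>arc) = of_real (if l = k then pi / 2 else 0)" for l
      unfolding of_real_mult[symmetric] integral_complex_of_real integral_arc_sin_sin ..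
    have "(\<lambda>l. b ^ l * of_real (if l = k then pi / 2 else 0)) sums (\<integral>t. sine_series b t * ?s t \<partial>arc)"
      using integral_sine_series[OF b m bd] unfolding v .
    moreover have "(\<lambda>l. b ^ l * of_real (if l = k then pi / 2 else 0)) sums (b ^ k * of_real (pi / 2))"
      using sums_single[of k "\<lambda>l. b ^ l * of_real (pi / 2)"]
      by (simp add: if_distrib[of "\<lambda>x. _ * of_real x"] cong: if_cong)
    ultimately show ?thesis
      using sums_unique2 by (fastforce simp: mult.commute)
  qed
  have "(\<lambda>k. a ^ k * (of_real (pi / 2) * b ^ k)) sums (\<integral>t. sine_series a t * sine_series b t \<partial>arc)"
    using integral_sine_series[OF a measurable_sine_series sine_series_bound[OF b]] unfolding inner .
  moreover have "(\<lambda>k. of_real (pi / 2) * (a * b) ^ k) sums (of_real (pi / 2) * (1 / (1 - a * b)))"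
    using a b mult_strict_mono[of "cmod a" 1 "cmod b" 1]
    by (intro sums_mult geometric_sums) (simp add: norm_mult)
  moreover have "(\<lambda>k. of_real (pi / 2) * (a * b) ^ k) = (\<lambda>k. a ^ k * (of_real (pi / 2) * b ^ k))"
    by (simp add: power_mult_distrib mult_ac)
  ultimately show ?thesis
    using sums_unique2 by fastforce
qed

text \<open>The right-hand side is (a - cos t)^2 + (sin t)^2. As the bound is uniform in a, the
  passage to |a| = 1 becomes a dominated limit.\<close>

lemma sin_sq_le: "(sin t)\<^sup>2 \<le> 1 + a\<^sup>2 - 2 * a * cos t" for a t :: real
proof -
  have "1 + a\<^sup>2 - 2 * a * cos t = (a - cos t)\<^sup>2 + (sin t)\<^sup>2"
    by (simp add: power2_diff sin_squared_eq)
  then show ?thesis by simp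
qed

text \<open>At x = - 2 cos t and a = - theta this is, up to the factor 2 / pi, the bulk density
  times dx / dt. Where the denominator vanishes the numerator does too, and the value is 0.\<close>

definition sc_kernel :: "real \<Rightarrow> real \<Rightarrow> real" where
  "sc_kernel a t = (sin t)\<^sup>2 / (1 + a\<^sup>2 - 2 * a * cos t)"

lemma measurable_sc_kernel [measurable]: "sc_kernel a \<in> borel_measurable borel"
  unfolding sc_kernel_def[abs_def] by measurable

lemma sc_kernel_bounds: "0 \<le> sc_kernel a t" "sc_kernel a t \<le> 1"
proof -
  have "0 \<le> 1 + a\<^sup>2 - 2 * a * cos t"
    by (rule order_trans[OF zero_le_power2 sin_sq_le])
  then show "0 \<le> sc_kernel a t" "sc_kernel a t \<le> 1"
    using sin_sq_le[of t a] by (auto simp: sc_kernel_def divide_le_eq_1)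
qed

definition poisson_like :: "complex \<Rightarrow> real \<Rightarrow> complex" where
  "poisson_like b t = 1 / (1 + b\<^sup>2 - 2 * b * of_real (cos t))"

text \<open>The squared sine is shared out: each of \<open>sc_kernel\<close> and
  \<open>poisson_like\<close> receives one factor and becomes a \<open>sine_series\<close>.\<close>

lemma integral_sc_kernel_inner:
  assumes a: "\<bar>a\<bar> < 1" and b: "cmod b < 1"
  shows "(\<integral>t. of_real (sc_kernel a t) * poisson_like b t \<partial>arc) = of_real (pi / 2) / (1 - of_real a * b)"
proof -
  have "of_real (sc_kernel a t) * poisson_like b t = sine_series (of_real a) t * sine_series b t" for t
    by (simp add: sc_kernel_def poisson_like_def sine_series_def power2_eq_square)
  then show ?thesis using integral_sine_sine[of "of_real a" b] a b by simp
qed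

lemma measurable_poisson_like [measurable]: "poisson_like b \<in> borel_measurable borel"
  unfolding poisson_like_def[abs_def] by measurable

lemma poisson_like_bound: "cmod b < 1 \<Longrightarrow> cmod (poisson_like b t) \<le> 1 / (1 - cmod b)\<^sup>2"
  unfolding poisson_like_def norm_divide
  using poisson_factor_nonzero[of b t] by (intro frac_le) auto

lemma kernel_poisson_bound:
  "cmod b < 1 \<Longrightarrow> cmod (of_real (sc_kernel a t) * poisson_like b t) \<le> 1 / (1 - cmod b)\<^sup>2"
  using mult_mono[OF sc_kernel_bounds(2)[of a t] poisson_like_bound[of b t]] sc_kernel_bounds[of a t]
  by (simp add: norm_mult)

text \<open>|a| < 1 is \<open>integral_sc_kernel_inner\<close>, |a| = 1 a limit from inside, and |a|
  > 1 reduces to 1 / a, since the quadratic in the denominator is a^2 times the one for 1 / a. The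
  formula changes at |a| = 1; in the limit law the atom makes up the difference.\<close>

lemma integral_sc_kernel:
  assumes b: "cmod b < 1"
  shows "(\<integral>t. of_real (sc_kernel a t) * poisson_like b t \<partial>arc)
    = (if \<bar>a\<bar> \<le> 1 then of_real (pi / 2) / (1 - of_real a * b)
       else of_real (pi / 2) / (of_real a * (of_real a - b)))"
proof -
  consider "\<bar>a\<bar> < 1" | "\<bar>a\<bar> = 1" | "\<bar>a\<bar> > 1" by linarith
  then show ?thesis
  proof cases
    case 1 then show ?thesis using integral_sc_kernel_inner[OF 1 b] by simp
  next
    case 2
    \<comment> \<open>Tends to 1 strictly from below, so that |r k a| < 1 for every k.\<close>
    define r where "r k = 1 - 1 / real (k + 2)" for k
    have r: "r \<longlonglongrightarrow> 1"
    proof -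
      have "(\<lambda>k. 1 - 1 / real (k + 2)) \<longlonglongrightarrow> 1 - 0"
        by (intro tendsto_diff tendsto_const LIMSEQ_ignore_initial_segment[OF lim_1_over_n])
      then show ?thesis by (simp add: r_def[abs_def])
    qed
    have r1: "\<bar>r k * a\<bar> < 1" for k using 2 by (simp add: r_def abs_mult)
    have "(\<lambda>k. \<integral>t. of_real (sc_kernel (r k * a) t) * poisson_like b t \<partial>arc)
        \<longlonglongrightarrow> (\<integral>t. of_real (sc_kernel a t) * poisson_like b t \<partial>arc)"
    proof (rule integral_dominated_convergence[where w = "\<lambda>_. 1 / (1 - cmod b)\<^sup>2"])
      show "integrable arc (\<lambda>_. 1 / (1 - cmod b)\<^sup>2)"
        by (rule finite_measure.integrable_const[OF finite_measure_arc])
      show "AE t in arc. cmod (of_real (sc_kernel (r k * a) t) * poisson_like b t) \<le> 1 / (1 - cmod b)\<^sup>2" for k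
        using kernel_poisson_bound[OF b] by simp
      have "(\<lambda>k. sc_kernel (r k * a) t) \<longlonglongrightarrow> sc_kernel a t" for t
      \<comment> \<open>At a zero of the sine the limiting denominator may vanish, but there the
        kernel is 0 for every parameter.\<close>
      proof (cases "sin t = 0")
        case True then show ?thesis by (simp add: sc_kernel_def)
      next
        case False
        then have "0 < (sin t)\<^sup>2" by simp
        then have "0 < 1 + (1 * a)\<^sup>2 - 2 * (1 * a) * cos t"
          using sin_sq_le[of t a] by (simp only: mult_1)
        then have "1 + (1 * a)\<^sup>2 - 2 * (1 * a) * cos t \<noteq> 0" by simp
        then have "(\<lambda>k. sc_kernel (r k * a) t) \<longlonglongrightarrow> (sin t)\<^sup>2 / (1 + (1 * a)\<^sup>2 - 2 * (1 * a) * cos t)"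
          unfolding sc_kernel_def by (intro tendsto_intros r)
        then show ?thesis by (simp add: sc_kernel_def)
      qed
      then show "AE t in arc. (\<lambda>k. of_real (sc_kernel (r k * a) t) * poisson_like b t)
          \<longlonglongrightarrow> of_real (sc_kernel a t) * poisson_like b t"
        by (intro AE_I2 tendsto_intros)
    qed (auto intro!: measurable_arc)
    moreover have "(\<lambda>k. \<integral>t. of_real (sc_kernel (r k * a) t) * poisson_like b t \<partial>arc)
        \<longlonglongrightarrow> of_real (pi / 2) / (1 - of_real (1 * a) * b)"
      unfolding integral_sc_kernel_inner[OF r1 b]
    proof (intro tendsto_intros r)
      have "cmod (of_real a * b) < 1" using 2 b by (simp add: norm_mult)
      then show "1 - of_real (1 * a) * b \<noteq> 0" by auto
    qed
    ultimately show ?thesis using 2 LIMSEQ_unique by fastforce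
  next
    case 3
    define c where "c = 1 / a"
    have a0: "a \<noteq> 0" using 3 by auto
    have c: "\<bar>c\<bar> < 1" using 3 by (simp add: c_def)
    have "sc_kernel a t = sc_kernel c t / a\<^sup>2" for t
    proof -
      have "1 + a\<^sup>2 - 2 * a * cos t = a\<^sup>2 * (1 + c\<^sup>2 - 2 * c * cos t)"
        using a0 by (simp add: c_def field_simps power2_eq_square)
      then show ?thesis by (simp add: sc_kernel_def)
    qed
    then have "(\<integral>t. of_real (sc_kernel a t) * poisson_like b t \<partial>arc)
        = (\<integral>t. (of_real (sc_kernel c t) * poisson_like b t) / of_real (a\<^sup>2) \<partial>arc)"
      by simp
    also have "\<dots> = (of_real (pi / 2) / (1 - of_real c * b)) / of_real (a\<^sup>2)"
      unfolding integral_sc_kernel_inner[OF c b, symmetric] by simp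
    also have "\<dots> = of_real (pi / 2) / (of_real a * (of_real a - b))"
    proof -
      have "of_real (a\<^sup>2) * (1 - of_real c * b) = of_real a * (of_real a - b)"
        using a0 by (simp add: c_def field_simps power2_eq_square)
      then show ?thesis
        by (simp only: divide_divide_eq_left mult.commute[of "1 - of_real c * b"])
    qed
    finally show ?thesis using 3 by simp
  qed
qed

text \<open>The two roots have product 1 and sum - z. Inversion reverses the sign of the imaginary
  part, so neither root is real and one lies in the upper half-plane. Were its modulus at least 1,
  the sum would have nonnegative imaginary part, against Im (- z) < 0.\<close>

lemma self_energy_root:
  assumes "Im z > 0"
  obtains s where "s\<^sup>2 + z * s + 1 = 0" "Im s > 0" "cmod s < 1"
proof -
  define d where "d = csqrt (z\<^sup>2 - 4)"
  have d: "d\<^sup>2 = z\<^sup>2 - 4" by (simp add: d_def)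
  define s1 where "s1 = (- z + d) / 2"
  define s2 where "s2 = (- z - d) / 2"
  have p: "s1 * s2 = 1" and q: "s1 + s2 = - z"
    using d by (simp_all add: s1_def s2_def field_simps power2_eq_square)
  have root: "s\<^sup>2 + z * s + 1 = 0" if "s = s1 \<or> s = s2" for s
  proof -
    have "(s - s1) * (s - s2) = s\<^sup>2 - (s1 + s2) * s + s1 * s2"
      by (simp add: algebra_simps power2_eq_square)
    then have "s\<^sup>2 + z * s + 1 = (s - s1) * (s - s2)" by (simp add: p q)
    then show ?thesis using that by auto
  qed
  have Im2: "Im y = - Im x / (cmod x)\<^sup>2" if "x * y = 1" for x y :: complex
  proof -
    have "y = inverse x" using that by (rule inverse_unique[symmetric])
    then show ?thesis by (simp add: cmod_power2)
  qed
  have sum: "Im s1 + Im s2 = - Im z" using arg_cong[OF q, of Im] by simp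
  have good: "Im x > 0 \<Longrightarrow> cmod x < 1" if "x * y = 1" "Im x + Im y = - Im z" for x y :: complex
  proof (rule ccontr)
    assume x: "Im x > 0" and "\<not> cmod x < 1"
    then have "(cmod x)\<^sup>2 \<ge> 1" by (simp add: one_le_power)
    then have "Im x / (cmod x)\<^sup>2 \<le> Im x" using x by (simp add: divide_le_eq mult_le_cancel_left1)
    then show False using Im2[OF that(1)] that(2) assms by simp
  qed
  have "Im s1 \<noteq> 0"
    using Im2[OF p] sum assms by auto
  then consider "Im s1 > 0" | "Im s1 < 0" by linarith
  then show ?thesis
  proof cases
    case 1 then show ?thesis using that[of s1] root good[OF p sum] by auto
  next
    case 2
    have "s1 \<noteq> 0" using 2 by auto
    then have "Im s2 > 0" using 2 Im2[OF p] by (simp add: divide_neg_pos)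
    then show ?thesis using that[of s2] root good[of s2 s1] p sum by (auto simp: mult.commute add.commute)
  qed
qed

text \<open>The limit law is a push-forward: the interval from 0 to pi carries the bulk, and the interval
  from 4 to 5, which is disjoint from it, is collapsed to the atom.\<close>
definition sc_density :: "real \<Rightarrow> real \<Rightarrow> real" where
  "sc_density \<theta> t = 2 / pi * sc_kernel (- \<theta>) t * indicator {0..pi} t
     + (if \<bar>\<theta>\<bar> > 1 then 1 - 1 / \<theta>\<^sup>2 else 0) * indicator {4..5} t"

definition sc_map :: "real \<Rightarrow> real \<Rightarrow> real" where
  "sc_map \<theta> t = (if t \<le> pi then - 2 * cos t else \<theta> + 1 / \<theta>)"

section \<open>The limit law as a push-forward, its mass and its Stieltjes transform\<close>

lemma measurable_sc_density [measurable]: "sc_density \<theta> \<in> borel_measurable borel"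
  unfolding sc_density_def[abs_def] by measurable

lemma measurable_sc_map [measurable]: "sc_map \<theta> \<in> borel_measurable borel"
  unfolding sc_map_def[abs_def] by measurable

lemma atom_weight_nonneg: "(if \<bar>\<theta>\<bar> > 1 then 1 - 1 / \<theta>\<^sup>2 else 0) \<ge> (0::real)"
proof (cases "\<bar>\<theta>\<bar> > 1")
  case True
  then have "\<theta>\<^sup>2 > 1" by (metis power2_abs power2_eq_square less_1_mult)
  then show ?thesis by (simp add: divide_le_eq_1)
qed auto

lemma sc_density_nonneg: "sc_density \<theta> t \<ge> 0"
  unfolding sc_density_def using sc_kernel_bounds(1) atom_weight_nonneg
  by (intro add_nonneg_nonneg mult_nonneg_nonneg) auto

text \<open>Substitution x = - 2 cos t, with the sign that makes it increasing from 0 to pi; sqrt (4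
  - x^2) and dx / dt both equal 2 sin t.\<close>

lemma nn_integral_sc_bulk:
  assumes "B \<in> sets borel"
  shows "(\<integral>\<^sup>+x. ennreal (sqrt (4 - x\<^sup>2) / (2 * pi * (\<theta>\<^sup>2 + 1 - \<theta> * x)) * indicator {x. \<bar>x\<bar> \<le> 2} x)
        * indicator B x \<partial>lborel)
    = (\<integral>\<^sup>+t. ennreal (2 / pi * sc_kernel (- \<theta>) t * indicator {0..pi} t) * indicator B (- 2 * cos t) \<partial>lborel)"
proof -
  \<comment> \<open>The indicator of |x| <= 2 is left out because the substitution restricts to that
    interval anyway.\<close>
  define f where "f x = ennreal (sqrt (4 - x\<^sup>2) / (2 * pi * (\<theta>\<^sup>2 + 1 - \<theta> * x))) * indicator B x" for x
  have fm: "f \<in> borel_measurable borel" unfolding f_def using assms by measurable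
  have "(\<integral>\<^sup>+x. ennreal (sqrt (4 - x\<^sup>2) / (2 * pi * (\<theta>\<^sup>2 + 1 - \<theta> * x)) * indicator {x. \<bar>x\<bar> \<le> 2} x)
        * indicator B x \<partial>lborel) = (\<integral>\<^sup>+x. f x * indicator {- 2 * cos 0 .. - 2 * cos pi} x \<partial>lborel)"
    by (intro nn_integral_cong) (auto simp: f_def indicator_def)
  also have "\<dots> = (\<integral>\<^sup>+t. f (- 2 * cos t) * ennreal (2 * sin t) * indicator {0..pi} t \<partial>lborel)"
    by (rule nn_integral_substitution_aux[OF fm])
      (auto intro!: derivative_eq_intros continuous_intros sin_ge_zero)
  also have "\<dots> = (\<integral>\<^sup>+t. ennreal (2 / pi * sc_kernel (- \<theta>) t * indicator {0..pi} t) * indicator B (- 2 * cos t) \<partial>lborel)"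
  proof (intro nn_integral_cong)
    fix t :: real
    show "f (- 2 * cos t) * ennreal (2 * sin t) * indicator {0..pi} t
        = ennreal (2 / pi * sc_kernel (- \<theta>) t * indicator {0..pi} t) * indicator B (- 2 * cos t)"
    proof (cases "t \<in> {0..pi} \<and> - 2 * cos t \<in> B")
      case True
      then have s: "sin t \<ge> 0" by (auto intro: sin_ge_zero)
      have "4 - (- 2 * cos t)\<^sup>2 = (2 * sin t)\<^sup>2"
        by (simp add: power_mult_distrib sin_squared_eq)
      then have sq: "sqrt (4 - (- 2 * cos t)\<^sup>2) = 2 * sin t"
        using s by (simp only: real_sqrt_abs)
      have "sqrt (4 - (- 2 * cos t)\<^sup>2) / (2 * pi * (\<theta>\<^sup>2 + 1 - \<theta> * (- 2 * cos t))) * (2 * sin t)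
          = 2 / pi * sc_kernel (- \<theta>) t"
      proof -
        have "2 * a / (2 * p * P) * (2 * a) = 2 / p * (a\<^sup>2 / P)" for a p P :: real
          by (simp add: power2_eq_square)
        moreover have "\<theta>\<^sup>2 + 1 - \<theta> * (- 2 * cos t) = 1 + (- \<theta>)\<^sup>2 - 2 * (- \<theta>) * cos t" by simp
        ultimately show ?thesis unfolding sq sc_kernel_def by metis
      qed
      then show ?thesis using True s by (simp add: f_def flip: ennreal_mult'')
    next
      case False then show ?thesis by (auto simp: f_def)
    qed
  qed
  finally show ?thesis .
qed

text \<open>The definition of the limit law yields measures of sets only; in this form its integrals
  follow from \<open>integral_distr\<close> and \<open>integral_density\<close>. The interval from 4
  to 5 has length 1, so its density is the weight of the atom.\<close>

lemma mu_sc_eq_distr: "mu_sc \<theta> = distr (density lborel (sc_density \<theta>)) borel (sc_map \<theta>)"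
proof (rule measure_eqI)
  show "sets (mu_sc \<theta>) = sets (distr (density lborel (sc_density \<theta>)) borel (sc_map \<theta>))"
    by (simp add: mu_sc_def sets.sigma_sets_eq[of borel, simplified])
  fix B assume "B \<in> sets (mu_sc \<theta>)"
  then have B: "B \<in> sets borel" by (simp add: mu_sc_def sets.sigma_sets_eq[of borel, simplified])
  define w where "w = (if \<bar>\<theta>\<bar> > 1 then 1 - 1 / \<theta>\<^sup>2 else 0)"
  have w: "w \<ge> 0" unfolding w_def by (rule atom_weight_nonneg)
  have pre: "sc_map \<theta> -` B \<in> sets borel"
    using measurable_sets[OF measurable_sc_map B] by simp
  have "emeasure (distr (density lborel (sc_density \<theta>)) borel (sc_map \<theta>)) B
      = (\<integral>\<^sup>+t. ennreal (sc_density \<theta> t) * indicator (sc_map \<theta> -` B) t \<partial>lborel)"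
    using B pre by (simp add: emeasure_distr emeasure_density)
  also have "\<dots> = (\<integral>\<^sup>+t. ennreal (2 / pi * sc_kernel (- \<theta>) t * indicator {0..pi} t) * indicator B (- 2 * cos t)
      + ennreal w * indicator B (\<theta> + 1 / \<theta>) * indicator {4..5::real} t \<partial>lborel)"
  proof (intro nn_integral_cong)
    fix t :: real
    consider "t \<le> pi" | "t > pi" by linarith
    then show "ennreal (sc_density \<theta> t) * indicator (sc_map \<theta> -` B) t
      = ennreal (2 / pi * sc_kernel (- \<theta>) t * indicator {0..pi} t) * indicator B (- 2 * cos t)
      + ennreal w * indicator B (\<theta> + 1 / \<theta>) * indicator {4..5} t"
      using pi_less_4 by cases (auto simp: sc_density_def sc_map_def w_def[symmetric] indicator_def)
  qed
  also have "\<dots> = (\<integral>\<^sup>+t. ennreal (2 / pi * sc_kernel (- \<theta>) t * indicator {0..pi} t) * indicator B (- 2 * cos t) \<partial>lborel)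
      + (\<integral>\<^sup>+t. ennreal w * indicator B (\<theta> + 1 / \<theta>) * indicator {4..5::real} t \<partial>lborel)"
    using B by (intro nn_integral_add) auto
  also have "(\<integral>\<^sup>+t. ennreal w * indicator B (\<theta> + 1 / \<theta>) * indicator {4..5::real} t \<partial>lborel)
      = ennreal w * indicator B (\<theta> + 1 / \<theta>)"
    by (simp add: nn_integral_cmult_indicator)
  also have "\<dots> = (if \<bar>\<theta>\<bar> > 1 then ennreal (1 - 1 / \<theta>\<^sup>2) * emeasure (return borel (\<theta> + 1 / \<theta>)) B else 0)"
    using B by (simp add: w_def)
  finally show "emeasure (mu_sc \<theta>) B = emeasure (distr (density lborel (sc_density \<theta>)) borel (sc_map \<theta>)) B"
    unfolding emeasure_mu_sc[OF B] nn_integral_sc_bulk[OF B] by simp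
qed

lemma integral_mu_sc:
  fixes f :: "real \<Rightarrow> complex"
  assumes f: "f \<in> borel_measurable borel" and K: "\<And>x. cmod (f x) \<le> K"
  shows "(\<integral>x. f x \<partial>mu_sc \<theta>) = of_real (2 / pi) * (\<integral>t. of_real (sc_kernel (- \<theta>) t) * f (- 2 * cos t) \<partial>arc)
    + of_real (if \<bar>\<theta>\<bar> > 1 then 1 - 1 / \<theta>\<^sup>2 else 0) * f (\<theta> + 1 / \<theta>)"
proof -
  define w where "w = (if \<bar>\<theta>\<bar> > 1 then 1 - 1 / \<theta>\<^sup>2 else 0)"
  let ?g = "\<lambda>t. of_real (sc_kernel (- \<theta>) t) * f (- 2 * cos t)"
  have gm: "?g \<in> borel_measurable borel" using f by measurable
  have gb: "cmod (?g t) \<le> 1 * K" for t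
    unfolding norm_mult using sc_kernel_bounds[of "- \<theta>" t] K by (intro mult_mono) auto
  have gi: "integrable arc ?g" by (rule integrable_arc_bounded[OF gm gb])
  have gi': "integrable lborel (\<lambda>t. indicator {0..pi} t *\<^sub>R ?g t)"
    using gi unfolding arc_def by (subst (asm) integrable_restrict_space) (auto simp: set_integrable_def)
  have atom_int: "integrable lborel (\<lambda>t. indicator {4..5::real} t *\<^sub>R (of_real w * f (\<theta> + 1 / \<theta>)))"
    by (intro integrable_scaleR_left) simp
  have "(\<integral>x. f x \<partial>mu_sc \<theta>) = (\<integral>t. f (sc_map \<theta> t) \<partial>density lborel (sc_density \<theta>))"
    unfolding mu_sc_eq_distr using f by (intro integral_distr) auto
  also have "\<dots> = (\<integral>t. sc_density \<theta> t *\<^sub>R f (sc_map \<theta> t) \<partial>lborel)"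
    using f sc_density_nonneg by (intro integral_density) auto
  also have "\<dots> = (\<integral>t. of_real (2 / pi) * (indicator {0..pi} t *\<^sub>R ?g t)
      + indicator {4..5} t *\<^sub>R (of_real w * f (\<theta> + 1 / \<theta>)) \<partial>lborel)"
  proof (intro Bochner_Integration.integral_cong refl)
    fix t :: real
    consider "t \<le> pi" | "t > pi" by linarith
    then show "sc_density \<theta> t *\<^sub>R f (sc_map \<theta> t) = of_real (2 / pi) * (indicator {0..pi} t *\<^sub>R ?g t)
      + indicator {4..5} t *\<^sub>R (of_real w * f (\<theta> + 1 / \<theta>))"
      using pi_less_4 by cases
        (auto simp: sc_density_def sc_map_def w_def[symmetric] indicator_def scaleR_conv_of_real)
  qed
  also have "\<dots> = of_real (2 / pi) * (\<integral>t. indicator {0..pi} t *\<^sub>R ?g t \<partial>lborel)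
      + (\<integral>t. indicator {4..5::real} t *\<^sub>R (of_real w * f (\<theta> + 1 / \<theta>)) \<partial>lborel)"
    by (simp only: Bochner_Integration.integral_add[OF integrable_mult_right[OF gi'] atom_int]
        integral_mult_right_zero)
  also have "(\<integral>t. indicator {4..5::real} t *\<^sub>R (of_real w * f (\<theta> + 1 / \<theta>)) \<partial>lborel) = of_real w * f (\<theta> + 1 / \<theta>)"
    by (subst integral_scaleR_left) auto
  also have "(\<integral>t. indicator {0..pi} t *\<^sub>R ?g t \<partial>lborel) = (\<integral>t. ?g t \<partial>arc)"
    unfolding arc_def by (subst integral_restrict_space) auto
  finally show ?thesis by (simp add: w_def)
qed

lemma space_mu_sc [simp]: "space (mu_sc \<theta>) = UNIV"
  by (simp add: mu_sc_eq_distr)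

lemma sets_mu_sc [simp, measurable_cong]: "sets (mu_sc \<theta>) = sets borel"
  by (simp add: mu_sc_eq_distr)

text \<open>At b = 0 the factor \<open>poisson_like\<close> is 1, so
  \<open>integral_sc_kernel\<close> gives the mass of the bulk: 1 for |theta| <= 1 and 1 / theta^2
  otherwise, which the atom completes to 1.\<close>

lemma prob_space_mu_sc: "prob_space (mu_sc \<theta>)"
proof (rule prob_spaceI)
  have fin: "integrable lborel (sc_density \<theta>)"
  proof -
    have "integrable arc (sc_kernel (- \<theta>))"
      using sc_kernel_bounds by (intro integrable_arc_bounded[of _ 1]) auto
    then have "integrable lborel (\<lambda>t. indicator {0..pi} t *\<^sub>R sc_kernel (- \<theta>) t)"
      unfolding arc_def by (subst (asm) integrable_restrict_space) (auto simp: set_integrable_def)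
    then have "integrable lborel (\<lambda>t. 2 / pi * (indicator {0..pi} t *\<^sub>R sc_kernel (- \<theta>) t))"
      by (rule integrable_mult_right)
    then show ?thesis unfolding sc_density_def[abs_def]
      by (intro Bochner_Integration.integrable_add) (auto simp: mult_ac)
  qed
  have em: "emeasure (mu_sc \<theta>) UNIV = ennreal (\<integral>t. sc_density \<theta> t \<partial>lborel)"
    using nn_integral_eq_integral[OF fin] sc_density_nonneg
    by (simp add: mu_sc_eq_distr emeasure_distr emeasure_density)
  then have "measure (mu_sc \<theta>) UNIV = (\<integral>t. sc_density \<theta> t \<partial>lborel)"
    using sc_density_nonneg by (simp add: measure_def)
  \<comment> \<open>\<open>integral_mu_sc\<close> is stated for complex integrands, hence the detour
    through the complex constant 1.\<close>
  moreover have "complex_of_real (measure (mu_sc \<theta>) UNIV) = 1"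
  proof -
    have "complex_of_real (measure (mu_sc \<theta>) UNIV) = (\<integral>x. 1 \<partial>mu_sc \<theta>)"
      by (simp add: scaleR_conv_of_real)
    also have "\<dots> = of_real (2 / pi) * (\<integral>t. of_real (sc_kernel (- \<theta>) t) * poisson_like 0 t \<partial>arc)
        + of_real (if \<bar>\<theta>\<bar> > 1 then 1 - 1 / \<theta>\<^sup>2 else 0)"
      using integral_mu_sc[of "\<lambda>_. 1" 1 \<theta>] by (simp add: poisson_like_def)
    also have "\<dots> = 1"
      using integral_sc_kernel[of 0 "- \<theta>"] by (auto simp: power2_eq_square)
    finally show ?thesis .
  qed
  ultimately show "emeasure (mu_sc \<theta>) (space (mu_sc \<theta>)) = 1"
    using em by (simp del: of_real_eq_1_iff add: of_real_eq_1_iff[THEN iffD1])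
qed

text \<open>As - z = s + 1 / s, the Cauchy kernel at x = - 2 cos t is s times
  \<open>poisson_like s t\<close>, and \<open>integral_sc_kernel\<close> evaluates the bulk. For
  |theta| > 1 bulk and atom share the denominator factor theta + s, which cancels in their
  sum.\<close>

lemma stieltjes_mu_sc:
  assumes z: "Im z > 0" and s: "s\<^sup>2 + z * s + 1 = 0" "Im s > 0" "cmod s < 1"
  shows "(\<integral>x. 1 / (of_real x - z) \<partial>mu_sc \<theta>) = s / (1 + of_real \<theta> * s)"
proof -
  let ?\<theta> = "complex_of_real \<theta>"
  have s0: "s \<noteq> 0" using s(2) by auto
  have zs: "- z = s + 1 / s"
  proof -
    have "(- z) * s = 1 + s\<^sup>2" using s(1) by (simp add: algebra_simps add_eq_0_iff2)
    then have "- z = (1 + s\<^sup>2) / s" by (rule iffD2[OF nonzero_eq_divide_eq[OF s0]])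
    also have "(1 + s\<^sup>2) / s = s + 1 / s"
      using s0 by (simp add: add_divide_distrib power2_eq_square)
    finally show ?thesis .
  qed
  have nz: "1 + ?\<theta> * s \<noteq> 0"
  proof
    assume "1 + ?\<theta> * s = 0"
    then have "?\<theta> * s = -1" by (simp add: add_eq_0_iff)
    then have "Im (?\<theta> * s) = 0" "?\<theta> \<noteq> 0" by auto
    then show False using s(2) by simp
  qed
  note b = cauchy_transform_bound[OF z]
  have "1 / (of_real (- 2 * cos t) - z) = s * poisson_like s t" for t
  proof -
    have "of_real (- 2 * cos t) - z = (s + 1 / s) - 2 * of_real (cos t)" unfolding zs[symmetric] by simp
    also have "\<dots> = (1 + s\<^sup>2 - 2 * s * of_real (cos t)) / s"
      using s0 by (simp add: field_simps power2_eq_square)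
    finally have "of_real (- 2 * cos t) - z = (1 + s\<^sup>2 - 2 * s * of_real (cos t)) / s" .
    then show ?thesis by (simp add: poisson_like_def)
  qed
  then have "(\<integral>t. of_real (sc_kernel (- \<theta>) t) * (1 / (of_real (- 2 * cos t) - z)) \<partial>arc)
      = (\<integral>t. s * (of_real (sc_kernel (- \<theta>) t) * poisson_like s t) \<partial>arc)"
    by (simp add: mult_ac)
  also have "\<dots> = s * (\<integral>t. of_real (sc_kernel (- \<theta>) t) * poisson_like s t \<partial>arc)"
    by simp
  finally have *: "(\<integral>t. of_real (sc_kernel (- \<theta>) t) * (1 / (of_real (- 2 * cos t) - z)) \<partial>arc)
      = s * (\<integral>t. of_real (sc_kernel (- \<theta>) t) * poisson_like s t \<partial>arc)" .
  have int: "(\<integral>x. 1 / (of_real x - z) \<partial>mu_sc \<theta>)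
      = of_real (2 / pi) * (s * (\<integral>t. of_real (sc_kernel (- \<theta>) t) * poisson_like s t \<partial>arc))
        + of_real (if \<bar>\<theta>\<bar> > 1 then 1 - 1 / \<theta>\<^sup>2 else 0) * (1 / (of_real (\<theta> + 1 / \<theta>) - z))"
    unfolding *[symmetric] by (rule integral_mu_sc[OF _ b]) measurable
  show ?thesis
  proof (cases "\<bar>\<theta>\<bar> \<le> 1")
    case True
    have "of_real (2 / pi) * (s * (of_real (pi / 2) / D)) = s / D" for D :: complex by simp
    from this[of "1 + ?\<theta> * s"] show ?thesis
      unfolding int integral_sc_kernel[OF s(3)] using True by simp
  next
    case False
    have \<theta>0: "?\<theta> \<noteq> 0" using False by auto
    have \<theta>s: "?\<theta> + s \<noteq> 0" using s(2) by (auto simp: complex_eq_iff)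
    have at: "of_real (\<theta> + 1 / \<theta>) - z = (?\<theta> + s) * (1 + ?\<theta> * s) / (?\<theta> * s)"
    proof -
      have "of_real (\<theta> + 1 / \<theta>) - z = ?\<theta> + 1 / ?\<theta> + (s + 1 / s)" unfolding zs[symmetric] by simp
      also have "\<dots> = (?\<theta> + s) * (1 + ?\<theta> * s) / (?\<theta> * s)"
        using s0 \<theta>0 by (simp add: field_simps)
      finally show ?thesis .
    qed
    have "of_real (2 / pi) * (s * (of_real (pi / 2) / (of_real (- \<theta>) * (of_real (- \<theta>) - s))))
        = s / (?\<theta> * (?\<theta> + s))"
    proof -
      have "of_real (2 / pi) * (s * (of_real (pi / 2) / D)) = s / D" for D :: complex by simp
      moreover have "of_real (- \<theta>) * (of_real (- \<theta>) - s) = ?\<theta> * (?\<theta> + s)"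
        by (simp add: algebra_simps)
      ultimately show ?thesis by simp
    qed
    moreover have "of_real (1 - 1 / \<theta>\<^sup>2) * (1 / (of_real (\<theta> + 1 / \<theta>) - z))
        = s * (?\<theta>\<^sup>2 - 1) / (?\<theta> * (?\<theta> + s) * (1 + ?\<theta> * s))"
      unfolding at using \<theta>0 s0 \<theta>s nz by (simp add: divide_simps power2_eq_square)
    moreover have "s / (?\<theta> * (?\<theta> + s)) + s * (?\<theta>\<^sup>2 - 1) / (?\<theta> * (?\<theta> + s) * (1 + ?\<theta> * s))
        = s / (1 + ?\<theta> * s)"
    proof -
      \<comment> \<open>Over the common denominator the numerators add up to (1 + theta s) +
        (theta^2 - 1) = theta (theta + s).\<close>
      have "s / (?\<theta> * (?\<theta> + s)) + s * (?\<theta>\<^sup>2 - 1) / (?\<theta> * (?\<theta> + s) * (1 + ?\<theta> * s))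
          = s * (?\<theta> * (?\<theta> + s)) / (?\<theta> * (?\<theta> + s) * (1 + ?\<theta> * s))"
        using \<theta>0 \<theta>s nz by (simp add: divide_simps) (simp add: algebra_simps power2_eq_square)
      also have "\<dots> = s / (1 + ?\<theta> * s)" using \<theta>0 \<theta>s by simp
      finally show ?thesis .
    qed
    ultimately show ?thesis
      unfolding int integral_sc_kernel[OF s(3)] using False by simp
  qed
qed

section \<open>Rank-one spikes, Cauchy kernels and convergence in probability\<close>

definition mat_trace :: "real Matrix.mat \<Rightarrow> real" where
  "mat_trace A = (\<Sum>i<dim_row A. index_mat A (i, i))"

lemma mat_trace_comm:
  assumes "A \<in> carrier_mat n n" "B \<in> carrier_mat n n"
  shows "mat_trace (A * B) = mat_trace (B * A)"
proof -
  have e: "mat_trace (A * B) = (\<Sum>i<n. \<Sum>k<n. index_mat A (i, k) * index_mat B (k, i))"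
    if "A \<in> carrier_mat n n" "B \<in> carrier_mat n n" for A B :: "real Matrix.mat"
    using that by (simp add: mat_trace_def scalar_prod_def atLeast0LessThan)
  show ?thesis
    unfolding e[OF assms] e[OF assms(2,1)] by (subst sum.swap) (simp add: mult.commute)
qed

text \<open>Schur decomposition gives a similar upper triangular B with the prescribed eigenvalues
  on its diagonal. The trace of the square is invariant, and by triangularity the diagonal of B B
  consists of the squared eigenvalues.\<close>

lemma mat_trace_sq_char_poly:
  assumes A: "A \<in> carrier_mat n n" and n: "n \<ge> 1"
    and cp: "char_poly A = [:- \<theta>, 1:] * [:0, 1:] ^ (n - 1)"
  shows "mat_trace (A * A) = \<theta>\<^sup>2"
proof -
  define es where "es = \<theta> # replicate (n - 1) 0"
  have cp': "char_poly A = (\<Prod>e\<leftarrow>es. [:- e, 1:])"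
    by (simp add: cp es_def)
  obtain B P Q where BPQ: "schur_decomposition A es = (B, P, Q)"
    using prod_cases3 by blast
  have sim: "similar_mat_wit A B P Q" and tri: "upper_triangular B" and diag: "diag_mat B = es"
    using schur_decomposition[OF A cp' BPQ] by auto
  have car: "B \<in> carrier_mat n n" "P \<in> carrier_mat n n" "Q \<in> carrier_mat n n"
    and QP: "Q * P = 1\<^sub>m n" and AB: "A = P * B * Q"
    using sim A by (auto simp: similar_mat_wit_def Let_def)
  have "A * A = P * B * (Q * P) * (B * Q)"
    unfolding AB using car by (simp add: assoc_mult_mat[of _ n n _ n _ n])
  also have "\<dots> = P * (B * B * Q)"
    unfolding QP using car by (simp add: assoc_mult_mat[of _ n n _ n _ n])
  finally have "mat_trace (A * A) = mat_trace (B * B * Q * P)"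
    using mat_trace_comm[of P n "B * B * Q"] car by simp
  also have "B * B * Q * P = B * B"
    using car QP by (simp add: assoc_mult_mat[of _ n n _ n _ n])
  also have "mat_trace (B * B) = (\<Sum>i<n. \<Sum>k<n. index_mat B (i, k) * index_mat B (k, i))"
    using car by (simp add: mat_trace_def scalar_prod_def atLeast0LessThan)
  also have "\<dots> = (\<Sum>i<n. \<Sum>k<n. if k = i then (index_mat B (i, i))\<^sup>2 else 0)"
  proof (intro sum.cong refl)
    fix i k assume "i \<in> {..<n}" "k \<in> {..<n}"
    then show "index_mat B (i, k) * index_mat B (k, i) = (if k = i then (index_mat B (i, i))\<^sup>2 else 0)"
      using upper_triangularD[OF tri, of k i] upper_triangularD[OF tri, of i k] car
      by (cases i k rule: linorder_cases) (auto simp: power2_eq_square)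
  qed
  also have "\<dots> = (\<Sum>i<n. (index_mat B (i, i))\<^sup>2)" by simp
  also have "\<dots> = (\<Sum>i<n. (es ! i)\<^sup>2)"
    unfolding diag[symmetric] using car by (simp add: diag_mat_def)
  also have "\<dots> = (\<Sum>i<n. if i = 0 then \<theta>\<^sup>2 else 0)"
    by (intro sum.cong refl) (auto simp: es_def nth_Cons split: nat.split)
  also have "\<dots> = \<theta>\<^sup>2" using n by simp
  finally show ?thesis .
qed

text \<open>The squared Frobenius distance from A to theta v v^T is tr (A A) - 2 theta <v, A v> +
  theta^2 = theta^2 - 2 theta^2 + theta^2 = 0. The argument covers theta = 0, where A
  vanishes.\<close>

lemma rank_one_of_char_poly:
  fixes A :: "real Matrix.mat" and v :: "real Matrix.vec"
  assumes A: "A \<in> carrier_mat n n" and n: "n \<ge> 1" and sym: "transpose_mat A = A"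
    and cp: "char_poly A = [:- \<theta>, 1:] * [:0, 1:] ^ (n - 1)"
    and v: "v \<in> carrier_vec n" "scalar_prod v v = 1" "eigenvector A v \<theta>"
    and ij: "i < n" "j < n"
  shows "index_mat A (i, j) = \<theta> * vec_index v i * vec_index v j"
proof -
  let ?a = "\<lambda>i j. index_mat A (i, j)" and ?v = "vec_index v"
  have vv: "(\<Sum>i<n. (?v i)\<^sup>2) = 1"
    using v(1,2) by (simp add: scalar_prod_def atLeast0LessThan power2_eq_square)
  have s: "?a i j = ?a j i" if "i < n" "j < n" for i j
    using arg_cong[OF sym, of "\<lambda>M. index_mat M (j, i)"] that A by simp
  have Av: "(\<Sum>j<n. ?a i j * ?v j) = \<theta> * ?v i" if "i < n" for i
  proof -
    have "vec_index (A *\<^sub>v v) i = vec_index (\<theta> \<cdot>\<^sub>v v) i" using v(3) by (simp add: eigenvector_def)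
    then show ?thesis using that A v(1) by (simp add: scalar_prod_def atLeast0LessThan)
  qed
  have "(\<Sum>i<n. \<Sum>j<n. (?a i j)\<^sup>2) = mat_trace (A * A)"
    using A s by (auto simp: mat_trace_def scalar_prod_def atLeast0LessThan power2_eq_square
        intro!: sum.cong)
  also have "\<dots> = \<theta>\<^sup>2" by (rule mat_trace_sq_char_poly[OF A n cp])
  finally have 1: "(\<Sum>i<n. \<Sum>j<n. (?a i j)\<^sup>2) = \<theta>\<^sup>2" .
  have "(\<Sum>i<n. \<Sum>j<n. ?a i j * (?v i * ?v j)) = (\<Sum>i<n. ?v i * (\<Sum>j<n. ?a i j * ?v j))"
    by (simp add: sum_distrib_left mult_ac)
  also have "\<dots> = (\<Sum>i<n. \<theta> * (?v i)\<^sup>2)"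
    using Av by (intro sum.cong refl) (simp add: power2_eq_square)
  also have "\<dots> = \<theta>" using vv by (simp flip: sum_distrib_left)
  finally have 2: "(\<Sum>i<n. \<Sum>j<n. ?a i j * (?v i * ?v j)) = \<theta>" .
  have 3: "(\<Sum>i<n. \<Sum>j<n. (?v i * ?v j)\<^sup>2) = 1"
    using vv by (simp add: power_mult_distrib flip: sum_product)
  have "(\<Sum>i<n. \<Sum>j<n. (?a i j - \<theta> * ?v i * ?v j)\<^sup>2)
      = (\<Sum>i<n. \<Sum>j<n. (?a i j)\<^sup>2) - 2 * \<theta> * (\<Sum>i<n. \<Sum>j<n. ?a i j * (?v i * ?v j))
        + \<theta>\<^sup>2 * (\<Sum>i<n. \<Sum>j<n. (?v i * ?v j)\<^sup>2)"
    unfolding sum_distrib_left sum.distrib[symmetric] sum_subtractf[symmetric]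
    by (intro sum.cong refl) (simp add: power2_eq_square algebra_simps)
  also have "\<dots> = 0" unfolding 1 2 3 by (simp add: power2_eq_square)
  finally have "(\<Sum>i<n. \<Sum>j<n. (?a i j - \<theta> * ?v i * ?v j)\<^sup>2) = 0" .
  then have "\<forall>i<n. (\<Sum>j<n. (?a i j - \<theta> * ?v i * ?v j)\<^sup>2) = 0"
    by (subst (asm) sum_nonneg_eq_0_iff) (auto intro: sum_nonneg)
  then have "\<forall>j<n. (?a i j - \<theta> * ?v i * ?v j)\<^sup>2 = 0"
    using ij by (subst (asm) sum_nonneg_eq_0_iff) auto
  then show ?thesis using ij by simp
qed

section \<open>Uniform approximation by Cauchy kernels\<close>

definition cauchy_kernel :: "real \<Rightarrow> real \<Rightarrow> real" where
  "cauchy_kernel e u = e / (e\<^sup>2 + u\<^sup>2)"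

lemma cauchy_kernel_nonneg: "e > 0 \<Longrightarrow> cauchy_kernel e u \<ge> 0"
  by (simp add: cauchy_kernel_def)

text \<open>The difference carries the factor (w - u) (w + u); |w| and |u| are each absorbed by
  their own denominator through |x| / (e^2 + x^2) <= 1 / (2 e).\<close>

lemma cauchy_kernel_lipschitz:
  assumes e: "e > 0"
  shows "\<bar>cauchy_kernel e u - cauchy_kernel e w\<bar> \<le> \<bar>u - w\<bar> / e\<^sup>2"
proof -
  have p: "e\<^sup>2 + x\<^sup>2 > 0" for x using e by (simp add: add_pos_nonneg)
  have b: "\<bar>x\<bar> / (e\<^sup>2 + x\<^sup>2) \<le> 1 / (2 * e)" for x
    using sum_squares_bound[of e "\<bar>x\<bar>"] e p[of x] by (simp add: field_simps power2_eq_square)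
  have c: "1 / (e\<^sup>2 + x\<^sup>2) \<le> 1 / e\<^sup>2" for x
    using e p[of x] by (intro divide_left_mono) auto
  have "cauchy_kernel e u - cauchy_kernel e w = e * ((w - u) * (w + u)) / ((e\<^sup>2 + u\<^sup>2) * (e\<^sup>2 + w\<^sup>2))"
    unfolding cauchy_kernel_def
    by (subst diff_frac_eq)
       (use p[of u] p[of w] in \<open>auto simp: less_imp_neq[symmetric] algebra_simps power2_eq_square
         intro!: arg_cong2[of _ _ _ _ "(/)"]\<close>)
  then have "\<bar>cauchy_kernel e u - cauchy_kernel e w\<bar>
      = e * \<bar>u - w\<bar> * (\<bar>w + u\<bar> / ((e\<^sup>2 + u\<^sup>2) * (e\<^sup>2 + w\<^sup>2)))"
    using e p[of u] p[of w] by (simp add: abs_mult abs_minus_commute)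
  also have "\<bar>w + u\<bar> / ((e\<^sup>2 + u\<^sup>2) * (e\<^sup>2 + w\<^sup>2))
      \<le> (\<bar>w\<bar> + \<bar>u\<bar>) / ((e\<^sup>2 + u\<^sup>2) * (e\<^sup>2 + w\<^sup>2))"
    using p[of u] p[of w] by (intro divide_right_mono) auto
  also have "\<dots> = \<bar>w\<bar> / (e\<^sup>2 + w\<^sup>2) * (1 / (e\<^sup>2 + u\<^sup>2)) + \<bar>u\<bar> / (e\<^sup>2 + u\<^sup>2) * (1 / (e\<^sup>2 + w\<^sup>2))"
    by (simp add: add_divide_distrib mult.commute)
  also have "\<dots> \<le> 1 / (2 * e) * (1 / e\<^sup>2) + 1 / (2 * e) * (1 / e\<^sup>2)"
    using e p by (intro add_mono mult_mono b c) (auto simp: less_imp_le)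
  finally have "\<bar>cauchy_kernel e u - cauchy_kernel e w\<bar>
      \<le> e * \<bar>u - w\<bar> * (1 / (2 * e) * (1 / e\<^sup>2) + 1 / (2 * e) * (1 / e\<^sup>2))"
    using e by (simp add: mult_left_mono)
  also have "\<dots> = \<bar>u - w\<bar> / e\<^sup>2" using e by simp
  finally show ?thesis .
qed

lemma arctan_le_self:
  assumes "x \<ge> (0::real)" shows "arctan x \<le> x"
proof (cases "x = 0")
  case False
  then have "x > 0" using assms by simp
  then obtain y where "0 < y" "y < x" and y: "arctan x - arctan 0 = (x - 0) * inverse (1 + y\<^sup>2)"
    using MVT2[of 0 x arctan "\<lambda>t. inverse (1 + t\<^sup>2)"] DERIV_arctan by blast
  have "inverse (1 + y\<^sup>2) \<le> 1" by (simp add: inverse_eq_divide divide_le_eq_1 add_pos_nonneg)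
  then show ?thesis using y assms mult_left_mono[of "inverse (1 + y\<^sup>2)" 1 x] by simp
qed simp

text \<open>The antiderivative is an arctangent. By the mean value theorem the integral over a cell
  is d times a kernel value inside it, and the Lipschitz bound costs d^2 / e^2 per cell.\<close>

lemma cauchy_kernel_riemann_sum:
  fixes a d x e :: real
  assumes e: "e > 0" and d: "d > 0"
  shows "\<bar>(\<Sum>k<N. d * cauchy_kernel e (x - (a + real k * d)))
      - (arctan ((a + real N * d - x) / e) - arctan ((a - x) / e))\<bar> \<le> real N * (d\<^sup>2 / e\<^sup>2)"
proof -
  let ?t = "\<lambda>k. a + real k * d"
  let ?A = "\<lambda>t. arctan ((t - x) / e)"
  have "\<bar>d * cauchy_kernel e (x - ?t k) - (?A (?t (Suc k)) - ?A (?t k))\<bar> \<le> d\<^sup>2 / e\<^sup>2" for k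
  proof -
    have D: "(?A has_real_derivative cauchy_kernel e (t - x)) (at t)" for t
    proof -
      have "(?A has_real_derivative (1 / e) / (1 + ((t - x) / e)\<^sup>2)) (at t)"
        using e by (auto intro!: derivative_eq_intros simp: inverse_eq_divide)
      also have "(1 / e) / (1 + ((t - x) / e)\<^sup>2) = cauchy_kernel e (t - x)"
        using e by (simp add: cauchy_kernel_def field_simps power2_eq_square)
      finally show ?thesis .
    qed
    have "?t k < ?t (Suc k)" using d by (simp add: algebra_simps)
    then obtain y where y: "?t k < y" "y < ?t (Suc k)"
        and A: "?A (?t (Suc k)) - ?A (?t k) = (?t (Suc k) - ?t k) * cauchy_kernel e (y - x)"
      using MVT2[of "?t k" "?t (Suc k)" ?A "\<lambda>t. cauchy_kernel e (t - x)"] D by blast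
    have sd: "?t (Suc k) - ?t k = d" by (simp add: algebra_simps)
    have "\<bar>d * cauchy_kernel e (x - ?t k) - (?A (?t (Suc k)) - ?A (?t k))\<bar>
        = d * \<bar>cauchy_kernel e (?t k - x) - cauchy_kernel e (y - x)\<bar>"
    proof -
      have "cauchy_kernel e (x - ?t k) = cauchy_kernel e (?t k - x)"
        by (simp add: cauchy_kernel_def power2_commute)
      then show ?thesis
        unfolding A sd using d by (simp only: right_diff_distrib[symmetric] abs_mult abs_of_pos)
    qed
    also have "\<dots> \<le> d * (\<bar>?t k - x - (y - x)\<bar> / e\<^sup>2)"
      using d by (intro mult_left_mono cauchy_kernel_lipschitz e) auto
    also have "\<dots> \<le> d * (d / e\<^sup>2)"
      using d y by (intro mult_left_mono divide_right_mono) (auto simp: algebra_simps)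
    finally show ?thesis by (simp add: power2_eq_square)
  qed
  then have sumle: "(\<Sum>k<N. \<bar>d * cauchy_kernel e (x - ?t k) - (?A (?t (Suc k)) - ?A (?t k))\<bar>) \<le> real N * (d\<^sup>2 / e\<^sup>2)"
    using sum_bounded_above[of "{..<N}"] by (metis (no_types, lifting) card_lessThan)
  have tel: "(\<Sum>k<N. d * cauchy_kernel e (x - ?t k)) - (?A (?t N) - ?A (?t 0))
      = (\<Sum>k<N. d * cauchy_kernel e (x - ?t k) - (?A (?t (Suc k)) - ?A (?t k)))"
    using sum_lessThan_telescope[of "\<lambda>k. ?A (?t k)" N] by (simp add: sum_subtractf)
  have "\<bar>(\<Sum>k<N. d * cauchy_kernel e (x - ?t k)) - (?A (?t N) - ?A (?t 0))\<bar> \<le> real N * (d\<^sup>2 / e\<^sup>2)"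
    unfolding tel by (rule order_trans[OF sum_abs sumle])
  then show ?thesis by simp
qed

text \<open>Convolution with a narrow Cauchy kernel, discretised by a Riemann sum. The nodes extend
  1 beyond the support, so that the kernel centred at any |x| <= R has nearly full mass on them; for
  larger |x| the mass is multiplied by g x = 0.\<close>

lemma cauchy_kernel_approx:
  fixes g :: "real \<Rightarrow> real"
  assumes cont: "continuous_on UNIV g" and supp: "\<And>x. \<bar>x\<bar> \<ge> R \<Longrightarrow> g x = 0" and R: "R > 0"
    and eps: "\<epsilon> > 0"
  obtains N c t e where "e > 0"
    "\<And>x. \<bar>(\<Sum>k<N::nat. c k * cauchy_kernel e (x - t k)) - g x\<bar> \<le> \<epsilon>"
proof -
  have uc: "uniformly_continuous_on UNIV g"
  proof -
    have "uniformly_continuous_on {-R-1..R+1} g"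
      using cont by (intro compact_uniformly_continuous) (auto intro: continuous_on_subset)
    show ?thesis
      unfolding uniformly_continuous_on_def
    proof (intro allI impI)
      fix d :: real assume "d > 0"
      then obtain r where r: "r > 0" "\<And>x y. x \<in> {-R-1..R+1} \<Longrightarrow> y \<in> {-R-1..R+1} \<Longrightarrow>
          dist y x < r \<Longrightarrow> dist (g y) (g x) < d"
        using \<open>uniformly_continuous_on {-R-1..R+1} g\<close> unfolding uniformly_continuous_on_def by metis
      \<comment> \<open>Two points at distance below 1 that are not both within R + 1 both have
        modulus at least R, where g is 0.\<close>
      have "dist (g y) (g x) < d" if xy: "dist y x < min r 1" for x y
      proof (cases "\<bar>x\<bar> \<le> R + 1 \<and> \<bar>y\<bar> \<le> R + 1")
        case True
        then show ?thesis using r(2)[of x y] xy by (auto simp: abs_le_iff)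
      next
        case False
        then have "\<bar>x\<bar> \<ge> R" "\<bar>y\<bar> \<ge> R" using xy by (auto simp: dist_real_def)
        then show ?thesis using supp \<open>d > 0\<close> by simp
      qed
      then show "\<exists>r>0. \<forall>x\<in>UNIV. \<forall>x'\<in>UNIV. dist x' x < r \<longrightarrow> dist (g x') (g x) < d"
        using r(1) by (intro exI[of _ "min r 1"]) auto
    qed
  qed
  have "bounded (g ` {-R..R})"
    using cont by (intro compact_imp_bounded compact_continuous_image) (auto intro: continuous_on_subset)
  then obtain K0 where "\<forall>x\<in>{-R..R}. \<bar>g x\<bar> \<le> K0"
    by (auto simp: bounded_iff)
  then have K0: "\<bar>g x\<bar> \<le> K0" if "x \<in> {-R..R}" for x using that by blast
  define K where "K = max K0 1"
  have K: "K \<ge> 1" "\<bar>g x\<bar> \<le> K" for x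
  proof -
    show "K \<ge> 1" by (simp add: K_def)
    show "\<bar>g x\<bar> \<le> K"
    proof (cases "\<bar>x\<bar> \<le> R")
      case True
      then have "x \<in> {-R..R}" by auto
      from K0[OF this] show ?thesis by (simp add: K_def)
    qed (use supp[of x] in \<open>simp add: K_def\<close>)
  qed
  obtain r where r: "r > 0" and gr: "\<And>x y. \<bar>y - x\<bar> < r \<Longrightarrow> \<bar>g y - g x\<bar> \<le> \<epsilon> / 8"
    using uc eps unfolding uniformly_continuous_on_def dist_real_def
    by (metis UNIV_I divide_pos_pos less_imp_le zero_less_numeral)
  define L where "L = 2 * R + 2"
  have L: "L > 0" using R by (simp add: L_def)
  \<comment> \<open>The first bound controls the mass lost beyond the nodes, K e <= \<epsilon> / 4;
    the second controls the tail at distance r or more, 2 K L e / r^2 <= \<epsilon> / 4.\<close>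
  define e where "e = min (\<epsilon> / (4 * K)) (\<epsilon> * r\<^sup>2 / (8 * K * L))"
  have e: "e > 0" using eps K(1) r L by (simp add: e_def)
  have e1: "K * e \<le> \<epsilon> / 4"
  proof -
    have "K * e \<le> K * (\<epsilon> / (4 * K))" using K(1) by (intro mult_left_mono) (auto simp: e_def)
    then show ?thesis using K(1) by simp
  qed
  have e2: "2 * K * L * (e / r\<^sup>2) \<le> \<epsilon> / 4"
  proof -
    have "2 * K * L * (e / r\<^sup>2) \<le> 2 * K * L * (\<epsilon> * r\<^sup>2 / (8 * K * L) / r\<^sup>2)"
      using K(1) L by (intro mult_left_mono divide_right_mono) (auto simp: e_def)
    then show ?thesis using K(1) r L by simp
  qed
  \<comment> \<open>N is chosen after e, because the Riemann sum error L^2 / (e^2 N) has to be at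
    most 1 and, multiplied by K, at most \<epsilon> / 4.\<close>
  obtain N :: nat where N: "real N > L\<^sup>2 / e\<^sup>2 * max 1 (4 * K / \<epsilon>)" using reals_Archimedean2 by blast
  have m1: "max 1 (4 * K / \<epsilon>) \<ge> 1" by simp
  have N0: "real N > 0"
  proof -
    have "L\<^sup>2 / e\<^sup>2 * max 1 (4 * K / \<epsilon>) \<ge> 0" using m1 by (intro mult_nonneg_nonneg) auto
    then show ?thesis using N by linarith
  qed
  define d where "d = L / N"
  have d: "d > 0" "real N * d = L" using N0 L by (simp_all add: d_def)
  define \<rho> where "\<rho> = real N * (d\<^sup>2 / e\<^sup>2)"
  have \<rho>eq: "\<rho> = L\<^sup>2 / e\<^sup>2 / N" using N0 by (simp add: \<rho>_def d_def power2_eq_square)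
  have \<rho>: "\<rho> \<ge> 0" "\<rho> * max 1 (4 * K / \<epsilon>) \<le> 1"
  proof -
    have "\<rho> * max 1 (4 * K / \<epsilon>) = (L\<^sup>2 / e\<^sup>2 * max 1 (4 * K / \<epsilon>)) / N" by (simp add: \<rho>eq)
    also have "\<dots> \<le> real N / N" using N by (intro divide_right_mono) auto
    finally show "\<rho> * max 1 (4 * K / \<epsilon>) \<le> 1" using N0 by simp
  qed (simp add: \<rho>eq)
  have \<rho>1: "\<rho> \<le> 1" using \<rho> m1 mult_left_mono[OF m1 \<rho>(1)] by linarith
  have \<rho>2: "K * \<rho> \<le> \<epsilon> / 4"
  proof -
    have "\<rho> * (4 * K / \<epsilon>) \<le> \<rho> * max 1 (4 * K / \<epsilon>)" using \<rho>(1) by (intro mult_left_mono) auto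
    then have "\<rho> * (4 * K / \<epsilon>) \<le> 1" using \<rho>(2) by linarith
    then show ?thesis using eps by (simp add: field_simps)
  qed
  define t where "t k = - R - 1 + real k * d" for k :: nat
  define p where "p k x = d * cauchy_kernel e (x - t k) / pi" for k x
  have p0: "p k x \<ge> 0" for k x using d e by (simp add: p_def cauchy_kernel_nonneg)
  define A where "A x = (arctan ((R + 1 - x) / e) - arctan ((- R - 1 - x) / e)) / pi" for x
  have sum_p: "\<bar>(\<Sum>k<N. p k x) - A x\<bar> \<le> \<rho>" for x
  proof -
    have "- R - 1 + real N * d = R + 1" unfolding d(2) by (simp add: L_def)
    then have "\<bar>(\<Sum>k<N. d * cauchy_kernel e (x - t k))
        - (arctan ((R + 1 - x) / e) - arctan ((- R - 1 - x) / e))\<bar> \<le> \<rho>"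
      using cauchy_kernel_riemann_sum[OF e d(1), where N = N and x = x and a = "- R - 1"]
      by (simp only: t_def \<rho>_def)
    moreover have "(\<Sum>k<N. p k x) - A x = ((\<Sum>k<N. d * cauchy_kernel e (x - t k))
        - (arctan ((R + 1 - x) / e) - arctan ((- R - 1 - x) / e))) / pi"
      by (simp add: p_def A_def diff_divide_distrib sum_divide_distrib)
    ultimately have "\<bar>(\<Sum>k<N. p k x) - A x\<bar> \<le> \<rho> / pi"
      by (simp add: divide_right_mono)
    also have "\<dots> \<le> \<rho>" using \<rho>(1) pi_ge_two by (simp add: divide_le_eq mult_le_cancel_left1)
    finally show ?thesis .
  qed
  have A1: "A x \<le> 1" for x
    using arctan_bounded[of "(R + 1 - x) / e"] arctan_bounded[of "(- R - 1 - x) / e"]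
    by (simp add: A_def divide_le_eq)
  \<comment> \<open>Both ends are at distance at least 1 from x, so the missing mass is at most (2 /
    pi) arctan e.\<close>
  have A2: "1 - A x \<le> e" if "\<bar>x\<bar> \<le> R" for x
  proof -
    have "1 / e \<le> (R + 1 - x) / e"
      using that e by (intro divide_right_mono) auto
    moreover have "(- R - 1 - x) / e \<le> - 1 / e"
      using that e by (intro divide_right_mono) auto
    then have "(- R - 1 - x) / e \<le> - (1 / e)" by simp
    ultimately have "arctan (1 / e) \<le> arctan ((R + 1 - x) / e)" "arctan ((- R - 1 - x) / e) \<le> - arctan (1 / e)"
      by (auto simp: arctan_le_iff simp flip: arctan_minus)
    then have "A x \<ge> (2 * arctan (1 / e)) / pi" unfolding A_def by (intro divide_right_mono) auto
    moreover have "arctan (1 / e) = pi / 2 - arctan e"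
      using arctan_inverse[of e] e by (simp add: inverse_eq_divide)
    ultimately have "1 - A x \<le> 2 * arctan e / pi" by (simp add: diff_divide_distrib)
    also have "\<dots> \<le> 2 * e / pi" using arctan_le_self[of e] e by (intro divide_right_mono) auto
    also have "\<dots> \<le> e" using pi_ge_two e by (simp add: divide_le_eq)
    finally show ?thesis .
  qed
  have far: "p k x \<le> d * (e / r\<^sup>2)" if "\<bar>t k - x\<bar> \<ge> r" for k x
  proof -
    have "r\<^sup>2 \<le> (x - t k)\<^sup>2" using that r by (metis abs_le_square_iff abs_minus_commute abs_of_pos)
    then have "cauchy_kernel e (x - t k) \<le> e / r\<^sup>2"
      unfolding cauchy_kernel_def using e r by (intro divide_left_mono) (auto simp: add_pos_nonneg intro: add_increasing)
    then have "p k x \<le> d * (e / r\<^sup>2) / pi" unfolding p_def using d by (intro divide_right_mono mult_left_mono) auto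
    also have "\<dots> \<le> d * (e / r\<^sup>2) / 1"
      using pi_ge_two d e by (intro divide_left_mono) auto
    also have "\<dots> = d * (e / r\<^sup>2)" by simp
    finally show ?thesis .
  qed
  \<comment> \<open>Budget: \<epsilon> / 4 from near nodes (oscillation \<epsilon> / 8, total weight
    at most 2), \<epsilon> / 4 from far nodes and \<epsilon> / 2 from the defect of mass.\<close>
  have main: "\<bar>(\<Sum>k<N. g (t k) * p k x) - g x\<bar> \<le> \<epsilon>" for x
  proof -
    let ?S = "\<Sum>k<N. p k x"
    have S2: "?S \<le> 2" using sum_p[of x] A1[of x] \<rho>1 by linarith
    have "\<bar>(g (t k) - g x) * p k x\<bar> \<le> \<epsilon> / 8 * p k x + 2 * K * (d * (e / r\<^sup>2))" for k
    proof (cases "\<bar>t k - x\<bar> < r")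
      case True
      have "\<bar>(g (t k) - g x) * p k x\<bar> \<le> \<epsilon> / 8 * p k x"
        unfolding abs_mult abs_of_nonneg[OF p0] by (rule mult_right_mono[OF gr[OF True] p0])
      moreover have "0 \<le> 2 * K * (d * (e / r\<^sup>2))" using K(1) d e by simp
      ultimately show ?thesis by linarith
    next
      case False
      have "\<bar>g (t k) - g x\<bar> \<le> 2 * K" using K(2)[of "t k"] K(2)[of x] by linarith
      then have "\<bar>(g (t k) - g x) * p k x\<bar> \<le> 2 * K * (d * (e / r\<^sup>2))"
        unfolding abs_mult using far[of k x] False p0[of k x] K(1) by (intro mult_mono) auto
      moreover have "0 \<le> \<epsilon> / 8 * p k x" using eps p0 by simp
      ultimately show ?thesis by linarith
    qed
    then have "\<bar>\<Sum>k<N. (g (t k) - g x) * p k x\<bar> \<le> (\<Sum>k<N. \<epsilon> / 8 * p k x + 2 * K * (d * (e / r\<^sup>2)))"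
      by (intro order_trans[OF sum_abs] sum_mono)
    also have "\<dots> = \<epsilon> / 8 * ?S + 2 * K * ((real N * d) * (e / r\<^sup>2))"
      by (simp add: sum.distrib sum_distrib_left)
    also have "\<dots> \<le> \<epsilon> / 8 * 2 + \<epsilon> / 4"
      unfolding d(2) using S2 e2 eps by (intro add_mono mult_left_mono) (auto simp: mult.assoc)
    finally have 1: "\<bar>\<Sum>k<N. (g (t k) - g x) * p k x\<bar> \<le> \<epsilon> / 2" by simp
    have 2: "\<bar>g x * (1 - ?S)\<bar> \<le> \<epsilon> / 2"
    proof (cases "\<bar>x\<bar> \<le> R")
      case True
      have "\<bar>1 - ?S\<bar> \<le> e + \<rho>" using sum_p[of x] A1[of x] A2[OF True] by linarith
      then have "\<bar>g x * (1 - ?S)\<bar> \<le> K * (e + \<rho>)"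
        unfolding abs_mult using K by (intro mult_mono) auto
      then show ?thesis using e1 \<rho>2 by (simp add: distrib_left)
    next
      case False then show ?thesis using supp[of x] eps by simp
    qed
    have "(\<Sum>k<N. g (t k) * p k x) - g x = (\<Sum>k<N. (g (t k) - g x) * p k x) - g x * (1 - ?S)"
      by (simp add: left_diff_distrib sum_subtractf right_diff_distrib sum_distrib_left)
    then show ?thesis using 1 2 by linarith
  qed
  show ?thesis
  proof (rule that[OF e, where N = N and c = "\<lambda>k. g (t k) * d / pi" and t = t])
    show "\<bar>(\<Sum>k<N. g (t k) * d / pi * cauchy_kernel e (x - t k)) - g x\<bar> \<le> \<epsilon>" for x
      using main[of x] by (simp add: p_def mult.assoc)
  qed
qed

text \<open>A union bound, with controlling sequences that may depend on \<epsilon>. Two are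
  provided, as needed for a sum of two variables and for the truncation of a bounded
  function.\<close>

lemma tendsto_in_prob_approx:
  assumes M: "\<And>n. n \<ge> 1 \<Longrightarrow> prob_space (M n)"
    and Y: "\<And>n. n \<ge> 1 \<Longrightarrow> Y n \<in> borel_measurable (M n)"
    and dom: "\<And>\<epsilon>. \<epsilon> > 0 \<Longrightarrow> \<exists>U u V v. \<exists>\<delta>>0. tendsto_in_prob M U u \<and> tendsto_in_prob M V v \<and>
      (\<forall>n\<ge>1. \<forall>\<omega>\<in>space (M n). \<bar>U n \<omega> - u\<bar> \<le> \<delta> \<longrightarrow> \<bar>V n \<omega> - v\<bar> \<le> \<delta> \<longrightarrow> \<bar>Y n \<omega> - c\<bar> \<le> \<epsilon>)"
  shows "tendsto_in_prob M Y c"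
  unfolding tendsto_in_prob_def
proof (intro conjI allI impI)
  fix n :: nat assume "n \<ge> 1" then show "Y n \<in> borel_measurable (M n)" by (rule Y)
next
  fix \<epsilon> :: real assume "\<epsilon> > 0"
  from dom[OF this] obtain U u V v \<delta> where \<delta>1: "\<delta> > 0"
    and U: "tendsto_in_prob M U u" and V: "tendsto_in_prob M V v"
    and "\<forall>n\<ge>1. \<forall>\<omega>\<in>space (M n).
      \<bar>U n \<omega> - u\<bar> \<le> \<delta> \<longrightarrow> \<bar>V n \<omega> - v\<bar> \<le> \<delta> \<longrightarrow> \<bar>Y n \<omega> - c\<bar> \<le> \<epsilon>"
    by (elim exE conjE)
  then have \<delta>2: "\<bar>Y n \<omega> - c\<bar> \<le> \<epsilon>" if "n \<ge> 1" "\<omega> \<in> space (M n)"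
      "\<bar>U n \<omega> - u\<bar> \<le> \<delta>" "\<bar>V n \<omega> - v\<bar> \<le> \<delta>" for n \<omega>
    using that by simp
  let ?P = "\<lambda>Z z \<epsilon> n. measure (M n) {\<omega> \<in> space (M n). \<bar>Z n \<omega> - z\<bar> > \<epsilon>}"
  have lim: "(\<lambda>n. ?P U u \<delta> n + ?P V v \<delta> n) \<longlonglongrightarrow> 0 + 0"
    using U V \<delta>1 unfolding tendsto_in_prob_def by (intro tendsto_add) auto
  show "?P Y c \<epsilon> \<longlonglongrightarrow> 0"
  proof (rule tendsto_sandwich[of "\<lambda>_. 0" _ _ "\<lambda>n. ?P U u \<delta> n + ?P V v \<delta> n"])
    show "eventually (\<lambda>n. ?P Y c \<epsilon> n \<le> ?P U u \<delta> n + ?P V v \<delta> n) sequentially"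
      using eventually_ge_at_top[of 1]
    proof eventually_elim
      case (elim n)
      interpret prob_space "M n" using M elim by blast
      have Um: "U n \<in> borel_measurable (M n)" and Vm: "V n \<in> borel_measurable (M n)"
        using U V elim by (auto simp: tendsto_in_prob_def)
      have sU: "{\<omega> \<in> space (M n). \<bar>U n \<omega> - u\<bar> > \<delta>} \<in> sets (M n)"
        and sV: "{\<omega> \<in> space (M n). \<bar>V n \<omega> - v\<bar> > \<delta>} \<in> sets (M n)"
        using Um Vm by measurable
      have "?P Y c \<epsilon> n \<le> measure (M n) ({\<omega> \<in> space (M n). \<bar>U n \<omega> - u\<bar> > \<delta>} \<union> {\<omega> \<in> space (M n). \<bar>V n \<omega> - v\<bar> > \<delta>})"
      proof (rule finite_measure_mono)
        show "{\<omega> \<in> space (M n). \<bar>Y n \<omega> - c\<bar> > \<epsilon>}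
            \<subseteq> {\<omega> \<in> space (M n). \<bar>U n \<omega> - u\<bar> > \<delta>} \<union> {\<omega> \<in> space (M n). \<bar>V n \<omega> - v\<bar> > \<delta>}"
        proof (intro subsetI, rule ccontr)
          fix \<omega> assume \<omega>: "\<omega> \<in> {\<omega> \<in> space (M n). \<bar>Y n \<omega> - c\<bar> > \<epsilon>}"
            "\<omega> \<notin> {\<omega> \<in> space (M n). \<bar>U n \<omega> - u\<bar> > \<delta>} \<union> {\<omega> \<in> space (M n). \<bar>V n \<omega> - v\<bar> > \<delta>}"
          then have "\<bar>U n \<omega> - u\<bar> \<le> \<delta>" "\<bar>V n \<omega> - v\<bar> \<le> \<delta>" by auto
          from \<delta>2[OF elim _ this] show False using \<omega>(1) by simp
        qed
      qed (use sU sV in auto)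
      also have "\<dots> \<le> ?P U u \<delta> n + ?P V v \<delta> n"
        by (rule measure_subadditive) (use sU sV in auto)
      finally show ?case .
    qed
  qed (use lim in auto)
qed

lemma tendsto_in_prob_const:
  assumes "\<And>n. n \<ge> 1 \<Longrightarrow> prob_space (M n)"
  shows "tendsto_in_prob M (\<lambda>n \<omega>. c) c"
  by (auto simp: tendsto_in_prob_def)

lemma tendsto_in_prob_add_cmult:
  assumes M: "\<And>n. n \<ge> 1 \<Longrightarrow> prob_space (M n)"
    and U: "tendsto_in_prob M U u" and V: "tendsto_in_prob M V v"
  shows "tendsto_in_prob M (\<lambda>n \<omega>. U n \<omega> + a * V n \<omega>) (u + a * v)"
proof (rule tendsto_in_prob_approx[OF M])
  fix n :: nat assume "n \<ge> 1"
  then show "(\<lambda>\<omega>. U n \<omega> + a * V n \<omega>) \<in> borel_measurable (M n)"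
    using U V unfolding tendsto_in_prob_def by (intro borel_measurable_add borel_measurable_times) auto
next
  fix \<epsilon> :: real assume \<epsilon>: "\<epsilon> > 0"
  let ?\<delta> = "\<epsilon> / (1 + \<bar>a\<bar>)"
  have "\<bar>x + a * y - (u + a * v)\<bar> \<le> \<epsilon>" if "\<bar>x - u\<bar> \<le> ?\<delta>" "\<bar>y - v\<bar> \<le> ?\<delta>" for x y
  proof -
    have "\<bar>x + a * y - (u + a * v)\<bar> = \<bar>(x - u) + a * (y - v)\<bar>" by (simp add: algebra_simps)
    also have "\<dots> \<le> \<bar>x - u\<bar> + \<bar>a\<bar> * \<bar>y - v\<bar>" by (metis abs_mult abs_triangle_ineq)
    also have "\<dots> \<le> ?\<delta> + \<bar>a\<bar> * ?\<delta>" using that by (intro add_mono mult_left_mono) auto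
    also have "\<dots> = (1 + \<bar>a\<bar>) * ?\<delta>" by (simp only: distrib_right mult_1_left)
    also have "\<dots> = \<epsilon>" by (simp add: add_pos_nonneg less_imp_neq[symmetric])
    finally show ?thesis .
  qed
  moreover have "?\<delta> > 0" using \<epsilon> by (simp add: add_pos_nonneg)
  ultimately show "\<exists>U' u' V' v'. \<exists>\<delta>>0. tendsto_in_prob M U' u' \<and> tendsto_in_prob M V' v' \<and>
      (\<forall>n\<ge>1. \<forall>\<omega>\<in>space (M n). \<bar>U' n \<omega> - u'\<bar> \<le> \<delta> \<longrightarrow> \<bar>V' n \<omega> - v'\<bar> \<le> \<delta> \<longrightarrow>
        \<bar>U n \<omega> + a * V n \<omega> - (u + a * v)\<bar> \<le> \<epsilon>)"
    by (intro exI[of _ U] exI[of _ u] exI[of _ V] exI[of _ v] exI[of _ ?\<delta>]) (simp add: U V)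
qed

lemma tendsto_in_prob_sum:
  assumes M: "\<And>n. n \<ge> 1 \<Longrightarrow> prob_space (M n)"
    and U: "\<And>k. k < N \<Longrightarrow> tendsto_in_prob M (U k) (u k)"
  shows "tendsto_in_prob M (\<lambda>n \<omega>. \<Sum>k<N::nat. c k * U k n \<omega>) (\<Sum>k<N. c k * u k)"
  using U
proof (induction N)
  case 0 show ?case using tendsto_in_prob_const[OF M, where c = 0] by simp
next
  case (Suc N)
  have "tendsto_in_prob M (\<lambda>n \<omega>. (\<Sum>k<N. c k * U k n \<omega>) + c N * U N n \<omega>) ((\<Sum>k<N. c k * u k) + c N * u N)"
    using Suc by (intro tendsto_in_prob_add_cmult[OF M]) auto
  then show ?case by simp
qed

section \<open>The spectral measure in the direction of the spike\<close>

text \<open>Product measures are determined on rectangles, where independence factorises. Z comes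
  first in the pair so that Fubini can freeze the direction v and integrate over the matrix.\<close>

lemma indep_rv_distr_pair:
  assumes M: "prob_space M" and ind: "indep_rv M S Y T Z"
  shows "distr M (T \<Otimes>\<^sub>M S) (\<lambda>\<omega>. (Z \<omega>, Y \<omega>)) = distr M T Z \<Otimes>\<^sub>M distr M S Y"
proof -
  interpret prob_space M by fact
  have Y: "Y \<in> measurable M S" and Z: "Z \<in> measurable M T"
    and ind': "indep_set {Y -` B \<inter> space M | B. B \<in> sets S} {Z -` B \<inter> space M | B. B \<in> sets T}"
    using ind by (auto simp: indep_rv_def)
  interpret PY: prob_space "distr M S Y" using Y by (rule prob_space_distr)
  interpret PZ: prob_space "distr M T Z" using Z by (rule prob_space_distr)
  show ?thesis
  proof (rule pair_measure_eqI[symmetric])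
    show "sets (distr M T Z \<Otimes>\<^sub>M distr M S Y) = sets (distr M (T \<Otimes>\<^sub>M S) (\<lambda>\<omega>. (Z \<omega>, Y \<omega>)))"
      by (simp cong: sets_pair_measure_cong)
    fix A B assume "A \<in> sets (distr M T Z)" "B \<in> sets (distr M S Y)"
    then have A: "A \<in> sets T" and B: "B \<in> sets S" by auto
    have "prob ((Y -` B \<inter> space M) \<inter> (Z -` A \<inter> space M)) = prob (Y -` B \<inter> space M) * prob (Z -` A \<inter> space M)"
      using A B by (intro indep_setD[OF ind']) auto
    moreover have "(\<lambda>\<omega>. (Z \<omega>, Y \<omega>)) -` (A \<times> B) \<inter> space M = (Y -` B \<inter> space M) \<inter> (Z -` A \<inter> space M)"
      by auto
    ultimately show "emeasure (distr M T Z) A * emeasure (distr M S Y) B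
        = emeasure (distr M (T \<Otimes>\<^sub>M S) (\<lambda>\<omega>. (Z \<omega>, Y \<omega>))) (A \<times> B)"
      using A B Y Z by (simp add: emeasure_distr emeasure_eq_measure ennreal_mult'' mult.commute)
  qed (rule PZ.sigma_finite_measure_axioms PY.sigma_finite_measure_axioms)+
qed

section \<open>Quadratic forms of a random matrix at a random vector\<close>

lemma measurable_borel_mat:
  assumes "i < n" "j < n" shows "(\<lambda>A. index_mat A (i, j)) \<in> borel_measurable (borel_mat n)"
proof -
  let ?S = "{..<n} \<times> {..<n}"
  have "(\<lambda>A. \<lambda>ij\<in>?S. index_mat A ij) \<in> measurable (borel_mat n) (PiM ?S (\<lambda>_. borel))"
    unfolding borel_mat_def by (rule measurable_vimage_algebra1) (auto simp: space_PiM)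
  moreover have "(\<lambda>x. x (i, j)) \<in> measurable (PiM ?S (\<lambda>_. borel)) borel"
    using assms by (intro measurable_component_singleton) auto
  ultimately have "(\<lambda>A. (\<lambda>ij\<in>?S. index_mat A ij) (i, j)) \<in> borel_measurable (borel_mat n)"
    by (rule measurable_compose)
  then show ?thesis using assms by simp
qed

lemma measurable_borel_vec:
  assumes "i < n" shows "(\<lambda>x. vec_index x i) \<in> borel_measurable (borel_vec n)"
proof -
  have "(\<lambda>x. \<lambda>i\<in>{..<n}. vec_index x i) \<in> measurable (borel_vec n) (PiM {..<n} (\<lambda>_. borel))"
    unfolding borel_vec_def by (rule measurable_vimage_algebra1) (auto simp: space_PiM)
  moreover have "(\<lambda>x. x i) \<in> measurable (PiM {..<n} (\<lambda>_. borel)) borel"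
    using assms by (intro measurable_component_singleton) auto
  ultimately have "(\<lambda>x. (\<lambda>i\<in>{..<n}. vec_index x i) i) \<in> borel_measurable (borel_vec n)"
    by (rule measurable_compose)
  then show ?thesis using assms by simp
qed

lemma measurable_res_quad:
  assumes h: "\<And>i j. i < n \<Longrightarrow> j < n \<Longrightarrow> (\<lambda>\<omega>. h \<omega> i j) \<in> borel_measurable M"
    and v: "\<And>i. i < n \<Longrightarrow> (\<lambda>\<omega>. v \<omega> i) \<in> borel_measurable M"
  shows "(\<lambda>\<omega>. res_quad n z (h \<omega>) (v \<omega>)) \<in> borel_measurable M"
proof -
  have v': "(\<lambda>\<omega>. complex_of_real (v \<omega> i)) \<in> borel_measurable M" if "i < n" for i
    using v[OF that] by measurable
  show ?thesis
    unfolding res_quad_def res_vec_def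
    by (intro borel_measurable_sum borel_measurable_times measurable_resolvent[OF h] v') auto
qed

text \<open>Only indices below n are read, so \<open>scaled\<close> and \<open>sym_of\<close>, which
  may differ elsewhere, become interchangeable.\<close>

lemma res_quad_cong:
  assumes "\<And>i j. i < n \<Longrightarrow> j < n \<Longrightarrow> h i j = h' i j" and "\<And>i. i < n \<Longrightarrow> v i = v' i"
  shows "res_quad n z h v = res_quad n z h' v'"
proof -
  have "shifted_mat n z h = shifted_mat n z h'"
    using assms(1) by (intro eq_matI) (auto simp: shifted_mat_def)
  then show ?thesis using assms(2) by (simp add: res_quad_def res_vec_def resolvent_def)
qed

lemma integral_spectral_measure:
  fixes f :: "real \<Rightarrow> 'b :: {banach, second_countable_topology}"
  assumes "f \<in> borel_measurable borel"
  shows "(\<integral>x. f x \<partial>spectral_measure n ls fs v) = (\<Sum>k<n. (scalar_prod (fs k) v)\<^sup>2 *\<^sub>R f (ls k))"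
  unfolding spectral_measure_def using assms
  by (subst integral_distr)
     (auto simp: measurable_def sets_point_measure space_point_measure
       lebesgue_integral_point_measure_finite)

lemma Im_inverse_cauchy: "Im (1 / (of_real x - Complex t e)) = cauchy_kernel e (x - t)"
  by (simp add: cauchy_kernel_def Im_divide power2_eq_square add.commute)

locale spiked_wigner =
  fixes M :: "nat \<Rightarrow> 'a measure"
    and P :: "'b measure" and \<xi> :: "'b \<Rightarrow> real"
    and X A :: "nat \<Rightarrow> 'a \<Rightarrow> real Matrix.mat"
    and v :: "nat \<Rightarrow> 'a \<Rightarrow> real Matrix.vec"
    and \<theta> :: real
    and ls :: "nat \<Rightarrow> 'a \<Rightarrow> nat \<Rightarrow> real"
    and \<phi> :: "nat \<Rightarrow> 'a \<Rightarrow> nat \<Rightarrow> real Matrix.vec"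
  assumes prob_P: "prob_space P"
    and meas_xi: "\<xi> \<in> borel_measurable P"
    and moments_xi: "\<And>k :: nat. integrable P (\<lambda>\<omega>. \<xi> \<omega> ^ k)"
    and mean_xi: "(\<integral>\<omega>. \<xi> \<omega> \<partial>P) = 0"
    and var_xi: "(\<integral>\<omega>. (\<xi> \<omega>)\<^sup>2 \<partial>P) = 1"
    and prob_M: "\<And>n. n \<ge> 1 \<Longrightarrow> prob_space (M n)"
    and X_sym: "\<And>n \<omega>. n \<ge> 1 \<Longrightarrow> \<omega> \<in> space (M n) \<Longrightarrow>
           X n \<omega> \<in> carrier_mat n n \<and> transpose_mat (X n \<omega>) = X n \<omega>"
    and X_indep: "\<And>n. n \<ge> 1 \<Longrightarrow>
           prob_space.indep_vars (M n) (\<lambda>_. borel) (\<lambda>ij \<omega>. index_mat (X n \<omega>) ij)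
             {(i, j). i \<le> j \<and> j < n}"
    and X_distr: "\<And>n i j. i \<le> j \<Longrightarrow> j < n \<Longrightarrow>
           distr (M n) borel (\<lambda>\<omega>. index_mat (X n \<omega>) (i, j)) = distr P borel \<xi>"
    and A_spike: "\<And>n \<omega>. n \<ge> 1 \<Longrightarrow> \<omega> \<in> space (M n) \<Longrightarrow>
           A n \<omega> \<in> carrier_mat n n \<and> transpose_mat (A n \<omega>) = A n \<omega> \<and>
           char_poly (A n \<omega>) = [:- \<theta>, 1:] * [:0, 1:] ^ (n - 1)"
    and v_unit: "\<And>n \<omega>. n \<ge> 1 \<Longrightarrow> \<omega> \<in> space (M n) \<Longrightarrow>
           v n \<omega> \<in> carrier_vec n \<and> scalar_prod (v n \<omega>) (v n \<omega>) = 1 \<and>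
           eigenvector (A n \<omega>) (v n \<omega>) \<theta>"
    and X_v_indep: "\<And>n. n \<ge> 1 \<Longrightarrow>
           indep_rv (M n) (borel_mat n) (X n) (borel_vec n) (v n)"
    and eigenbasis: "\<And>n \<omega>. n \<ge> 1 \<Longrightarrow> \<omega> \<in> space (M n) \<Longrightarrow>
           ordered_eigenbasis n ((1 / sqrt (real n)) \<cdot>\<^sub>m X n \<omega> + A n \<omega>) (ls n \<omega>) (\<phi> n \<omega>)"
begin

text \<open>The moments of the variable are moments of its law, so every estimate on the product
  space applies with D the common law of the entries.\<close>

sublocale entry_law "distr P borel \<xi>"
proof -
  interpret P: prob_space P by (rule prob_P)
  interpret D: prob_space "distr P borel \<xi>" using meas_xi by (rule P.prob_space_distr)
  show "entry_law (distr P borel \<xi>)"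
    using moments_xi mean_xi var_xi meas_xi
    by unfold_locales (auto simp: integrable_distr_eq integral_distr)
qed

definition scaled :: "nat \<Rightarrow> real Matrix.mat \<Rightarrow> nat \<Rightarrow> nat \<Rightarrow> real" where
  "scaled n B i j = index_mat B (i, j) / sqrt (real n)"

definition noise_form :: "nat \<Rightarrow> complex \<Rightarrow> 'a \<Rightarrow> complex" where
  "noise_form n z \<omega> = res_quad n z (scaled n (X n \<omega>)) (vec_index (v n \<omega>))"

definition spec_int :: "nat \<Rightarrow> 'a \<Rightarrow> (real \<Rightarrow> real) \<Rightarrow> real" where
  "spec_int n \<omega> f = (\<integral>x. f x \<partial>spectral_measure n (ls n \<omega>) (\<phi> n \<omega>) (v n \<omega>))"

abbreviation wt :: "nat \<Rightarrow> 'a \<Rightarrow> nat \<Rightarrow> real" where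
  "wt n \<omega> k \<equiv> (scalar_prod (\<phi> n \<omega> k) (v n \<omega>))\<^sup>2"

lemma X_symD:
  assumes "n \<ge> 1" "\<omega> \<in> space (M n)" "i < n" "j < n"
  shows "index_mat (X n \<omega>) (i, j) = index_mat (X n \<omega>) (j, i)"
proof -
  have c: "X n \<omega> \<in> carrier_mat n n" and t: "transpose_mat (X n \<omega>) = X n \<omega>"
    using X_sym[OF assms(1,2)] by auto
  have "index_mat (transpose_mat (X n \<omega>)) (i, j) = index_mat (X n \<omega>) (j, i)"
    using c assms(3,4) by simp
  then show ?thesis by (simp add: t)
qed

lemma sym_scaled:
  assumes "n \<ge> 1" "\<omega> \<in> space (M n)" shows "sym_on n (scaled n (X n \<omega>))"
  using X_symD[OF assms] by (simp add: sym_on_def scaled_def)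

lemma v_norm:
  assumes "n \<ge> 1" "\<omega> \<in> space (M n)" shows "(\<Sum>i<n. (vec_index (v n \<omega>) i)\<^sup>2) = 1"
  using v_unit[OF assms] by (auto simp: scalar_prod_def atLeast0LessThan power2_eq_square)

text \<open>\<open>rank_one_of_char_poly\<close> identifies W as scaled noise plus theta v v^T.
  Orthonormality of n eigenvectors reads F F^T = 1, which for a square F gives the completeness
  relation F^T F = 1.\<close>

lemma eigenbasis_sums:
  assumes n: "n \<ge> 1" and \<omega>: "\<omega> \<in> space (M n)"
  defines "f \<equiv> \<lambda>k i. vec_index (\<phi> n \<omega> k) i"
  shows "\<And>k i. k < n \<Longrightarrow> i < n \<Longrightarrow>
      (\<Sum>j<n. (scaled n (X n \<omega>) i j + \<theta> * vec_index (v n \<omega>) i * vec_index (v n \<omega>) j) * f k j) = ls n \<omega> k * f k i"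
    and "\<And>i j. i < n \<Longrightarrow> j < n \<Longrightarrow> (\<Sum>k<n. f k i * f k j) = (if i = j then 1 else 0)"
    and "\<And>k. k < n \<Longrightarrow> scalar_prod (\<phi> n \<omega> k) (v n \<omega>) = (\<Sum>i<n. f k i * vec_index (v n \<omega>) i)"
proof -
  let ?W = "(1 / sqrt (real n)) \<cdot>\<^sub>m X n \<omega> + A n \<omega>"
  note Ac = A_spike[OF n \<omega>] and vc = v_unit[OF n \<omega>] and Xc = X_sym[OF n \<omega>]
  have fc: "\<phi> n \<omega> k \<in> carrier_vec n" and ev: "eigenvector ?W (\<phi> n \<omega> k) (ls n \<omega> k)" if "k < n" for k
    using eigenbasis[OF n \<omega>] that by (auto simp: ordered_eigenbasis_def)
  have on: "scalar_prod (\<phi> n \<omega> k) (\<phi> n \<omega> l) = (if k = l then 1 else 0)" if "k < n" "l < n" for k l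
    using eigenbasis[OF n \<omega>] that by (auto simp: ordered_eigenbasis_def)
  have W: "index_mat ?W (i, j) = scaled n (X n \<omega>) i j + \<theta> * vec_index (v n \<omega>) i * vec_index (v n \<omega>) j"
    if "i < n" "j < n" for i j
    using rank_one_of_char_poly[of "A n \<omega>" n \<theta> "v n \<omega>" i j] Ac vc n that
      carrier_matD[OF conjunct1[OF Ac]] carrier_matD[OF conjunct1[OF Xc]] by (simp add: scaled_def)
  show "(\<Sum>j<n. (scaled n (X n \<omega>) i j + \<theta> * vec_index (v n \<omega>) i * vec_index (v n \<omega>) j) * f k j) = ls n \<omega> k * f k i"
    if k: "k < n" and i: "i < n" for k i
  proof -
    have "vec_index (?W *\<^sub>v \<phi> n \<omega> k) i = vec_index (ls n \<omega> k \<cdot>\<^sub>v \<phi> n \<omega> k) i"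
      using ev[OF k] by (simp add: eigenvector_def)
    moreover have "vec_index (?W *\<^sub>v \<phi> n \<omega> k) i = (\<Sum>j<n. index_mat ?W (i, j) * f k j)"
      using Ac Xc fc[OF k] i by (auto simp: scalar_prod_def atLeast0LessThan f_def intro!: sum.cong)
    moreover have "vec_index (ls n \<omega> k \<cdot>\<^sub>v \<phi> n \<omega> k) i = ls n \<omega> k * f k i"
      using fc[OF k] i by (simp add: f_def)
    ultimately show ?thesis using W[OF i] by simp
  qed
  define F where "F = Matrix.mat n n (\<lambda>(k, i). f k i)"
  have F: "F \<in> carrier_mat n n" by (simp add: F_def)
  have "F * transpose_mat F = 1\<^sub>m n"
  proof (rule eq_matI)
    fix k l assume "k < dim_row (1\<^sub>m n :: real Matrix.mat)" "l < dim_col (1\<^sub>m n :: real Matrix.mat)"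
    then have kl: "k < n" "l < n" by auto
    have "index_mat (F * transpose_mat F) (k, l) = scalar_prod (\<phi> n \<omega> k) (\<phi> n \<omega> l)"
      using kl carrier_vecD[OF fc[OF kl(1)]] carrier_vecD[OF fc[OF kl(2)]]
      by (simp add: F_def f_def scalar_prod_def)
    then show "index_mat (F * transpose_mat F) (k, l) = index_mat (1\<^sub>m n) (k, l)"
      using on kl by simp
  qed (auto simp: F_def)
  then have FF: "transpose_mat F * F = 1\<^sub>m n"
    using mat_mult_left_right_inverse[of F n "transpose_mat F"] F by simp
  show "(\<Sum>k<n. f k i * f k j) = (if i = j then 1 else 0)" if "i < n" "j < n" for i j
  proof -
    have "index_mat (transpose_mat F * F) (i, j) = (\<Sum>k<n. f k i * f k j)"
      using that by (simp add: F_def scalar_prod_def atLeast0LessThan)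
    then show ?thesis using that by (simp add: FF)
  qed
  show "scalar_prod (\<phi> n \<omega> k) (v n \<omega>) = (\<Sum>i<n. f k i * vec_index (v n \<omega>) i)" if "k < n" for k
    using vc by (auto simp: scalar_prod_def f_def atLeast0LessThan)
qed

text \<open>Parseval's identity for the unit vector v: the spectral measure has mass 1.\<close>

lemma spectral_weights:
  assumes n: "n \<ge> 1" and \<omega>: "\<omega> \<in> space (M n)"
  shows "(\<Sum>k<n. wt n \<omega> k) = 1"
proof -
  let ?f = "\<lambda>k i. vec_index (\<phi> n \<omega> k) i" and ?v = "vec_index (v n \<omega>)"
  have "(\<Sum>k<n. wt n \<omega> k)
      = (\<Sum>k<n. \<Sum>i<n. \<Sum>j<n. ?v i * ?v j * (?f k i * ?f k j))"
    using eigenbasis_sums(3)[OF n \<omega>] by (simp add: power2_eq_square sum_product mult_ac)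
  also have "\<dots> = (\<Sum>i<n. \<Sum>k<n. \<Sum>j<n. ?v i * ?v j * (?f k i * ?f k j))" by (rule sum.swap)
  also have "\<dots> = (\<Sum>i<n. \<Sum>j<n. \<Sum>k<n. ?v i * ?v j * (?f k i * ?f k j))"
    by (rule sum.cong[OF refl], rule sum.swap)
  also have "\<dots> = (\<Sum>i<n. \<Sum>j<n. ?v i * ?v j * (if i = j then 1 else 0))"
    using eigenbasis_sums(2)[OF n \<omega>] by (intro sum.cong refl) (simp flip: sum_distrib_left)
  also have "\<dots> = (\<Sum>i<n. (?v i)\<^sup>2)"
    by (intro sum.cong refl) (simp add: if_distrib power2_eq_square cong: if_cong)
  finally show ?thesis using v_norm[OF n \<omega>] by simp
qed

lemma spec_int_eq:
  assumes "f \<in> borel_measurable borel"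
  shows "spec_int n \<omega> f = (\<Sum>k<n. wt n \<omega> k * f (ls n \<omega> k))"
  using assms by (simp add: spec_int_def integral_spectral_measure)

lemma spec_int_diff_le:
  assumes n: "n \<ge> 1" and \<omega>: "\<omega> \<in> space (M n)"
    and f: "f \<in> borel_measurable borel" and g: "g \<in> borel_measurable borel"
    and fg: "\<And>x. \<bar>f x - g x\<bar> \<le> u x" and u: "u \<in> borel_measurable borel"
  shows "\<bar>spec_int n \<omega> f - spec_int n \<omega> g\<bar> \<le> spec_int n \<omega> u"
proof -
  let ?c = "\<lambda>k. wt n \<omega> k"
  have "spec_int n \<omega> f - spec_int n \<omega> g = (\<Sum>k<n. ?c k * (f (ls n \<omega> k) - g (ls n \<omega> k)))"
    using f g by (simp add: spec_int_eq sum_subtractf right_diff_distrib)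
  also have "\<bar>\<dots>\<bar> \<le> (\<Sum>k<n. ?c k * u (ls n \<omega> k))"
    using fg by (intro order_trans[OF sum_abs] sum_mono) (simp add: abs_mult mult_left_mono)
  finally show ?thesis using u by (simp add: spec_int_eq)
qed

lemma spec_int_const:
  assumes "n \<ge> 1" "\<omega> \<in> space (M n)" shows "spec_int n \<omega> (\<lambda>x. c) = c"
  using spectral_weights[OF assms] by (simp add: spec_int_eq flip: sum_distrib_right)

text \<open>Q is the Stieltjes transform of the spectral measure, and
  \<open>res_quad_rank_one\<close> links it to the noise. Only Im Q is expressed by
  \<open>spec_int\<close>, which takes real integrands; it integrates a Cauchy kernel.\<close>

lemma spec_stieltjes:
  assumes n: "n \<ge> 1" and \<omega>: "\<omega> \<in> space (M n)" and z: "Im z > 0"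
  obtains Q where "noise_form n z \<omega> = (1 + of_real \<theta> * noise_form n z \<omega>) * Q" "cmod Q \<le> 1 / Im z"
    "Im Q = spec_int n \<omega> (\<lambda>x. Im (1 / (of_real x - z)))"
proof
  let ?f = "\<lambda>k i. vec_index (\<phi> n \<omega> k) i"
  let ?Q = "\<Sum>k<n. of_real (wt n \<omega> k) / (of_real (ls n \<omega> k) - z)"
  have "noise_form n z \<omega> = (1 + of_real \<theta> * noise_form n z \<omega>) *
      (\<Sum>k<n. of_real ((\<Sum>i<n. ?f k i * vec_index (v n \<omega>) i)\<^sup>2) / (of_real (ls n \<omega> k) - z))"
    unfolding noise_form_def
    by (rule res_quad_rank_one[OF sym_scaled[OF n \<omega>] z v_norm[OF n \<omega>]
        eigenbasis_sums(1)[OF n \<omega>] eigenbasis_sums(2)[OF n \<omega>]])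
  also have "(\<Sum>k<n. of_real ((\<Sum>i<n. ?f k i * vec_index (v n \<omega>) i)\<^sup>2) / (of_real (ls n \<omega> k) - z)) = ?Q"
    using eigenbasis_sums(3)[OF n \<omega>] by (intro sum.cong refl) simp
  finally show "noise_form n z \<omega> = (1 + of_real \<theta> * noise_form n z \<omega>) * ?Q" .
  have "cmod ?Q \<le> (\<Sum>k<n. wt n \<omega> k * (1 / Im z))"
  proof (intro order_trans[OF norm_sum] sum_mono)
    fix k
    have "cmod (of_real (wt n \<omega> k) / (of_real (ls n \<omega> k) - z))
        = wt n \<omega> k * cmod (1 / (of_real (ls n \<omega> k) - z))"
      by (simp add: norm_divide norm_power)
    also have "\<dots> \<le> wt n \<omega> k * (1 / Im z)"
      by (intro mult_left_mono cauchy_transform_bound z) simp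
    finally show "cmod (of_real (wt n \<omega> k) / (of_real (ls n \<omega> k) - z))
        \<le> wt n \<omega> k * (1 / Im z)" .
  qed
  then show "cmod ?Q \<le> 1 / Im z"
    using spectral_weights[OF n \<omega>] by (simp add: flip: sum_distrib_right sum_divide_distrib)
  have m: "(\<lambda>x. Im (1 / (of_real x - z))) \<in> borel_measurable borel" by measurable
  have "Im (of_real c / w) = c * Im (1 / w)" for c w
  proof -
    have "Im (of_real c * u) = c * Im u" for u by simp
    from this[of "1 / w"] show ?thesis by simp
  qed
  then show "Im ?Q = spec_int n \<omega> (\<lambda>x. Im (1 / (of_real x - z)))"
    unfolding spec_int_eq[OF m] Im_sum by (intro sum.cong refl)
qed

section \<open>Transfer of the estimates to the random matrices\<close>

lemma measurable_noise_form:
  assumes n: "n \<ge> 1" shows "noise_form n z \<in> borel_measurable (M n)"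
proof -
  have X: "X n \<in> measurable (M n) (borel_mat n)" and v: "v n \<in> measurable (M n) (borel_vec n)"
    using X_v_indep[OF n] by (auto simp: indep_rv_def)
  show ?thesis
    unfolding noise_form_def[abs_def] scaled_def
    using measurable_compose[OF X measurable_borel_mat] measurable_compose[OF v measurable_borel_vec]
    by (intro measurable_res_quad borel_measurable_divide borel_measurable_const) auto
qed

text \<open>Independence and equality in law of the entries on and above the diagonal say that their
  joint law is the product measure.\<close>

lemma distr_entries:
  assumes n: "n \<ge> 1"
  shows "distr (M n) (PiM (upper_idx n) (\<lambda>_. borel)) (\<lambda>\<omega>. \<lambda>ij\<in>upper_idx n. index_mat (X n \<omega>) ij) = entry_space n"
    and "(\<lambda>\<omega>. \<lambda>ij\<in>upper_idx n. index_mat (X n \<omega>) ij) \<in> measurable (M n) (PiM (upper_idx n) (\<lambda>_. borel))"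
proof -
  interpret Mn: prob_space "M n" using prob_M n by blast
  have rv: "Mn.random_variable borel (\<lambda>\<omega>. index_mat (X n \<omega>) ij)" if "ij \<in> upper_idx n" for ij
    using X_indep[OF n] that by (auto simp: Mn.indep_vars_def upper_idx_def)
  show "(\<lambda>\<omega>. \<lambda>ij\<in>upper_idx n. index_mat (X n \<omega>) ij) \<in> measurable (M n) (PiM (upper_idx n) (\<lambda>_. borel))"
    using rv by (intro measurable_restrict)
  have ne: "upper_idx n \<noteq> {}" using edge_in_upper_idx[of 0 n 0] n by auto
  have "distr (M n) (PiM (upper_idx n) (\<lambda>_. borel)) (\<lambda>\<omega>. \<lambda>ij\<in>upper_idx n. index_mat (X n \<omega>) ij)
      = PiM (upper_idx n) (\<lambda>ij. distr (M n) borel (\<lambda>\<omega>. index_mat (X n \<omega>) ij))"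
    using Mn.indep_vars_iff_distr_eq_PiM'[OF ne rv] X_indep[OF n] by (simp add: upper_idx_def)
  also have "\<dots> = entry_space n"
    unfolding entry_space_def by (intro PiM_cong refl) (auto simp: upper_idx_def X_distr)
  finally show "distr (M n) (PiM (upper_idx n) (\<lambda>_. borel)) (\<lambda>\<omega>. \<lambda>ij\<in>upper_idx n. index_mat (X n \<omega>) ij) = entry_space n" .
qed

text \<open>By independence and Tonelli, v can be frozen: the inner integral over X_n is an
  expectation over \<open>entry_space\<close>, bounded by the same c for every unit vector.
  Nonnegative integrals avoid a separate proof that the joint function is integrable.\<close>

lemma nn_integral_noise_form:
  assumes n: "n \<ge> 1" and C: "\<And>w. (\<Sum>i<n. (w i)\<^sup>2) = 1 \<Longrightarrow>
      (\<integral>x. (cmod (res_quad n z (sym_of n x) w - s))\<^sup>2 \<partial>entry_space n) \<le> c"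
    and z: "Im z > 0"
  shows "(\<integral>\<^sup>+\<omega>. ennreal ((cmod (noise_form n z \<omega> - s))\<^sup>2) \<partial>M n) \<le> ennreal c"
proof -
  interpret Mn: prob_space "M n" using prob_M n by blast
  have X: "X n \<in> measurable (M n) (borel_mat n)" and v: "v n \<in> measurable (M n) (borel_vec n)"
    using X_v_indep[OF n] by (auto simp: indep_rv_def)
  define F where "F = (\<lambda>(w, B). ennreal ((cmod (res_quad n z (scaled n B) (vec_index w) - s))\<^sup>2))"
  have Fm: "F \<in> borel_measurable (borel_vec n \<Otimes>\<^sub>M borel_mat n)"
  proof -
    have "(\<lambda>p. res_quad n z (scaled n (snd p)) (vec_index (fst p))) \<in> borel_measurable (borel_vec n \<Otimes>\<^sub>M borel_mat n)"
      unfolding scaled_def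
      using measurable_compose[OF measurable_snd measurable_borel_mat]
        measurable_compose[OF measurable_fst measurable_borel_vec]
      by (intro measurable_res_quad borel_measurable_divide borel_measurable_const) auto
    then show ?thesis unfolding F_def split_beta' by measurable
  qed
  interpret DX: prob_space "distr (M n) (borel_mat n) (X n)" using X by (rule Mn.prob_space_distr)
  have inner: "(\<integral>\<^sup>+\<omega>'. F (v n \<omega>, X n \<omega>') \<partial>M n) \<le> ennreal c" if \<omega>: "\<omega> \<in> space (M n)" for \<omega>
  proof -
    let ?w = "vec_index (v n \<omega>)"
    let ?x = "\<lambda>\<omega>. \<lambda>ij\<in>upper_idx n. index_mat (X n \<omega>) ij"
    let ?g = "\<lambda>x. (cmod (res_quad n z (sym_of n x) ?w - s))\<^sup>2"
    have gm: "?g \<in> borel_measurable (entry_space n)"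
      using measurable_entry_space_res_quad by measurable
    have "F (v n \<omega>, X n \<omega>') = ennreal (?g (?x \<omega>'))" if \<omega>': "\<omega>' \<in> space (M n)" for \<omega>'
    proof -
      \<comment> \<open>Symmetry of X_n reads the entries below the diagonal from the stored upper
        triangle.\<close>
      have "scaled n (X n \<omega>') i j = sym_of n (?x \<omega>') i j" if "i < n" "j < n" for i j
        using X_symD[OF n \<omega>' that] edge_in_upper_idx[OF that]
        by (auto simp: scaled_def sym_of_def edge_def min_def max_def)
      then have "res_quad n z (scaled n (X n \<omega>')) ?w = res_quad n z (sym_of n (?x \<omega>')) ?w"
        by (rule res_quad_cong) auto
      then show ?thesis by (simp add: F_def)
    qed
    then have "(\<integral>\<^sup>+\<omega>'. F (v n \<omega>, X n \<omega>') \<partial>M n) = (\<integral>\<^sup>+\<omega>'. ennreal (?g (?x \<omega>')) \<partial>M n)"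
      by (rule nn_integral_cong)
    also have "\<dots> = (\<integral>\<^sup>+x. ennreal (?g x) \<partial>entry_space n)"
    proof -
      have "sets (entry_space n) = sets (PiM (upper_idx n) (\<lambda>_. borel))"
        using distr_entries(1)[OF n] by (metis sets_distr)
      then have "?g \<in> borel_measurable (PiM (upper_idx n) (\<lambda>_. borel))"
        using gm measurable_cong_sets by blast
      then show ?thesis
        unfolding distr_entries(1)[OF n, symmetric]
        using distr_entries(2)[OF n] by (subst nn_integral_distr) auto
    qed
    also have "\<dots> = ennreal (\<integral>x. ?g x \<partial>entry_space n)"
    proof (rule nn_integral_eq_integral)
      have "cmod (res_quad n z (sym_of n x) ?w - s) \<le> 1 / Im z + cmod s" for x
        using res_quad_bound[OF sym_on_sym_of z v_norm[OF n \<omega>], of x]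
          norm_triangle_ineq4[of "res_quad n z (sym_of n x) ?w" s] by linarith
      then show "integrable (entry_space n) ?g"
        by (intro L2_integrable(2) borel_measurable_diff measurable_entry_space_res_quad borel_measurable_const)
    qed simp
    also have "\<dots> \<le> ennreal c"
      using C[OF v_norm[OF n \<omega>]] by (rule ennreal_leI)
    finally show ?thesis .
  qed
  have "(\<integral>\<^sup>+\<omega>. ennreal ((cmod (noise_form n z \<omega> - s))\<^sup>2) \<partial>M n) = (\<integral>\<^sup>+\<omega>. F (v n \<omega>, X n \<omega>) \<partial>M n)"
    by (simp add: F_def noise_form_def)
  also have "\<dots> = (\<integral>\<^sup>+p. F p \<partial>distr (M n) (borel_vec n \<Otimes>\<^sub>M borel_mat n) (\<lambda>\<omega>. (v n \<omega>, X n \<omega>)))"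
    using Fm X v by (subst nn_integral_distr) auto
  also have "\<dots> = (\<integral>\<^sup>+p. F p \<partial>(distr (M n) (borel_vec n) (v n) \<Otimes>\<^sub>M distr (M n) (borel_mat n) (X n)))"
    by (simp add: indep_rv_distr_pair[OF Mn.prob_space_axioms X_v_indep[OF n]])
  also have "\<dots> = (\<integral>\<^sup>+w. \<integral>\<^sup>+B. F (w, B) \<partial>distr (M n) (borel_mat n) (X n) \<partial>distr (M n) (borel_vec n) (v n))"
    using Fm by (subst DX.nn_integral_fst[symmetric]) (auto cong: measurable_cong_sets sets_pair_measure_cong)
  also have "\<dots> = (\<integral>\<^sup>+\<omega>. \<integral>\<^sup>+B. F (v n \<omega>, B) \<partial>distr (M n) (borel_mat n) (X n) \<partial>M n)"
  proof (rule nn_integral_distr[OF v])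
    show "(\<lambda>w. \<integral>\<^sup>+B. F (w, B) \<partial>distr (M n) (borel_mat n) (X n)) \<in> borel_measurable (distr (M n) (borel_vec n) (v n))"
      using Fm by (intro DX.borel_measurable_nn_integral) (simp add: split_beta' cong: measurable_cong_sets sets_pair_measure_cong)
  qed
  also have "\<dots> = (\<integral>\<^sup>+\<omega>. \<integral>\<^sup>+\<omega>'. F (v n \<omega>, X n \<omega>') \<partial>M n \<partial>M n)"
  proof (rule nn_integral_cong)
    fix \<omega> assume \<omega>: "\<omega> \<in> space (M n)"
    have "(\<lambda>B. F (v n \<omega>, B)) \<in> borel_measurable (borel_mat n)"
      using measurable_Pair2[OF Fm measurable_space[OF v \<omega>]] .
    then show "(\<integral>\<^sup>+B. F (v n \<omega>, B) \<partial>distr (M n) (borel_mat n) (X n)) = (\<integral>\<^sup>+\<omega>'. F (v n \<omega>, X n \<omega>') \<partial>M n)"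
      by (subst nn_integral_distr[OF X]) simp_all
  qed
  also have "\<dots> \<le> (\<integral>\<^sup>+\<omega>. ennreal c \<partial>M n)"
    using inner by (intro nn_integral_mono)
  also have "\<dots> = ennreal c" by (simp add: Mn.emeasure_space_1)
  finally show ?thesis .
qed

text \<open>No lower bound for |1 + theta q| is required: in (Q - L) (1 + theta s) = (q - s) (1 -
  theta Q) the factor Q is bounded by 1 / Im z, and only the deterministic 1 + theta s has to be
  nonzero. Markov's inequality for |q - s|^2 then gives convergence in probability.\<close>

lemma tendsto_spec_cauchy:
  assumes e: "e > 0"
  shows "tendsto_in_prob M (\<lambda>n \<omega>. spec_int n \<omega> (\<lambda>x. cauchy_kernel e (x - t)))
    (\<integral>x. cauchy_kernel e (x - t) \<partial>mu_sc \<theta>)"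
proof -
  define z where "z = Complex t e"
  have z: "Im z > 0" using e by (simp add: z_def)
  obtain s where s: "s\<^sup>2 + z * s + 1 = 0" "Im s > 0" "cmod s < 1"
    using self_energy_root[OF z] .
  obtain C where C: "\<And>n w. n \<ge> 1 \<Longrightarrow> (\<Sum>i<n. (w i)\<^sup>2) = 1 \<Longrightarrow>
      (\<integral>x. (cmod (res_quad n z (sym_of n x) w - s))\<^sup>2 \<partial>entry_space n) \<le> C / sqrt n"
    using quad_L2[OF z s(1,2)] by blast
  define L where "L = s / (1 + of_real \<theta> * s)"
  have nz: "1 + of_real \<theta> * s \<noteq> 0"
  proof
    assume 0: "1 + of_real \<theta> * s = 0"
    then have "Im (1 + of_real \<theta> * s) = 0" by simp
    then have "\<theta> = 0" using s(2) by simp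
    with 0 show False by simp
  qed
  define K where "K = (1 + \<bar>\<theta>\<bar> / Im z) / cmod (1 + of_real \<theta> * s)"
  have K: "K > 0" unfolding K_def using z nz by (intro divide_pos_pos add_pos_nonneg) auto
  have fm: "(\<lambda>x. cauchy_kernel e (x - t)) \<in> borel_measurable borel"
    unfolding cauchy_kernel_def by measurable
  have ImL: "(\<integral>x. cauchy_kernel e (x - t) \<partial>mu_sc \<theta>) = Im L"
  proof -
    interpret mu: prob_space "mu_sc \<theta>" by (rule prob_space_mu_sc)
    have "integrable (mu_sc \<theta>) (\<lambda>x. 1 / (of_real x - z))"
      using cauchy_transform_bound[OF z]
      by (intro mu.integrable_const_bound[where B = "1 / Im z"]) auto
    then have "Im (\<integral>x. 1 / (of_real x - z) \<partial>mu_sc \<theta>) = (\<integral>x. Im (1 / (of_real x - z)) \<partial>mu_sc \<theta>)"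
      by (rule integral_Im[symmetric])
    also have "\<dots> = (\<integral>x. cauchy_kernel e (x - t) \<partial>mu_sc \<theta>)"
      by (simp only: z_def Im_inverse_cauchy)
    finally show ?thesis using stieltjes_mu_sc[OF z s] by (simp add: L_def)
  qed
  have close: "\<bar>spec_int n \<omega> (\<lambda>x. cauchy_kernel e (x - t)) - Im L\<bar> \<le> K * cmod (noise_form n z \<omega> - s)"
    and val: "spec_int n \<omega> (\<lambda>x. cauchy_kernel e (x - t)) = Im (noise_form n z \<omega> / (1 + of_real \<theta> * noise_form n z \<omega>))"
    if n: "n \<ge> 1" and \<omega>: "\<omega> \<in> space (M n)" for n \<omega>
  proof -
    let ?q = "noise_form n z \<omega>"
    obtain Q where Q: "?q = (1 + of_real \<theta> * ?q) * Q" "cmod Q \<le> 1 / Im z"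
      "Im Q = spec_int n \<omega> (\<lambda>x. Im (1 / (of_real x - z)))"
      using spec_stieltjes[OF n \<omega> z] .
    have ImQ: "spec_int n \<omega> (\<lambda>x. cauchy_kernel e (x - t)) = Im Q"
      unfolding Q(3) by (simp only: z_def Im_inverse_cauchy)
    \<comment> \<open>If it vanished, the identity for Q would force q = 0 and hence 1 = 0.\<close>
    have "1 + of_real \<theta> * ?q \<noteq> 0"
    proof
      assume 0: "1 + of_real \<theta> * ?q = 0"
      then have "?q = 0" using Q(1) by simp
      with 0 show False by simp
    qed
    then have "Q = ?q / (1 + of_real \<theta> * ?q)"
      using Q(1) by (metis nonzero_mult_div_cancel_left)
    then show "spec_int n \<omega> (\<lambda>x. cauchy_kernel e (x - t)) = Im (?q / (1 + of_real \<theta> * ?q))"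
      unfolding ImQ by simp
    have "(Q - L) * (1 + of_real \<theta> * s) = Q * (1 + of_real \<theta> * s) - s"
      using nz by (simp add: L_def left_diff_distrib)
    also have "\<dots> = (?q - s) - Q * of_real \<theta> * (?q - s)"
      using Q(1) by (simp add: algebra_simps)
    also have "cmod \<dots> \<le> cmod (?q - s) + (1 / Im z) * \<bar>\<theta>\<bar> * cmod (?q - s)"
      using Q(2) by (intro order_trans[OF norm_triangle_ineq4] add_left_mono)
        (simp only: norm_mult norm_of_real, intro mult_right_mono, auto)
    finally have "cmod ((Q - L) * (1 + of_real \<theta> * s))
        \<le> cmod (?q - s) + (1 / Im z) * \<bar>\<theta>\<bar> * cmod (?q - s)" .
    also have "\<dots> = (1 + \<bar>\<theta>\<bar> / Im z) * cmod (?q - s)" by (simp add: distrib_right)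
    finally have "cmod (Q - L) * cmod (1 + of_real \<theta> * s) \<le> (1 + \<bar>\<theta>\<bar> / Im z) * cmod (?q - s)"
      unfolding norm_mult .
    then have "cmod (Q - L) \<le> K * cmod (?q - s)"
      using nz by (simp add: K_def pos_le_divide_eq)
    moreover have "\<bar>Im Q - Im L\<bar> \<le> cmod (Q - L)" using abs_Im_le_cmod[of "Q - L"] by simp
    ultimately show "\<bar>spec_int n \<omega> (\<lambda>x. cauchy_kernel e (x - t)) - Im L\<bar> \<le> K * cmod (?q - s)"
      unfolding ImQ by linarith
  qed
  show ?thesis
    unfolding tendsto_in_prob_def ImL
  proof (intro conjI allI impI)
    fix n :: nat assume n: "n \<ge> 1"
    \<comment> \<open>Measurability is read off from the formula in q, since eigenvalues and
      eigenvectors are not assumed to be measurable in \<omega>.\<close>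
    have "(\<lambda>\<omega>. Im (noise_form n z \<omega> / (1 + of_real \<theta> * noise_form n z \<omega>))) \<in> borel_measurable (M n)"
      using measurable_noise_form[OF n, of z] by measurable
    then show "(\<lambda>\<omega>. spec_int n \<omega> (\<lambda>x. cauchy_kernel e (x - t))) \<in> borel_measurable (M n)"
      using val[OF n] by (simp cong: measurable_cong)
  next
    fix \<epsilon> :: real assume \<epsilon>: "\<epsilon> > 0"
    let ?P = "\<lambda>n. measure (M n) {\<omega> \<in> space (M n). \<bar>spec_int n \<omega> (\<lambda>x. cauchy_kernel e (x - t)) - Im L\<bar> > \<epsilon>}"
    \<comment> \<open>\<open>max C 0\<close> appears because \<open>quad_L2\<close> gives no sign
      for its constant, while the bound passes through \<open>ennreal\<close>.\<close>
    have bound: "?P n \<le> (K / \<epsilon>)\<^sup>2 * (max C 0 / sqrt (real n))" if n: "n \<ge> 1" for n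
    proof -
      interpret Mn: prob_space "M n" using prob_M n by blast
      let ?u = "\<lambda>\<omega>. ennreal ((cmod (noise_form n z \<omega> - s))\<^sup>2)"
      let ?c = "ennreal ((K / \<epsilon>)\<^sup>2)"
      have um: "?u \<in> borel_measurable (M n)" using measurable_noise_form[OF n, of z] by measurable
      have "emeasure (M n) {\<omega> \<in> space (M n). \<bar>spec_int n \<omega> (\<lambda>x. cauchy_kernel e (x - t)) - Im L\<bar> > \<epsilon>}
          \<le> emeasure (M n) {\<omega> \<in> space (M n). 1 \<le> ?c * ?u \<omega>}"
      proof (rule emeasure_mono)
        show "{\<omega> \<in> space (M n). 1 \<le> ?c * ?u \<omega>} \<in> sets (M n)" using um by measurable
        show "{\<omega> \<in> space (M n). \<bar>spec_int n \<omega> (\<lambda>x. cauchy_kernel e (x - t)) - Im L\<bar> > \<epsilon>}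
            \<subseteq> {\<omega> \<in> space (M n). 1 \<le> ?c * ?u \<omega>}"
        proof safe
          fix \<omega> assume \<omega>: "\<omega> \<in> space (M n)"
            and "\<bar>spec_int n \<omega> (\<lambda>x. cauchy_kernel e (x - t)) - Im L\<bar> > \<epsilon>"
          then have "\<epsilon> \<le> K * cmod (noise_form n z \<omega> - s)" using close[OF n \<omega>] by linarith
          then have "1 \<le> K / \<epsilon> * cmod (noise_form n z \<omega> - s)" using \<epsilon> by (simp add: field_simps)
          then have "1 \<le> (K / \<epsilon> * cmod (noise_form n z \<omega> - s))\<^sup>2" by (rule one_le_power)
          then have "1 \<le> (K / \<epsilon>)\<^sup>2 * (cmod (noise_form n z \<omega> - s))\<^sup>2" by (simp only: power_mult_distrib)
          then show "1 \<le> ?c * ?u \<omega>" by (simp flip: ennreal_mult ennreal_1)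
        qed
      qed
      also have "\<dots> \<le> ?c * (\<integral>\<^sup>+\<omega>. ?u \<omega> * indicator (space (M n)) \<omega> \<partial>M n)"
        using um by (intro nn_integral_Markov_inequality) auto
      also have "(\<integral>\<^sup>+\<omega>. ?u \<omega> * indicator (space (M n)) \<omega> \<partial>M n) = (\<integral>\<^sup>+\<omega>. ?u \<omega> \<partial>M n)"
        by (intro nn_integral_cong) simp
      also have "?c * (\<integral>\<^sup>+\<omega>. ?u \<omega> \<partial>M n) \<le> ?c * ennreal (max C 0 / sqrt (real n))"
      proof (intro mult_left_mono nn_integral_noise_form[OF n _ z])
        fix w :: "nat \<Rightarrow> real" assume "(\<Sum>i<n. (w i)\<^sup>2) = 1"
        from C[OF n this] show "(\<integral>x. (cmod (res_quad n z (sym_of n x) w - s))\<^sup>2 \<partial>entry_space n) \<le> max C 0 / sqrt (real n)"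
          by (rule order_trans) (intro divide_right_mono; simp)
      qed simp
      also have "\<dots> = ennreal ((K / \<epsilon>)\<^sup>2 * (max C 0 / sqrt (real n)))" by (rule ennreal_mult[symmetric]) auto
      finally show ?thesis
        by (simp add: Mn.emeasure_eq_measure)
    qed
    have lim: "(\<lambda>n. (K / \<epsilon>)\<^sup>2 * (max C 0 / sqrt (real n))) \<longlonglongrightarrow> (K / \<epsilon>)\<^sup>2 * 0"
      by (intro tendsto_mult tendsto_const real_tendsto_divide_at_top[OF tendsto_const]
          filterlim_compose[OF sqrt_at_top filterlim_real_sequentially])
    show "?P \<longlonglongrightarrow> 0"
    proof (rule tendsto_sandwich[of "\<lambda>_. 0" _ _ "\<lambda>n. (K / \<epsilon>)\<^sup>2 * (max C 0 / sqrt (real n))"])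
      show "eventually (\<lambda>n. ?P n \<le> (K / \<epsilon>)\<^sup>2 * (max C 0 / sqrt (real n))) sequentially"
        using eventually_ge_at_top[of 1] by eventually_elim (rule bound)
    qed (use lim in auto)
  qed
qed

text \<open>An approximation within \<delta>, uniform on the line, changes both integrals by at most
  \<delta>, because both measures have mass 1.\<close>

lemma tendsto_spec_compact_support:
  assumes g: "continuous_on UNIV g" and supp: "\<And>x. \<bar>x\<bar> \<ge> R \<Longrightarrow> g x = 0" and R: "R > 0"
  shows "tendsto_in_prob M (\<lambda>n \<omega>. spec_int n \<omega> g) (\<integral>x. g x \<partial>mu_sc \<theta>)"
proof -
  interpret mu: prob_space "mu_sc \<theta>" by (rule prob_space_mu_sc)
  have gm: "g \<in> borel_measurable borel" using g by (rule borel_measurable_continuous_onI)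
  have approx: "\<exists>f. f \<in> borel_measurable borel \<and> (\<forall>x. \<bar>f x - g x\<bar> \<le> \<delta>) \<and>
      integrable (mu_sc \<theta>) f \<and>
      tendsto_in_prob M (\<lambda>n \<omega>. spec_int n \<omega> f) (\<integral>x. f x \<partial>mu_sc \<theta>)" if \<delta>: "\<delta> > 0" for \<delta>
  proof -
    obtain N c t e where e: "e > 0"
      and ap: "\<And>x. \<bar>(\<Sum>k<N::nat. c k * cauchy_kernel e (x - t k)) - g x\<bar> \<le> \<delta>"
      by (rule cauchy_kernel_approx[OF g _ R \<delta>], erule supp, rule that)
    define f where "f x = (\<Sum>k<N. c k * cauchy_kernel e (x - t k))" for x
    have km: "(\<lambda>x. cauchy_kernel e (x - t k)) \<in> borel_measurable borel" for k
      unfolding cauchy_kernel_def by measurable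
    have fm: "f \<in> borel_measurable borel"
      unfolding f_def[abs_def] using km by (intro borel_measurable_sum borel_measurable_times) auto
    have kb: "norm (cauchy_kernel e u) \<le> 1 / e" for u
    proof -
      have "cauchy_kernel e u \<le> e / e\<^sup>2"
        unfolding cauchy_kernel_def using e by (intro divide_left_mono) (auto simp: add_pos_nonneg)
      then show ?thesis using e cauchy_kernel_nonneg[OF e, of u] by (simp add: power2_eq_square)
    qed
    have ki: "integrable (mu_sc \<theta>) (\<lambda>x. cauchy_kernel e (x - t k))" for k
      using km kb by (intro mu.integrable_const_bound[where B = "1 / e"]) (auto cong: measurable_cong_sets)
    have "spec_int n \<omega> f = (\<Sum>k<N. c k * spec_int n \<omega> (\<lambda>x. cauchy_kernel e (x - t k)))" for n \<omega>
      unfolding spec_int_eq[OF fm] spec_int_eq[OF km] f_def sum_distrib_left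
      by (subst sum.swap) (simp add: mult_ac)
    moreover have "(\<integral>x. f x \<partial>mu_sc \<theta>) = (\<Sum>k<N. c k * (\<integral>x. cauchy_kernel e (x - t k) \<partial>mu_sc \<theta>))"
      unfolding f_def using ki by (simp add: Bochner_Integration.integral_sum)
    ultimately have "tendsto_in_prob M (\<lambda>n \<omega>. spec_int n \<omega> f) (\<integral>x. f x \<partial>mu_sc \<theta>)"
      by (simp only:) (intro tendsto_in_prob_sum prob_M tendsto_spec_cauchy[OF e])
    moreover have "integrable (mu_sc \<theta>) f"
      unfolding f_def[abs_def] using ki by (intro Bochner_Integration.integrable_sum integrable_mult_right)
    ultimately show ?thesis using fm ap unfolding f_def by blast
  qed
  \<comment> \<open>Approximants are fixed by choice so that the sequence at \<delta> = 1 / (k + 1)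
    is available for the measurability of the limit.\<close>
  define F where "F \<delta> = (SOME f. f \<in> borel_measurable borel \<and> (\<forall>x. \<bar>f x - g x\<bar> \<le> \<delta>) \<and>
      integrable (mu_sc \<theta>) f \<and>
      tendsto_in_prob M (\<lambda>n \<omega>. spec_int n \<omega> f) (\<integral>x. f x \<partial>mu_sc \<theta>))" for \<delta>
  have F: "F \<delta> \<in> borel_measurable borel" "\<bar>F \<delta> x - g x\<bar> \<le> \<delta>" "integrable (mu_sc \<theta>) (F \<delta>)"
    "tendsto_in_prob M (\<lambda>n \<omega>. spec_int n \<omega> (F \<delta>)) (\<integral>x. F \<delta> x \<partial>mu_sc \<theta>)"
    if \<delta>: "\<delta> > 0" for \<delta> x
  proof -
    have P: "F \<delta> \<in> borel_measurable borel \<and> (\<forall>x. \<bar>F \<delta> x - g x\<bar> \<le> \<delta>) \<and> integrable (mu_sc \<theta>) (F \<delta>) \<and>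
        tendsto_in_prob M (\<lambda>n \<omega>. spec_int n \<omega> (F \<delta>)) (\<integral>x. F \<delta> x \<partial>mu_sc \<theta>)"
      unfolding F_def by (rule someI_ex[OF approx[OF \<delta>]])
    show "F \<delta> \<in> borel_measurable borel" "\<bar>F \<delta> x - g x\<bar> \<le> \<delta>" "integrable (mu_sc \<theta>) (F \<delta>)"
      "tendsto_in_prob M (\<lambda>n \<omega>. spec_int n \<omega> (F \<delta>)) (\<integral>x. F \<delta> x \<partial>mu_sc \<theta>)"
      using P by (simp_all only: simp_thms)
  qed
  have close: "\<bar>spec_int n \<omega> (F \<delta>) - spec_int n \<omega> g\<bar> \<le> \<delta>"
    if "\<delta> > 0" "n \<ge> 1" "\<omega> \<in> space (M n)" for \<delta> n \<omega>
    using spec_int_diff_le[OF that(2,3) F(1)[OF that(1)] gm F(2)[OF that(1)]] spec_int_const[OF that(2,3)]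
    by simp
  have meas: "(\<lambda>\<omega>. spec_int n \<omega> g) \<in> borel_measurable (M n)" if n: "n \<ge> 1" for n
  proof (rule borel_measurable_LIMSEQ_real)
    show "(\<lambda>\<omega>. spec_int n \<omega> (F (1 / real (Suc k)))) \<in> borel_measurable (M n)" for k
      using F(4)[of "1 / real (Suc k)"] n by (simp add: tendsto_in_prob_def)
    fix \<omega> assume \<omega>: "\<omega> \<in> space (M n)"
    have "(\<lambda>k. spec_int n \<omega> (F (1 / real (Suc k))) - spec_int n \<omega> g) \<longlonglongrightarrow> 0"
      by (rule Lim_null_comparison[OF _ LIMSEQ_inverse_real_of_nat])
        (use close[OF _ n \<omega>] in \<open>auto simp: inverse_eq_divide\<close>)
    then show "(\<lambda>k. spec_int n \<omega> (F (1 / real (Suc k)))) \<longlonglongrightarrow> spec_int n \<omega> g"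
      by (rule LIM_zero_cancel)
  qed
  show ?thesis
  proof (rule tendsto_in_prob_approx[OF prob_M meas])
    fix \<epsilon> :: real assume \<epsilon>: "\<epsilon> > 0"
    define \<delta> where "\<delta> = \<epsilon> / 3"
    have \<delta>: "\<delta> > 0" using \<epsilon> by (simp add: \<delta>_def)
    let ?m = "\<integral>x. F \<delta> x \<partial>mu_sc \<theta>"
    have gi: "integrable (mu_sc \<theta>) g"
    proof -
      have "integrable (mu_sc \<theta>) (\<lambda>x. F \<delta> x - g x)"
        using F(1,2)[OF \<delta>] gm by (intro mu.integrable_const_bound[where B = \<delta>])
          (auto cong: measurable_cong_sets)
      from Bochner_Integration.integrable_diff[OF F(3)[OF \<delta>] this] show ?thesis by simp
    qed
    have mu_close: "\<bar>?m - (\<integral>x. g x \<partial>mu_sc \<theta>)\<bar> \<le> \<delta>"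
    proof -
      have "?m - (\<integral>x. g x \<partial>mu_sc \<theta>) = (\<integral>x. F \<delta> x - g x \<partial>mu_sc \<theta>)"
        using F(3)[OF \<delta>] gi by simp
      also have "\<bar>\<dots>\<bar> \<le> (\<integral>x. \<bar>F \<delta> x - g x\<bar> \<partial>mu_sc \<theta>)" by (rule integral_abs_bound)
      also have "\<dots> \<le> (\<integral>x. \<delta> \<partial>mu_sc \<theta>)"
        using F(2,3)[OF \<delta>] gi by (intro integral_mono) auto
      finally show ?thesis using mu.prob_space by simp
    qed
    have "\<bar>spec_int n \<omega> g - (\<integral>x. g x \<partial>mu_sc \<theta>)\<bar> \<le> \<epsilon>"
      if "n \<ge> 1" "\<omega> \<in> space (M n)" "\<bar>spec_int n \<omega> (F \<delta>) - ?m\<bar> \<le> \<delta>" for n \<omega>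
      using close[OF \<delta> that(1,2)] mu_close that(3) unfolding \<delta>_def by linarith
    then show "\<exists>U u V v. \<exists>\<delta>>0. tendsto_in_prob M U u \<and> tendsto_in_prob M V v \<and>
        (\<forall>n\<ge>1. \<forall>\<omega>\<in>space (M n). \<bar>U n \<omega> - u\<bar> \<le> \<delta> \<longrightarrow> \<bar>V n \<omega> - v\<bar> \<le> \<delta> \<longrightarrow>
          \<bar>spec_int n \<omega> g - (\<integral>x. g x \<partial>mu_sc \<theta>)\<bar> \<le> \<epsilon>)"
      using F(4)[OF \<delta>] \<delta>
      by (intro exI[of _ "\<lambda>n \<omega>. spec_int n \<omega> (F \<delta>)"] exI[of _ ?m] exI[of _ \<delta>]) simp
  qed
qed

definition cutoff :: "real \<Rightarrow> real \<Rightarrow> real" where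
  "cutoff R x = max 0 (min 1 (R + 1 - \<bar>x\<bar>))"

lemma cutoff:
  "continuous_on UNIV (cutoff R)" "0 \<le> cutoff R x" "cutoff R x \<le> 1"
  "\<bar>x\<bar> \<le> R \<Longrightarrow> cutoff R x = 1" "\<bar>x\<bar> \<ge> R + 1 \<Longrightarrow> cutoff R x = 0"
  unfolding cutoff_def by (auto intro!: continuous_intros)

lemma tendsto_spec_bounded:
  assumes f: "continuous_on UNIV f" and fb: "bounded (range f)"
  shows "tendsto_in_prob M (\<lambda>n \<omega>. spec_int n \<omega> f) (\<integral>x. f x \<partial>mu_sc \<theta>)"
proof -
  interpret mu: prob_space "mu_sc \<theta>" by (rule prob_space_mu_sc)
  obtain K0 where "\<forall>x. \<bar>f x\<bar> \<le> K0" using fb by (auto simp: bounded_iff)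
  then have K: "\<bar>f x\<bar> \<le> max K0 1" for x by (meson max.coboundedI1)
  define K where "K = max K0 1"
  have Kpos: "K > 0" by (simp add: K_def)
  have fm: "f \<in> borel_measurable borel" using f by (rule borel_measurable_continuous_onI)
  have cm: "cutoff R \<in> borel_measurable borel" for R
    using cutoff(1) by (rule borel_measurable_continuous_onI)
  \<comment> \<open>Large enough for bulk and atom. For theta = 0 the convention 1 / 0 = 0 makes it
    2.\<close>
  define R where "R = 2 + \<bar>\<theta> + 1 / \<theta>\<bar>"
  have R: "R > 0" by (simp add: R_def)
  have cfc: "continuous_on UNIV (\<lambda>x. f x * cutoff r x)" for r
    by (intro continuous_intros f cutoff(1))
  have cfz: "f x * cutoff r x = 0" if "\<bar>x\<bar> \<ge> r + 1" for r x using cutoff(5)[OF that] by simp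
  \<comment> \<open>The push-forward map takes all its values between -R and R, so integrands that
    agree there have equal integrals.\<close>
  have mu_eq: "(\<integral>x. h x \<partial>mu_sc \<theta>) = (\<integral>x. h' x \<partial>mu_sc \<theta>)"
    if h: "h \<in> borel_measurable borel" "h' \<in> borel_measurable borel" "\<And>x. \<bar>x\<bar> \<le> R \<Longrightarrow> h x = h' x"
    for h h' :: "real \<Rightarrow> real"
  proof -
    have "\<bar>sc_map \<theta> t\<bar> \<le> R" for t
    proof -
      have "\<bar>- 2 * cos t\<bar> \<le> 2" using abs_cos_le_one[of t] by (simp add: abs_mult)
      then show ?thesis unfolding sc_map_def R_def by (cases "t \<le> pi") simp_all
    qed
    then show ?thesis
      unfolding mu_sc_eq_distr using h by (simp add: integral_distr)
  qed
  have T1: "tendsto_in_prob M (\<lambda>n \<omega>. spec_int n \<omega> (\<lambda>x. f x * cutoff R x)) (\<integral>x. f x \<partial>mu_sc \<theta>)"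
  proof -
    have "(\<integral>x. f x * cutoff R x \<partial>mu_sc \<theta>) = (\<integral>x. f x \<partial>mu_sc \<theta>)"
      using fm cm[of R] by (intro mu_eq) (auto simp: cutoff(4))
    then show ?thesis
      using tendsto_spec_compact_support[where g = "\<lambda>x. f x * cutoff R x" and R = "R + 1", OF cfc cfz] R by simp
  qed
  \<comment> \<open>Convergence of the cutoff integral to the full mass 1 bounds the spectral mass
    beyond R.\<close>
  have T2: "tendsto_in_prob M (\<lambda>n \<omega>. spec_int n \<omega> (cutoff R)) 1"
  proof -
    have "(\<integral>x. cutoff R x \<partial>mu_sc \<theta>) = (\<integral>x. 1 \<partial>mu_sc \<theta>)"
      using cm[of R] by (intro mu_eq) (auto simp: cutoff(4))
    then have "(\<integral>x. cutoff R x \<partial>mu_sc \<theta>) = 1" using mu.prob_space by simp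
    then show ?thesis
      using tendsto_spec_compact_support[where g = "cutoff R" and R = "R + 1", OF cutoff(1) cutoff(5)] R by simp
  qed
  show ?thesis
  proof (rule tendsto_in_prob_approx[OF prob_M])
    fix n :: nat assume n: "n \<ge> 1"
    show "(\<lambda>\<omega>. spec_int n \<omega> f) \<in> borel_measurable (M n)"
    proof (rule borel_measurable_LIMSEQ_real)
      show "(\<lambda>\<omega>. spec_int n \<omega> (\<lambda>x. f x * cutoff (real k) x)) \<in> borel_measurable (M n)" for k
        using tendsto_spec_compact_support[where g = "\<lambda>x. f x * cutoff (real k) x" and R = "real k + 1", OF cfc cfz] n
        by (simp add: tendsto_in_prob_def)
      fix \<omega> assume "\<omega> \<in> space (M n)"
      \<comment> \<open>For fixed \<omega> there are only n eigenvalues, so the truncated integrals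
        are eventually constant in k.\<close>
      show "(\<lambda>k. spec_int n \<omega> (\<lambda>x. f x * cutoff (real k) x)) \<longlonglongrightarrow> spec_int n \<omega> f"
      proof (rule tendsto_eventually)
        obtain N :: nat where N: "(\<Sum>i<n. \<bar>ls n \<omega> i\<bar>) \<le> N" using real_arch_simple by blast
        show "eventually (\<lambda>k. spec_int n \<omega> (\<lambda>x. f x * cutoff (real k) x) = spec_int n \<omega> f) sequentially"
          using eventually_ge_at_top[of N]
        proof eventually_elim
          case (elim k)
          have "cutoff (real k) (ls n \<omega> i) = 1" if "i < n" for i
          proof (rule cutoff(4))
            have "\<bar>ls n \<omega> i\<bar> \<le> (\<Sum>i<n. \<bar>ls n \<omega> i\<bar>)" using that by (intro member_le_sum) auto
            then show "\<bar>ls n \<omega> i\<bar> \<le> real k" using N elim by linarith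
          qed
          then show ?case using fm cm by (simp add: spec_int_eq)
        qed
      qed
    qed
  next
    fix \<epsilon> :: real assume \<epsilon>: "\<epsilon> > 0"
    \<comment> \<open>One \<delta> pays for the truncated function, K \<delta> for the mass outside
      the cutoff.\<close>
    define \<delta> where "\<delta> = \<epsilon> / (1 + K)"
    have \<delta>: "\<delta> > 0" "\<delta> + K * \<delta> = \<epsilon>"
    proof -
      show "\<delta> > 0" using \<epsilon> Kpos by (simp add: \<delta>_def)
      have "(1 + K) * \<delta> = \<epsilon>" using Kpos by (simp add: \<delta>_def)
      then show "\<delta> + K * \<delta> = \<epsilon>" by (simp add: distrib_right)
    qed
    have "\<bar>spec_int n \<omega> f - (\<integral>x. f x \<partial>mu_sc \<theta>)\<bar> \<le> \<epsilon>"
      if n: "n \<ge> 1" and \<omega>: "\<omega> \<in> space (M n)"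
        and 1: "\<bar>spec_int n \<omega> (\<lambda>x. f x * cutoff R x) - (\<integral>x. f x \<partial>mu_sc \<theta>)\<bar> \<le> \<delta>"
        and 2: "\<bar>spec_int n \<omega> (cutoff R) - 1\<bar> \<le> \<delta>" for n \<omega>
    proof -
      have "\<bar>spec_int n \<omega> f - spec_int n \<omega> (\<lambda>x. f x * cutoff R x)\<bar> \<le> spec_int n \<omega> (\<lambda>x. K * (1 - cutoff R x))"
      proof (rule spec_int_diff_le[OF n \<omega> fm])
        fix x
        have "f x - f x * cutoff R x = f x * (1 - cutoff R x)" by (simp add: right_diff_distrib)
        also have "\<bar>\<dots>\<bar> \<le> K * (1 - cutoff R x)"
          unfolding abs_mult using K[of x] cutoff(3)[of R x] by (intro mult_mono) (auto simp: K_def)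
        finally show "\<bar>f x - f x * cutoff R x\<bar> \<le> K * (1 - cutoff R x)" .
      qed (use fm cm in auto)
      also have "\<dots> = K * (1 - spec_int n \<omega> (cutoff R))"
      proof -
        let ?c = "\<lambda>k. wt n \<omega> k" and ?l = "\<lambda>k. cutoff R (ls n \<omega> k)"
        have "(\<Sum>k<n. ?c k * (K * (1 - ?l k))) = K * ((\<Sum>k<n. ?c k) - (\<Sum>k<n. ?c k * ?l k))"
          unfolding sum_subtractf[symmetric] sum_distrib_left
          by (intro sum.cong refl) (simp add: algebra_simps)
        then show ?thesis using cm[of R] by (simp add: spec_int_eq spectral_weights[OF n \<omega>])
      qed
      also have "\<dots> \<le> K * \<delta>" using 2 Kpos by (intro mult_left_mono) auto
      finally show ?thesis using 1 \<delta>(2) by linarith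
    qed
    then show "\<exists>U u V v. \<exists>\<delta>>0. tendsto_in_prob M U u \<and> tendsto_in_prob M V v \<and>
        (\<forall>n\<ge>1. \<forall>\<omega>\<in>space (M n). \<bar>U n \<omega> - u\<bar> \<le> \<delta> \<longrightarrow> \<bar>V n \<omega> - v\<bar> \<le> \<delta> \<longrightarrow>
          \<bar>spec_int n \<omega> f - (\<integral>x. f x \<partial>mu_sc \<theta>)\<bar> \<le> \<epsilon>)"
      using T1 T2 \<delta>(1)
      by (intro exI[of _ "\<lambda>n \<omega>. spec_int n \<omega> (\<lambda>x. f x * cutoff R x)"]
          exI[of _ "\<integral>x. f x \<partial>mu_sc \<theta>"] exI[of _ "\<lambda>n \<omega>. spec_int n \<omega> (cutoff R)"]
          exI[of _ "1 :: real"] exI[of _ \<delta>]) simp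
  qed
qed

end

theorem proposition2:
  fixes M :: "nat \<Rightarrow> 'a measure"
    and P :: "'b measure" and \<xi> :: "'b \<Rightarrow> real"
    and X A :: "nat \<Rightarrow> 'a \<Rightarrow> real Matrix.mat"
    and v :: "nat \<Rightarrow> 'a \<Rightarrow> real Matrix.vec"
    and \<theta> :: real
    and ls :: "nat \<Rightarrow> 'a \<Rightarrow> nat \<Rightarrow> real"
    and \<phi> :: "nat \<Rightarrow> 'a \<Rightarrow> nat \<Rightarrow> real Matrix.vec"
  assumes "prob_space P"
    and "\<xi> \<in> borel_measurable P"
    and "\<And>k :: nat. integrable P (\<lambda>\<omega>. \<xi> \<omega> ^ k)"
    and "(\<integral>\<omega>. \<xi> \<omega> \<partial>P) = 0"
    and "(\<integral>\<omega>. (\<xi> \<omega>)\<^sup>2 \<partial>P) = 1"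
    and "\<And>n. n \<ge> 1 \<Longrightarrow> prob_space (M n)"
    and "\<And>n \<omega>. n \<ge> 1 \<Longrightarrow> \<omega> \<in> space (M n) \<Longrightarrow>
           X n \<omega> \<in> carrier_mat n n \<and> transpose_mat (X n \<omega>) = X n \<omega>"
    and "\<And>n. n \<ge> 1 \<Longrightarrow>
           prob_space.indep_vars (M n) (\<lambda>_. borel) (\<lambda>ij \<omega>. index_mat (X n \<omega>) ij)
             {(i, j). i \<le> j \<and> j < n}"
    and "\<And>n i j. i \<le> j \<Longrightarrow> j < n \<Longrightarrow>
           distr (M n) borel (\<lambda>\<omega>. index_mat (X n \<omega>) (i, j)) = distr P borel \<xi>"
    and "\<And>n \<omega>. n \<ge> 1 \<Longrightarrow> \<omega> \<in> space (M n) \<Longrightarrow>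
           A n \<omega> \<in> carrier_mat n n \<and> transpose_mat (A n \<omega>) = A n \<omega> \<and>
           char_poly (A n \<omega>) = [:- \<theta>, 1:] * [:0, 1:] ^ (n - 1)"
    and "\<And>n \<omega>. n \<ge> 1 \<Longrightarrow> \<omega> \<in> space (M n) \<Longrightarrow>
           v n \<omega> \<in> carrier_vec n \<and> scalar_prod (v n \<omega>) (v n \<omega>) = 1 \<and>
           eigenvector (A n \<omega>) (v n \<omega>) \<theta>"
    and "\<And>n. n \<ge> 1 \<Longrightarrow>
           indep_rv (M n) (borel_mat n) (X n) (borel_mat n) (A n)"
    and "\<And>n. n \<ge> 1 \<Longrightarrow>
           indep_rv (M n) (borel_mat n) (X n) (borel_vec n) (v n)"
    and "\<And>n \<omega>. n \<ge> 1 \<Longrightarrow> \<omega> \<in> space (M n) \<Longrightarrow>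
           ordered_eigenbasis n ((1 / sqrt (real n)) \<cdot>\<^sub>m X n \<omega> + A n \<omega>) (ls n \<omega>) (\<phi> n \<omega>)"
  shows "prob_space (mu_sc \<theta>) \<and>
    weak_conv_in_prob M (\<lambda>n \<omega>. spectral_measure n (ls n \<omega>) (\<phi> n \<omega>) (v n \<omega>)) (mu_sc \<theta>)"
proof -
  interpret spiked_wigner M P \<xi> X A v \<theta> ls \<phi>
    by (rule spiked_wigner.intro) (fact assms)+
  show ?thesis
    unfolding weak_conv_in_prob_def spec_int_def[symmetric]
    using prob_space_mu_sc tendsto_spec_bounded by blast
qed

end
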